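(* Let $T$ be a simple complete theory. Then for every $k\in\mathbb{N}^+$, $T$ is $1$-trivial if and only if $T$ is $k$-trivial.
   Context: $T$ is a complete first-order theory with infinite models, and $\mathbb{M}\models T$ is a monster model ($\kappa$-saturated and strongly $\kappa$-homogeneous for some sufficiently large $\kappa$); "small" means of size $<\kappa$. For tuples/small sets $A,B$ and a small set $D$, $A\mathrel{\perp\!\!\!\perp}_D B$ means that $\mathrm{tp}(A/BD)$ does not fork over $D$ (non-forking independence). A sequence $(a_i:i\in I)$ of tuples indexed by a small linear order is $D$-independent if $a_i\mathrel{\perp\!\!\!\perp}_D\{a_j:j<i\}$ for all $i\in I$. A finite sequence $(a_1,\dots,a_k)$ of tuples is a $k$-cycle over $D$ if every proper subsequence of it is $D$-independent but $(a_1,\dots,a_k)$ itself is not $D$-independent. For $k\in\mathbb{N}^+$, $T$ is $k$-trivial if there is no $(k+2)$-cycle over any small $D\subseteq\mathbb{M}$. (So $1$-trivial means: for all tuples $a,b,c$ and small $D$, if $a,b,c$ are pairwise independent over $D$ then $a\mathrel{\perp\!\!\!\perp}_D bc$.) *)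

theory Defs
  imports Main "HOL-Library.Sublist"
begin

unbundle cardinal_syntax

text \<open>A symbol belongs to the language iff it has an arity, so a language may have
  no function symbols or no relation symbols. Constants are function symbols of arity 0.\<close>

record ('f, 'r) language =
  fun_arity :: "'f \<Rightarrow> nat option"
  rel_arity :: "'r \<Rightarrow> nat option"

datatype 'f tm = Var nat | App 'f "'f tm list"

datatype ('f, 'r) fm =
    Eq "'f tm" "'f tm"
  | Rel 'r "'f tm list"
  | Neg "('f, 'r) fm"
  | Con "('f, 'r) fm" "('f, 'r) fm"
  | Ex nat "('f, 'r) fm"

fun wf_tm :: "('f, 'r) language \<Rightarrow> 'f tm \<Rightarrow> bool" where
  "wf_tm L (Var i) \<longleftrightarrow> True"
| "wf_tm L (App f ts) \<longleftrightarrow> fun_arity L f = Some (length ts) \<and> (\<forall>t\<in>set ts. wf_tm L t)"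

fun wf_fm :: "('f, 'r) language \<Rightarrow> ('f, 'r) fm \<Rightarrow> bool" where
  "wf_fm L (Eq s t) \<longleftrightarrow> wf_tm L s \<and> wf_tm L t"
| "wf_fm L (Rel r ts) \<longleftrightarrow> rel_arity L r = Some (length ts) \<and> (\<forall>t\<in>set ts. wf_tm L t)"
| "wf_fm L (Neg \<phi>) \<longleftrightarrow> wf_fm L \<phi>"
| "wf_fm L (Con \<phi> \<psi>) \<longleftrightarrow> wf_fm L \<phi> \<and> wf_fm L \<psi>"
| "wf_fm L (Ex i \<phi>) \<longleftrightarrow> wf_fm L \<phi>"

fun fv_tm :: "'f tm \<Rightarrow> nat set" where
  "fv_tm (Var i) = {i}"
| "fv_tm (App f ts) = (\<Union>t\<in>set ts. fv_tm t)"

fun fv :: "('f, 'r) fm \<Rightarrow> nat set" where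
  "fv (Eq s t) = fv_tm s \<union> fv_tm t"
| "fv (Rel r ts) = (\<Union>t\<in>set ts. fv_tm t)"
| "fv (Neg \<phi>) = fv \<phi>"
| "fv (Con \<phi> \<psi>) = fv \<phi> \<union> fv \<psi>"
| "fv (Ex i \<phi>) = fv \<phi> - {i}"

text \<open>The \<open>L\<close>-formulas \<open>\<phi>(x\<^sub>0, \<dots>, x\<^bsub>n-1\<^esub>)\<close>; for \<open>n = 0\<close> these are the sentences.\<close>

definition formulas :: "('f, 'r) language \<Rightarrow> nat \<Rightarrow> ('f, 'r) fm set" where
  "formulas L n = {\<phi>. wf_fm L \<phi> \<and> fv \<phi> \<subseteq> {..<n}}"

record ('f, 'r, 'm) struct =
  univ :: "'m set"
  fun_int :: "'f \<Rightarrow> 'm list \<Rightarrow> 'm"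
  rel_int :: "'r \<Rightarrow> 'm list \<Rightarrow> bool"

definition tuples :: "('f, 'r, 'm) struct \<Rightarrow> nat \<Rightarrow> 'm list set" where
  "tuples M n = {a \<in> lists (univ M). length a = n}"

definition is_structure :: "('f, 'r) language \<Rightarrow> ('f, 'r, 'm) struct \<Rightarrow> bool" where
  "is_structure L M \<longleftrightarrow> univ M \<noteq> {} \<and>
     (\<forall>f n. fun_arity L f = Some n \<longrightarrow> (\<forall>a\<in>tuples M n. fun_int M f a \<in> univ M))"

fun eval_tm :: "('f, 'r, 'm) struct \<Rightarrow> (nat \<Rightarrow> 'm) \<Rightarrow> 'f tm \<Rightarrow> 'm" where
  "eval_tm M v (Var i) = v i"
| "eval_tm M v (App f ts) = fun_int M f (map (eval_tm M v) ts)"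

fun sat :: "('f, 'r, 'm) struct \<Rightarrow> (nat \<Rightarrow> 'm) \<Rightarrow> ('f, 'r) fm \<Rightarrow> bool" where
  "sat M v (Eq s t) \<longleftrightarrow> eval_tm M v s = eval_tm M v t"
| "sat M v (Rel r ts) \<longleftrightarrow> rel_int M r (map (eval_tm M v) ts)"
| "sat M v (Neg \<phi>) \<longleftrightarrow> \<not> sat M v \<phi>"
| "sat M v (Con \<phi> \<psi>) \<longleftrightarrow> sat M v \<phi> \<and> sat M v \<psi>"
| "sat M v (Ex i \<phi>) \<longleftrightarrow> (\<exists>m\<in>univ M. sat M (v(i := m)) \<phi>)"

text \<open>\<open>M \<Turnstile> \<phi>(a)\<close>, meant for \<open>\<phi> \<in> formulas L (length a)\<close>: the values of the valuation
  beyond the length of \<open>a\<close> are then irrelevant.\<close>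

definition holds :: "('f, 'r, 'm) struct \<Rightarrow> ('f, 'r) fm \<Rightarrow> 'm list \<Rightarrow> bool" where
  "holds M \<phi> a \<longleftrightarrow> sat M ((!) a) \<phi>"

definition is_model ::
    "('f, 'r) language \<Rightarrow> ('f, 'r) fm set \<Rightarrow> ('f, 'r, 'm) struct \<Rightarrow> bool" where
  "is_model L T M \<longleftrightarrow> is_structure L M \<and> (\<forall>\<phi>\<in>T. holds M \<phi> [])"

text \<open>Semantic consequence. HOL cannot quantify over the types of all models; by the downward
  Loewenheim-Skolem theorem it makes no difference to test only those models whose
  universe is a set of elements of the type of formulas, which has at least \<open>|L| + \<aleph>\<^sub>0\<close> elements.\<close>

definition entails ::
    "('f, 'r) language \<Rightarrow> ('f, 'r) fm set \<Rightarrow> ('f, 'r) fm \<Rightarrow> bool" where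
  "entails L T \<phi> \<longleftrightarrow>
     (\<forall>N :: ('f, 'r, ('f, 'r) fm) struct. is_model L T N \<longrightarrow> holds N \<phi> [])"

definition complete_theory :: "('f, 'r) language \<Rightarrow> ('f, 'r) fm set \<Rightarrow> bool" where
  "complete_theory L T \<longleftrightarrow> T \<subseteq> formulas L 0 \<and>
     (\<forall>\<phi>\<in>formulas L 0. entails L T \<phi> \<or> entails L T (Neg \<phi>))"

text \<open>A pair \<open>(\<phi>, c)\<close> stands for the formula \<open>\<phi>(x, c)\<close> with parameters \<open>c\<close>, where
  \<open>x = (x\<^sub>0, \<dots>, x\<^bsub>n-1\<^esub>)\<close> and the parameters are substituted for the following variables.\<close>

type_synonym ('f, 'r, 'm) pfm = "('f, 'r) fm \<times> 'm list"

definition pformulas ::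
    "('f, 'r) language \<Rightarrow> 'm set \<Rightarrow> nat \<Rightarrow> ('f, 'r, 'm) pfm set" where
  "pformulas L C n = {(\<phi>, c). c \<in> lists C \<and> \<phi> \<in> formulas L (n + length c)}"

definition realizes ::
    "('f, 'r, 'm) struct \<Rightarrow> 'm list \<Rightarrow> ('f, 'r, 'm) pfm set \<Rightarrow> bool" where
  "realizes M a p \<longleftrightarrow> (\<forall>(\<phi>, c)\<in>p. holds M \<phi> (a @ c))"

definition finitely_satisfiable ::
    "('f, 'r, 'm) struct \<Rightarrow> nat \<Rightarrow> ('f, 'r, 'm) pfm set \<Rightarrow> bool" where
  "finitely_satisfiable M n p \<longleftrightarrow>
     (\<forall>p0. finite p0 \<and> p0 \<subseteq> p \<longrightarrow> (\<exists>a\<in>tuples M n. realizes M a p0))"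

definition tp ::
    "('f, 'r) language \<Rightarrow> ('f, 'r, 'm) struct \<Rightarrow> 'm list \<Rightarrow> 'm set \<Rightarrow> ('f, 'r, 'm) pfm set" where
  "tp L M a C = {(\<phi>, c) \<in> pformulas L C (length a). holds M \<phi> (a @ c)}"

definition small :: "'k rel \<Rightarrow> 'a set \<Rightarrow> bool" where
  "small \<kappa> A \<longleftrightarrow> |A| <o \<kappa>"

definition saturated ::
    "('f, 'r) language \<Rightarrow> 'k rel \<Rightarrow> ('f, 'r, 'm) struct \<Rightarrow> bool" where
  "saturated L \<kappa> M \<longleftrightarrow>
     (\<forall>C n p. C \<subseteq> univ M \<and> small \<kappa> C \<and> p \<subseteq> pformulas L C n \<and> finitely_satisfiable M n p
        \<longrightarrow> (\<exists>a\<in>tuples M n. realizes M a p))"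

definition elementary_map ::
    "('f, 'r) language \<Rightarrow> ('f, 'r, 'm) struct \<Rightarrow> 'm set \<Rightarrow> ('m \<Rightarrow> 'm) \<Rightarrow> bool" where
  "elementary_map L M A g \<longleftrightarrow> A \<subseteq> univ M \<and> g ` A \<subseteq> univ M \<and>
     (\<forall>a\<in>lists A. \<forall>\<phi>\<in>formulas L (length a). holds M \<phi> a \<longleftrightarrow> holds M \<phi> (map g a))"

definition automorphism ::
    "('f, 'r) language \<Rightarrow> ('f, 'r, 'm) struct \<Rightarrow> ('m \<Rightarrow> 'm) \<Rightarrow> bool" where
  "automorphism L M \<sigma> \<longleftrightarrow> bij_betw \<sigma> (univ M) (univ M) \<and>
     (\<forall>f n. fun_arity L f = Some n \<longrightarrow>
        (\<forall>a\<in>tuples M n. \<sigma> (fun_int M f a) = fun_int M f (map \<sigma> a))) \<and>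
     (\<forall>r n. rel_arity L r = Some n \<longrightarrow>
        (\<forall>a\<in>tuples M n. rel_int M r a \<longleftrightarrow> rel_int M r (map \<sigma> a)))"

definition strongly_homogeneous ::
    "('f, 'r) language \<Rightarrow> 'k rel \<Rightarrow> ('f, 'r, 'm) struct \<Rightarrow> bool" where
  "strongly_homogeneous L \<kappa> M \<longleftrightarrow>
     (\<forall>A g. small \<kappa> A \<and> elementary_map L M A g \<longrightarrow>
        (\<exists>\<sigma>. automorphism L M \<sigma> \<and> (\<forall>a\<in>A. \<sigma> a = g a)))"

text \<open>``Sufficiently large'' is read as \<open>\<kappa> > |L| + \<aleph>\<^sub>0\<close>, the number of \<open>L\<close>-formulas. As \<open>T\<close> is
  complete, it has infinite models iff its model \<open>M\<close> is infinite.\<close>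

definition monster_model ::
    "('f, 'r) language \<Rightarrow> ('f, 'r) fm set \<Rightarrow> 'k rel \<Rightarrow> ('f, 'r, 'm) struct \<Rightarrow> bool" where
  "monster_model L T \<kappa> M \<longleftrightarrow> is_model L T M \<and> infinite (univ M) \<and>
     Card_order \<kappa> \<and> |{\<phi>. wf_fm L \<phi>}| <o \<kappa> \<and>
     saturated L \<kappa> M \<and> strongly_homogeneous L \<kappa> M"

text \<open>\<open>k\<close>-inconsistency of the family \<open>(\<phi>(x, b\<^sub>i))\<^sub>i\<close> refers to sets of \<open>k\<close> indices, since the
  \<open>b\<^sub>i\<close> need not be distinct.\<close>

definition k_inconsistent ::
    "('f, 'r, 'm) struct \<Rightarrow> nat \<Rightarrow> ('f, 'r) fm \<Rightarrow> nat \<Rightarrow> (nat \<Rightarrow> 'm list) \<Rightarrow> bool" where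
  "k_inconsistent M n \<phi> k b \<longleftrightarrow>
     (\<forall>I. finite I \<and> card I = k \<longrightarrow> \<not> (\<exists>a\<in>tuples M n. \<forall>i\<in>I. holds M \<phi> (a @ b i)))"

text \<open>The nodes of the tree \<open>\<omega>\<^bsup><\<omega>\<^esup>\<close> are finite lists; the branch given by \<open>\<beta> \<in> \<omega>\<^sup>\<omega>\<close> passes
  through the initial segments of \<open>\<beta>\<close>. The parameter at the root plays no role.\<close>

definition tree_property ::
    "('f, 'r, 'm) struct \<Rightarrow> nat \<Rightarrow> nat \<Rightarrow> ('f, 'r) fm \<Rightarrow> bool" where
  "tree_property M n m \<phi> \<longleftrightarrow>
     (\<exists>k (b :: nat list \<Rightarrow> 'm list). (\<forall>s. b s \<in> tuples M m) \<and>
        (\<forall>s. k_inconsistent M n \<phi> k (\<lambda>i. b (s @ [i]))) \<and>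
        (\<forall>\<beta> :: nat \<Rightarrow> nat.
           finitely_satisfiable M n {(\<phi>, b (map \<beta> [0..<j])) | j. j \<ge> 1}))"
  for M :: "('f, 'r, 'm) struct"

definition simple_theory :: "('f, 'r) language \<Rightarrow> ('f, 'r, 'm) struct \<Rightarrow> bool" where
  "simple_theory L M \<longleftrightarrow> (\<forall>n m. \<forall>\<phi>\<in>formulas L (n + m). \<not> tree_property M n m \<phi>)"

definition divides ::
    "('f, 'r) language \<Rightarrow> ('f, 'r, 'm) struct \<Rightarrow> nat \<Rightarrow> ('f, 'r, 'm) pfm \<Rightarrow> 'm set \<Rightarrow> bool" where
  "divides L M n \<psi> D \<longleftrightarrow> (case \<psi> of (\<phi>, b) \<Rightarrow>
     (\<exists>k (b' :: nat \<Rightarrow> 'm list).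
        (\<forall>i. b' i \<in> tuples M (length b) \<and> tp L M (b' i) D = tp L M b D) \<and>
        k_inconsistent M n \<phi> k b'))"
  for M :: "('f, 'r, 'm) struct"

text \<open>A partial type in \<open>n\<close> variables over a small set forks over \<open>D\<close> iff it implies a finite
  disjunction of formulas with arbitrary parameters, each of which divides over \<open>D\<close>.
  By saturation, implication may be tested in \<open>M\<close>.\<close>

definition forks ::
    "('f, 'r) language \<Rightarrow> ('f, 'r, 'm) struct \<Rightarrow> nat \<Rightarrow> ('f, 'r, 'm) pfm set \<Rightarrow> 'm set \<Rightarrow> bool" where
  "forks L M n p D \<longleftrightarrow>
     (\<exists>\<Psi>. finite \<Psi> \<and> \<Psi> \<subseteq> pformulas L (univ M) n \<and> (\<forall>\<psi>\<in>\<Psi>. divides L M n \<psi> D) \<and>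
        (\<forall>a\<in>tuples M n. realizes M a p \<longrightarrow> (\<exists>\<psi>\<in>\<Psi>. realizes M a {\<psi>})))"

text \<open>\<open>A\<close> is independent from \<open>B\<close> over \<open>D\<close>. As every formula of \<open>tp(A/BD)\<close> mentions only finitely
  many variables, \<open>tp(A/BD)\<close> forks over \<open>D\<close> iff \<open>tp(a/BD)\<close> does for some finite tuple \<open>a\<close> of
  elements of \<open>A\<close>.\<close>

definition indep ::
    "('f, 'r) language \<Rightarrow> ('f, 'r, 'm) struct \<Rightarrow> 'm set \<Rightarrow> 'm set \<Rightarrow> 'm set \<Rightarrow> bool" where
  "indep L M A D B \<longleftrightarrow> (\<forall>a\<in>lists A. \<not> forks L M (length a) (tp L M a (B \<union> D)) D)"

text \<open>A tuple enters the notion of independence only through the set of its entries: permuting or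
  repeating entries does not affect forking. A sequence of (possibly infinite) tuples is therefore
  represented by the list of the sets of their entries.\<close>

definition indep_seq ::
    "('f, 'r) language \<Rightarrow> ('f, 'r, 'm) struct \<Rightarrow> 'm set \<Rightarrow> 'm set list \<Rightarrow> bool" where
  "indep_seq L M D as \<longleftrightarrow> (\<forall>i<length as. indep L M (as ! i) D (\<Union>j<i. as ! j))"

definition is_cycle ::
    "('f, 'r) language \<Rightarrow> ('f, 'r, 'm) struct \<Rightarrow> 'm set \<Rightarrow> 'm set list \<Rightarrow> bool" where
  "is_cycle L M D as \<longleftrightarrow>
     (\<forall>bs. strict_subseq bs as \<longrightarrow> indep_seq L M D bs) \<and> \<not> indep_seq L M D as"

text \<open>The cardinal \<open>\<mu>\<close> bounds the length of the tuples (strictly): \<open>\<mu> = \<aleph>\<^sub>0\<close> gives finite tuples,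
  \<open>\<mu> = \<kappa>\<close> arbitrary small tuples.\<close>

definition k_trivial ::
    "('f, 'r) language \<Rightarrow> 'k rel \<Rightarrow> 'l rel \<Rightarrow> ('f, 'r, 'm) struct \<Rightarrow> nat \<Rightarrow> bool" where
  "k_trivial L \<kappa> \<mu> M k \<longleftrightarrow>
     \<not> (\<exists>D as. D \<subseteq> univ M \<and> small \<kappa> D \<and> length as = k + 2 \<and>
            (\<forall>A\<in>set as. A \<subseteq> univ M \<and> |A| <o \<mu>) \<and> is_cycle L M D as)"

end

(* A cycle may be shrunk to finite tuples, and moving one entry a of an (m+1)-cycle over D into the base
gives an m-cycle over D a, by transitivity of independence. So everything rests on making cycles longer.

Given a cycle (e_1, ..., e_m, c) over D with m >= 2, let e = (e_1, ..., e_m) and take copies of e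
that have the type of e over D c and are independent over D c. Since c depends on e over D, a long
sequence of copies cannot be independent over D: each copy lowers a fixed finite local rank of the
type of c. Some copies therefore form a cycle over D; there are at least two of them. Replacing each
copy by its m entries yields again a cycle: a proper part of a copy is independent from c over D, hence
from the other copies.

The theory of forking is derived from the local ranks alone, without indiscernible sequences.
Existence and symmetry follow from the rank argument above: if b depended on a while a is
independent from b, then copies of a over b, independent in reverse order, would lower the rank
of the type of b too often. *)
theory Submission
  imports Defs "HOL-Library.Countable"
begin

subsection \<open>Definable predicates\<close>

text \<open>Symmetry is to be proved, so nothing before it may use it. What is available without it
  is that a set which divides over D still divides over D c, with the same k, when c is independent
  over D from its parameters (\<open>k_divides_extend\<close>); transitivity on the left follows.
  Keeping k and the formula is essential: every dividing set met in the rank argument is a conjugate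
  of one of finitely many given sets, so a finite collection of formulas fixed in advance measures
  every drop, and simplicity bounds its rank. The same lemma dictates that \<open>weight\<close>
  asks for the earlier copies to be independent from the next one: sets with parameters on the side
  of the next copy must keep dividing over the earlier copies. The copies in the proof of symmetry
  are therefore produced last to first. With r copies the new cycle has length r m, where r >= 2 is
  not known in advance; r m > m + 1 since m >= 2. The required length k + 2 is hence reached by
  overshooting and shortening. Types are replaced by families of definable sets, and equality of
  types by conjugacy under automorphisms, so that dividing needs only sequences of
  automorphisms.\<close>

lemma eval_tm_cong: "(\<And>i. i \<in> fv_tm t \<Longrightarrow> v i = w i) \<Longrightarrow> eval_tm M v t = eval_tm M w t"
proof (induction t)
  case (App f ts)
  then have "map (eval_tm M v) ts = map (eval_tm M w) ts" by fastforce
  then show ?case by (metis eval_tm.simps(2))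
qed simp

lemma sat_cong: "(\<And>i. i \<in> fv \<phi> \<Longrightarrow> v i = w i) \<Longrightarrow> sat M v \<phi> \<longleftrightarrow> sat M w \<phi>"
proof (induction \<phi> arbitrary: v w)
  case (Eq s t)
  then show ?case using eval_tm_cong[of s v w M] eval_tm_cong[of t v w M] by simp
next
  case (Rel r ts)
  then have "map (eval_tm M v) ts = map (eval_tm M w) ts"
    by (auto intro!: eval_tm_cong)
  then show ?case by (metis sat.simps(2))
next
  case (Neg \<phi>)
  then show ?case by (metis fv.simps(3) sat.simps(3))
next
  case (Con \<phi>1 \<phi>2)
  then show ?case by (metis Un_iff fv.simps(4) sat.simps(4))
next
  case (Ex i \<phi>)
  have "sat M (v(i := m)) \<phi> = sat M (w(i := m)) \<phi>" for m
    using Ex.prems by (intro Ex.IH) auto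
  then show ?case by simp
qed

lemma finite_fv_tm: "finite (fv_tm t)"
  by (induction t) auto

lemma finite_fv: "finite (fv \<phi>)"
  by (induction \<phi>) (auto simp: finite_fv_tm)

fun sub_tm :: "(nat \<Rightarrow> nat) \<Rightarrow> 'f tm \<Rightarrow> 'f tm" where
  "sub_tm f (Var i) = Var (f i)"
| "sub_tm f (App g ts) = App g (map (sub_tm f) ts)"

lemma eval_sub_tm: "eval_tm M v (sub_tm f t) = eval_tm M (v \<circ> f) t"
proof (induction t)
  case (App g ts)
  then have "map (eval_tm M v) (map (sub_tm f) ts) = map (eval_tm M (v \<circ> f)) ts"
    by (simp add: o_def)
  then show ?case by (metis eval_tm.simps(2) sub_tm.simps(2))
qed simp

lemma fv_sub_tm: "fv_tm (sub_tm f t) = f ` fv_tm t"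
  by (induction t) auto

lemma wf_sub_tm: "wf_tm L (sub_tm f t) \<longleftrightarrow> wf_tm L t"
  by (induction t) auto

text \<open>Substitution is described by its effect on \<open>sat\<close> instead of by a recursive
  function, so that under a quantifier any fresh bound variable may be chosen.\<close>

lemma ex_subst:
  "wf_fm L \<phi> \<Longrightarrow> \<exists>\<phi>'. wf_fm L \<phi>' \<and> fv \<phi>' \<subseteq> f ` fv \<phi> \<and> (\<forall>v. sat M v \<phi>' \<longleftrightarrow> sat M (v \<circ> f) \<phi>)"
proof (induction \<phi> arbitrary: f)
  case (Eq s t)
  then show ?case
    by (intro exI[of _ "Eq (sub_tm f s) (sub_tm f t)"])
       (auto simp: wf_sub_tm fv_sub_tm eval_sub_tm o_def)
next
  case (Rel r ts)
  have "map (eval_tm M v) (map (sub_tm f) ts) = map (eval_tm M (v \<circ> f)) ts" for v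
    by (simp add: eval_sub_tm)
  then have "sat M v (Rel r (map (sub_tm f) ts)) \<longleftrightarrow> sat M (v \<circ> f) (Rel r ts)" for v
    by (metis sat.simps(2))
  moreover have "wf_fm L (Rel r (map (sub_tm f) ts))" "fv (Rel r (map (sub_tm f) ts)) \<subseteq> f ` fv (Rel r ts)"
    using Rel by (auto simp: wf_sub_tm fv_sub_tm)
  ultimately show ?case by blast
next
  case (Neg \<phi>)
  then obtain \<phi>' where "wf_fm L \<phi>'" "fv \<phi>' \<subseteq> f ` fv \<phi>" "\<forall>v. sat M v \<phi>' \<longleftrightarrow> sat M (v \<circ> f) \<phi>"
    by fastforce
  then show ?case by (intro exI[of _ "Neg \<phi>'"]) (auto simp: o_def)
next
  case (Con \<phi> \<psi>)
  then obtain \<phi>' \<psi>' where "wf_fm L \<phi>'" "fv \<phi>' \<subseteq> f ` fv \<phi>" "\<forall>v. sat M v \<phi>' \<longleftrightarrow> sat M (v \<circ> f) \<phi>"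
    "wf_fm L \<psi>'" "fv \<psi>' \<subseteq> f ` fv \<psi>" "\<forall>v. sat M v \<psi>' \<longleftrightarrow> sat M (v \<circ> f) \<psi>"
    by (metis wf_fm.simps(4))
  then show ?case by (intro exI[of _ "Con \<phi>' \<psi>'"]) (auto simp: o_def)
next
  case (Ex i \<phi>)
  \<comment> \<open>The bound variable must avoid the images of all free variables of \<phi>;
    otherwise one of them could be captured.\<close>
  obtain z where z: "z \<notin> f ` fv \<phi>"
    using ex_new_if_finite[OF infinite_UNIV_nat] finite_fv by blast
  obtain \<phi>' where \<phi>': "wf_fm L \<phi>'" "fv \<phi>' \<subseteq> f(i := z) ` fv \<phi>"
      "\<And>v. sat M v \<phi>' \<longleftrightarrow> sat M (v \<circ> f(i := z)) \<phi>"
    using Ex by (metis wf_fm.simps(5))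
  have "sat M (v(z := m) \<circ> f(i := z)) \<phi> \<longleftrightarrow> sat M ((v \<circ> f)(i := m)) \<phi>" for v m
    using z by (intro sat_cong) auto
  then have "sat M v (Ex z \<phi>') \<longleftrightarrow> sat M (v \<circ> f) (Ex i \<phi>)" for v
    using \<phi>'(3) by simp
  moreover have "fv (Ex z \<phi>') \<subseteq> f ` fv (Ex i \<phi>)"
    using \<phi>'(2) by (auto split: if_splits)
  ultimately show ?case using \<phi>'(1) by (intro exI[of _ "Ex z \<phi>'"]) (auto simp: o_def)
qed

text \<open>Formulas refer to variables by position. Moving \<phi> from \<open>ts\<close> to another
  list containing its entries brings two formulas to a common list, or puts selected variables at
  the end.\<close>

lemma ex_reindex:
  assumes "\<phi> \<in> formulas L (length ts)" "set ts \<subseteq> set us"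
  obtains \<phi>' where "\<phi>' \<in> formulas L (length us)"
    "\<And>g. holds M \<phi>' (map g us) \<longleftrightarrow> holds M \<phi> (map g ts)"
proof -
  have "\<forall>i. \<exists>j. i < length ts \<longrightarrow> j < length us \<and> us ! j = ts ! i"
    by (metis assms(2) in_set_conv_nth nth_mem subsetD)
  then obtain f where f: "\<And>i. i < length ts \<Longrightarrow> f i < length us \<and> us ! f i = ts ! i" by metis
  obtain \<phi>' where \<phi>': "wf_fm L \<phi>'" "fv \<phi>' \<subseteq> f ` fv \<phi>" "\<And>v. sat M v \<phi>' \<longleftrightarrow> sat M (v \<circ> f) \<phi>"
    using ex_subst assms(1) unfolding formulas_def by blast
  have "holds M \<phi>' (map g us) \<longleftrightarrow> holds M \<phi> (map g ts)" for g
    unfolding holds_def \<phi>'(3) using assms(1) f by (intro sat_cong) (auto simp: formulas_def)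
  moreover have "\<phi>' \<in> formulas L (length us)"
    using \<phi>' f assms(1) by (force simp: formulas_def)
  ultimately show ?thesis using that by blast
qed

text \<open>One quantifier is used per entry, each time removing the last variable; this is why the
  quantified block has to stand at the end.\<close>

lemma ex_formula:
  assumes "\<phi> \<in> formulas L (n + k)"
  obtains \<phi>' where "\<phi>' \<in> formulas L n"
    "\<And>a. length a = n \<Longrightarrow> holds M \<phi>' a \<longleftrightarrow> (\<exists>b\<in>tuples M k. holds M \<phi> (a @ b))"
proof -
  have "\<exists>\<phi>'. \<phi>' \<in> formulas L n \<and>
      (\<forall>a. length a = n \<longrightarrow> (holds M \<phi>' a \<longleftrightarrow> (\<exists>b\<in>tuples M k. holds M \<phi> (a @ b))))"
    using assms
  proof (induction k arbitrary: \<phi>)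
    case 0
    have "tuples M 0 = {[]}" by (auto simp: tuples_def)
    then show ?case using 0 by auto
  next
    case (Suc k)
    let ?\<psi> = "Ex (n + k) \<phi>"
    have \<psi>: "?\<psi> \<in> formulas L (n + k)" using Suc.prems by (fastforce simp: formulas_def less_Suc_eq)
    have *: "holds M ?\<psi> a \<longleftrightarrow> (\<exists>m\<in>univ M. holds M \<phi> (a @ [m]))" if "length a = n + k" for a
    proof -
      have "sat M (((!) a)(n + k := m)) \<phi> \<longleftrightarrow> sat M ((!) (a @ [m])) \<phi>" for m
        using Suc.prems that by (intro sat_cong) (force simp: formulas_def nth_append less_Suc_eq)
      then show ?thesis by (simp add: holds_def)
    qed
    have "(\<exists>b\<in>tuples M k. holds M ?\<psi> (a @ b)) \<longleftrightarrow> (\<exists>b\<in>tuples M (Suc k). holds M \<phi> (a @ b))"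
      (is "?l \<longleftrightarrow> ?r") if "length a = n" for a
    proof
      assume ?l
      then obtain b where b: "b \<in> tuples M k" "holds M ?\<psi> (a @ b)" by blast
      moreover have "length (a @ b) = n + k" using b that by (simp add: tuples_def)
      ultimately obtain m where m: "m \<in> univ M" "holds M \<phi> ((a @ b) @ [m])" using * by blast
      then show ?r using b(1) by (intro bexI[of _ "b @ [m]"]) (auto simp: tuples_def)
    next
      assume ?r
      then obtain c where c: "c \<in> tuples M (Suc k)" "holds M \<phi> (a @ c)" by blast
      then obtain b m where "c = b @ [m]" by (cases c rule: rev_cases) (auto simp: tuples_def)
      then show ?l using c * that by (intro bexI[of _ b]) (auto simp: tuples_def)
    qed
    then show ?case using Suc.IH[OF \<psi>] by auto
  qed
  then show ?thesis using that by blast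
qed

text \<open>The list \<open>ts\<close> holds the arguments of \<phi>: \<open>Inl i\<close> is the
  variable i, \<open>Inr c\<close> the parameter c. Naming arguments by an index set instead of by
  positions gives closure under connectives, substitution and quantifiers without renumbering. As
  \<open>ts\<close> is a list, P reads only finitely many coordinates of v.\<close>

definition definable ::
    "('f, 'r) language \<Rightarrow> ('f, 'r, 'm) struct \<Rightarrow> 'i set \<Rightarrow> 'm set \<Rightarrow> (('i \<Rightarrow> 'm) \<Rightarrow> bool) \<Rightarrow> bool" where
  "definable L M J C P \<longleftrightarrow> (\<exists>ts \<phi>. set ts \<subseteq> J <+> C \<and> \<phi> \<in> formulas L (length ts) \<and>
     (\<forall>v. v ` J \<subseteq> univ M \<longrightarrow> (P v \<longleftrightarrow> holds M \<phi> (map (case_sum v id) ts))))"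

lemma definable_cong:
  "definable L M J C P \<Longrightarrow> (\<And>v. v ` J \<subseteq> univ M \<Longrightarrow> P v \<longleftrightarrow> Q v) \<Longrightarrow> definable L M J C Q"
  unfolding definable_def by simp

lemma definable_neg: "definable L M J C P \<Longrightarrow> definable L M J C (\<lambda>v. \<not> P v)"
proof -
  assume "definable L M J C P"
  then obtain ts \<phi> where "set ts \<subseteq> J <+> C" "\<phi> \<in> formulas L (length ts)"
     "\<forall>v. v ` J \<subseteq> univ M \<longrightarrow> (P v \<longleftrightarrow> holds M \<phi> (map (case_sum v id) ts))" unfolding definable_def by blast
  then show ?thesis unfolding definable_def
    by (intro exI[of _ ts] exI[of _ "Neg \<phi>"]) (auto simp: formulas_def holds_def)
qed

lemma definable_conj: "definable L M J C P \<Longrightarrow> definable L M J C Q \<Longrightarrow> definable L M J C (\<lambda>v. P v \<and> Q v)"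
proof -
  assume "definable L M J C P" "definable L M J C Q"
  then obtain ts \<phi> us \<psi> where t: "set ts \<subseteq> J <+> C" "\<phi> \<in> formulas L (length ts)"
     "\<forall>v. v ` J \<subseteq> univ M \<longrightarrow> (P v \<longleftrightarrow> holds M \<phi> (map (case_sum v id) ts))"
     and u: "set us \<subseteq> J <+> C" "\<psi> \<in> formulas L (length us)"
     "\<forall>v. v ` J \<subseteq> univ M \<longrightarrow> (Q v \<longleftrightarrow> holds M \<psi> (map (case_sum v id) us))" unfolding definable_def by metis
  obtain \<phi>' where \<phi>': "\<phi>' \<in> formulas L (length (ts @ us))"
     "\<And>g. holds M \<phi>' (map g (ts @ us)) \<longleftrightarrow> holds M \<phi> (map g ts)"
    using ex_reindex[OF t(2), of "ts @ us"] by auto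
  obtain \<psi>' where \<psi>': "\<psi>' \<in> formulas L (length (ts @ us))"
     "\<And>g. holds M \<psi>' (map g (ts @ us)) \<longleftrightarrow> holds M \<psi> (map g us)"
    using ex_reindex[OF u(2), of "ts @ us"] by auto
  have "holds M (Con \<phi>' \<psi>') a \<longleftrightarrow> holds M \<phi>' a \<and> holds M \<psi>' a" for a by (simp add: holds_def)
  moreover have "Con \<phi>' \<psi>' \<in> formulas L (length (ts @ us))"
    using \<phi>'(1) \<psi>'(1) by (simp add: formulas_def)
  ultimately show ?thesis unfolding definable_def
    using t u \<phi>'(2) \<psi>'(2) by (intro exI[of _ "ts @ us"] exI[of _ "Con \<phi>' \<psi>'"]) auto
qed

lemma definable_True: "univ M \<noteq> {} \<Longrightarrow> definable L M J C (\<lambda>v. True)"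
  unfolding definable_def
  by (intro exI[of _ "[]"] exI[of _ "Ex 0 (Eq (Var 0) (Var 0))"]) (auto simp: formulas_def holds_def)

lemma definable_Ball:
  assumes "univ M \<noteq> {}" "finite S" "\<And>s. s \<in> S \<Longrightarrow> definable L M J C (P s)"
  shows "definable L M J C (\<lambda>v. \<forall>s\<in>S. P s v)"
  using assms(2,3)
proof (induction S)
  case empty
  then show ?case using definable_True[OF assms(1)] by simp
next
  case (insert x S)
  then have "definable L M J C (\<lambda>v. P x v \<and> (\<forall>s\<in>S. P s v))" by (intro definable_conj) auto
  then show ?case by simp
qed

text \<open>A variable may be sent to another variable or to a parameter; in the second way fixed
  coordinates enter the parameter set.\<close>

lemma definable_subst:
  fixes M :: "('f, 'r, 'm) struct" and s :: "'i \<Rightarrow> 'j + 'm"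
  assumes "definable L M J C P" "s ` J \<subseteq> J' <+> C'" "C \<subseteq> C'" "C' \<subseteq> univ M"
  shows "definable L M J' C' (\<lambda>w. P (\<lambda>i. case_sum w id (s i)))"
proof -
  obtain ts \<phi> where t: "set ts \<subseteq> J <+> C" "\<phi> \<in> formulas L (length ts)"
     "\<And>v. v ` J \<subseteq> univ M \<Longrightarrow> (P v \<longleftrightarrow> holds M \<phi> (map (case_sum v id) ts))"
    using assms(1) unfolding definable_def by blast
  let ?us = "map (case_sum s Inr) ts"
  have "P (\<lambda>i. case_sum w id (s i)) \<longleftrightarrow> holds M \<phi> (map (case_sum w id) ?us)" if "w ` J' \<subseteq> univ M" for w
  proof -
    have "case_sum w id (s i) \<in> univ M" if "i \<in> J" for i
    proof -
      have "s i \<in> J' <+> C'" using assms(2) that by blast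
      then show ?thesis using assms(4) \<open>w ` J' \<subseteq> univ M\<close> by auto
    qed
    then have "(\<lambda>i. case_sum w id (s i)) ` J \<subseteq> univ M" by blast
    moreover have "map (case_sum w id) ?us = map (case_sum (\<lambda>i. case_sum w id (s i)) id) ts"
      by (auto split: sum.splits)
    ultimately show ?thesis by (simp only: t(3))
  qed
  moreover have "set ?us \<subseteq> J' <+> C'"
  proof
    fix u assume "u \<in> set ?us"
    then obtain x where x: "x \<in> J <+> C" "u = case_sum s Inr x" using t(1) by auto
    then show "u \<in> J' <+> C'" using assms(2,3) by (cases x) auto
  qed
  ultimately show ?thesis unfolding definable_def using t(2) by (intro exI[of _ ?us] exI[of _ \<phi>]) auto
qed

text \<open>The left summand of the index type \<open>nat + 'i\<close> carries the tuple to be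
  quantified, the right summand the variables that remain.\<close>

lemma definable_ex:
  fixes M :: "('f, 'r, 'm) struct" and J :: "'i set"
  assumes "definable L M (Inl ` {..<n} \<union> Inr ` J) C P"
  shows "definable L M J C (\<lambda>v. \<exists>x\<in>tuples M n. P (case_sum ((!) x) v))"
proof -
  let ?K = "Inl ` {..<n} \<union> Inr ` J :: (nat + 'i) set"
  obtain ts \<phi> where t: "set ts \<subseteq> ?K <+> C" "\<phi> \<in> formulas L (length ts)"
     "\<And>v. v ` ?K \<subseteq> univ M \<Longrightarrow> (P v \<longleftrightarrow> holds M \<phi> (map (case_sum v id) ts))"
    using assms unfolding definable_def by blast
  define old :: "'i + 'm \<Rightarrow> (nat + 'i) + 'm" where "old = case_sum (Inl \<circ> Inr) Inr"
  define xs :: "((nat + 'i) + 'm) list" where "xs = map (Inl \<circ> Inl) [0..<n]"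
  \<comment> \<open>Arguments outside the quantified block go first and the block \<open>xs\<close>
    goes last, the shape that \<open>ex_formula\<close> requires.\<close>
  define us where "us = filter (\<lambda>t. t \<notin> set xs) ts"
  have "set us \<subseteq> old ` (J <+> C)"
  proof
    fix t assume "t \<in> set us"
    then have "t \<in> ?K <+> C" "t \<notin> set xs" using t(1) by (auto simp: us_def)
    then show "t \<in> old ` (J <+> C)"
    proof (elim PlusE)
      fix j assume "j \<in> ?K" "t = Inl j" "t \<notin> set xs"
      then obtain i where "i \<in> J" "j = Inr i" unfolding xs_def by auto
      then have "t = old (Inl i)" using \<open>t = Inl j\<close> by (simp add: old_def)
      then show "t \<in> old ` (J <+> C)" using \<open>i \<in> J\<close> by blast
    next
      fix c assume "c \<in> C" "t = Inr c"
      then have "t = old (Inr c)" by (simp add: old_def)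
      then show "t \<in> old ` (J <+> C)" using \<open>c \<in> C\<close> by blast
    qed
  qed
  then have "us \<in> lists (old ` (J <+> C))" by (simp only: lists_eq_set mem_Collect_eq)
  then have "us \<in> map old ` lists (J <+> C)" by (simp only: lists_image)
  then obtain ws where ws: "us = map old ws" "set ws \<subseteq> J <+> C" by auto
  obtain \<phi>' where \<phi>': "\<phi>' \<in> formulas L (length (us @ xs))"
     "\<And>g. holds M \<phi>' (map g (us @ xs)) \<longleftrightarrow> holds M \<phi> (map g ts)"
    using ex_reindex[OF t(2), of "us @ xs" M] by (auto simp: us_def)
  have "\<phi>' \<in> formulas L (length ws + n)" using \<phi>'(1) by (simp add: ws xs_def)
  then obtain \<psi> where \<psi>: "\<psi> \<in> formulas L (length ws)"
    "\<And>a. length a = length ws \<Longrightarrow> holds M \<psi> a \<longleftrightarrow> (\<exists>b\<in>tuples M n. holds M \<phi>' (a @ b))"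
    using ex_formula by blast
  have "(\<exists>x\<in>tuples M n. P (case_sum ((!) x) v)) \<longleftrightarrow> holds M \<psi> (map (case_sum v id) ws)"
    if v: "v ` J \<subseteq> univ M" for v
  proof -
    have "P (case_sum ((!) x) v) \<longleftrightarrow> holds M \<phi>' (map (case_sum v id) ws @ x)"
      if x: "x \<in> tuples M n" for x
    proof -
      let ?g = "case_sum (case_sum ((!) x) v) id :: (nat + 'i) + 'm \<Rightarrow> 'm"
      have "case_sum ((!) x) v ` ?K \<subseteq> univ M" using v x by (auto simp: tuples_def in_lists_conv_set)
      then have "P (case_sum ((!) x) v) \<longleftrightarrow> holds M \<phi>' (map ?g (us @ xs))" using t(3) \<phi>'(2) by blast
      moreover have "map ?g xs = x" using x by (auto simp: xs_def tuples_def intro: nth_equalityI)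
      moreover have "map ?g us = map (case_sum v id) ws" by (auto simp: ws old_def split: sum.splits)
      ultimately show ?thesis by simp
    qed
    then show ?thesis using \<psi>(2) by auto
  qed
  then show ?thesis unfolding definable_def using ws(2) \<psi>(1)
    by (intro exI[of _ ws] exI[of _ \<psi>]) auto
qed

section \<open>The monster model and smallness\<close>

locale monster =
  fixes L :: "('f, 'r) language" and T :: "('f, 'r) fm set"
    and M :: "('f, 'r, 'm) struct" and \<kappa> :: "'k rel"
  assumes monster: "monster_model L T \<kappa> M"
begin

abbreviation "U \<equiv> univ M"
abbreviation "tup \<equiv> tuples M"
abbreviation "ind \<equiv> indep L M"
abbreviation "ind_seq \<equiv> indep_seq L M"

definition small_in :: "'m set \<Rightarrow> bool" where "small_in D \<longleftrightarrow> D \<subseteq> U \<and> small \<kappa> D"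

lemma struct: "is_structure L M" and U_ne: "U \<noteq> {}"
  using monster by (auto simp: monster_model_def is_model_def is_structure_def)

text \<open>There are infinitely many formulas already of the form
  \<open>Eq (Var i) (Var i)\<close>, and \<kappa> exceeds the number of all formulas.\<close>

lemma infinite_Field: "infinite (Field \<kappa>)"
proof
  assume "finite (Field \<kappa>)"
  moreover have "Card_order \<kappa>" "|{\<phi>. wf_fm L \<phi>}| <o \<kappa>" using monster by (auto simp: monster_model_def)
  ultimately have "finite {\<phi>. wf_fm L \<phi>}"
    by (metis card_of_Field_ordIso card_of_ordLeq_finite ordIso_iff_ordLeq ordLeq_transitive ordLess_imp_ordLeq)
  moreover have "(\<lambda>i. Eq (Var i) (Var i)) ` UNIV \<subseteq> {\<phi>. wf_fm L \<phi>}" by auto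
  moreover have "inj (\<lambda>i. Eq (Var i) (Var i) :: ('f, 'r) fm)" by (auto simp: inj_on_def)
  ultimately show False by (metis finite_imageD infinite_UNIV_nat rev_finite_subset)
qed

lemma small_in_finite: "finite A \<Longrightarrow> A \<subseteq> U \<Longrightarrow> small_in A"
  using finite_ordLess_infinite[OF card_of_Well_order _ _ infinite_Field, of A] monster
  by (auto simp: small_in_def small_def monster_model_def card_order_on_def Field_card_of)

lemma small_in_Un: "small_in A \<Longrightarrow> small_in B \<Longrightarrow> small_in (A \<union> B)"
  using card_of_Un_ordLess_infinite_Field[OF infinite_Field] monster
  by (auto simp: small_in_def small_def monster_model_def)

lemma small_in_subset: "small_in A \<Longrightarrow> B \<subseteq> A \<Longrightarrow> small_in B"
  unfolding small_in_def small_def using card_of_mono1 ordLeq_ordLess_trans by blast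

lemma small_inD: "small_in A \<Longrightarrow> A \<subseteq> U" by (simp add: small_in_def)

lemma tuplesI: "set a \<subseteq> U \<Longrightarrow> length a = n \<Longrightarrow> a \<in> tup n"
  by (auto simp: tuples_def)

lemma tuplesD: "a \<in> tup n \<Longrightarrow> set a \<subseteq> U \<and> length a = n"
  by (auto simp: tuples_def)

lemma tuples_ne: "tup n \<noteq> {}"
proof -
  obtain u where "u \<in> U" using U_ne by blast
  then have "replicate n u \<in> tup n" by (auto simp: tuples_def)
  then show ?thesis by blast
qed

subsection \<open>Definable sets and compactness\<close>

definition dset :: "nat \<Rightarrow> ('f, 'r, 'm) pfm \<Rightarrow> 'm list set" where
  "dset n \<psi> = {a \<in> tup n. holds M (fst \<psi>) (a @ snd \<psi>)}"

text \<open>The type of a tuple over C is handled as the family of members of \<open>Def C n\<close>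
  that contain it. Equivalent formulas are thereby identified, and parameters enter only through
  C.\<close>

definition Def :: "'m set \<Rightarrow> nat \<Rightarrow> 'm list set set" where
  "Def C n = dset n ` pformulas L C n"

lemma Def_subset: "X \<in> Def C n \<Longrightarrow> X \<subseteq> tup n"
  by (auto simp: Def_def dset_def)

lemma Def_mono: "X \<in> Def C n \<Longrightarrow> C \<subseteq> C' \<Longrightarrow> X \<in> Def C' n"
  unfolding Def_def pformulas_def by auto

lemma Def_finite_support:
  assumes "X \<in> Def C n"
  obtains B where "finite B" "B \<subseteq> C" "X \<in> Def B n"
proof -
  obtain \<phi> c where c: "c \<in> lists C" "\<phi> \<in> formulas L (n + length c)" "X = dset n (\<phi>, c)"
    using assms by (auto simp: Def_def pformulas_def)
  then have "X \<in> Def (set c) n" by (auto simp: Def_def pformulas_def)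
  with c(1) show ?thesis by (intro that[of "set c"]) auto
qed

lemma definable_Def:
  assumes "X \<in> Def C n" "set ts \<subseteq> J <+> C" "length ts = n" "C \<subseteq> U"
  shows "definable L M J C (\<lambda>v. map (case_sum v id) ts \<in> X)"
proof -
  obtain \<phi> c where c: "c \<in> lists C" "\<phi> \<in> formulas L (n + length c)" "X = dset n (\<phi>, c)"
    using assms by (auto simp: Def_def pformulas_def)
  have "map (case_sum v id) ts \<in> X \<longleftrightarrow> holds M \<phi> (map (case_sum v id) (ts @ map Inr c))"
    if "v ` J \<subseteq> U" for v
  proof -
    have "case_sum v id t \<in> U" if "t \<in> set ts" for t
    proof -
      have "t \<in> J <+> C" using assms(2) that by blast
      then show ?thesis using \<open>v ` J \<subseteq> U\<close> assms(4) by auto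
    qed
    then have "map (case_sum v id) ts \<in> tup n" using assms(3) by (auto simp: tuples_def)
    moreover have "map (case_sum v id \<circ> Inr) c = c" by (simp add: comp_def)
    ultimately show ?thesis by (simp add: c(3) dset_def)
  qed
  moreover have "set (ts @ map Inr c) \<subseteq> J <+> C" using assms(2) c(1) by auto
  moreover have "\<phi> \<in> formulas L (length (ts @ map Inr c))" using c(2) assms(3) by simp
  ultimately show ?thesis unfolding definable_def by blast
qed

lemma DefI:
  assumes "definable L M {..<n} C P" "X = {a \<in> tup n. P ((!) a)}"
  shows "X \<in> Def C n"
proof -
  obtain ts \<phi> where t: "set ts \<subseteq> {..<n} <+> C" "\<phi> \<in> formulas L (length ts)"
     "\<And>v. v ` {..<n} \<subseteq> U \<Longrightarrow> (P v \<longleftrightarrow> holds M \<phi> (map (case_sum v id) ts))"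
    using assms(1) unfolding definable_def by blast
  have fin: "finite {c \<in> C. Inr c \<in> set ts}"
    by (rule finite_subset[of _ "projr ` set ts"]) force+
  then obtain c where c: "set c = {c \<in> C. Inr c \<in> set ts}" using finite_list by blast
  \<comment> \<open>Variables first, then the finitely many parameters that occur: the order in
    which \<open>dset\<close> evaluates a formula.\<close>
  let ?us = "map Inl [0..<n] @ map Inr c"
  have "set ts \<subseteq> set ?us"
  proof
    fix t assume "t \<in> set ts"
    then show "t \<in> set ?us" using t(1) c by (cases t) auto
  qed
  then obtain \<psi> where \<psi>: "\<psi> \<in> formulas L (length ?us)"
     "\<And>g. holds M \<psi> (map g ?us) \<longleftrightarrow> holds M \<phi> (map g ts)"
    using ex_reindex[OF t(2)] by blast
  have "holds M \<psi> (a @ c) \<longleftrightarrow> P ((!) a)" if "a \<in> tup n" for a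
  proof -
    have "map (case_sum ((!) a) id) ?us = a @ c"
      using that by (auto simp: tuples_def map_nth comp_def)
    moreover have "(!) a ` {..<n} \<subseteq> U" using that by (auto simp: tuples_def in_lists_conv_set)
    ultimately show ?thesis using t(3) \<psi>(2) by metis
  qed
  then have "X = dset n (\<psi>, c)" unfolding assms(2) dset_def by auto
  moreover have "(\<psi>, c) \<in> pformulas L C n" using \<psi>(1) c by (auto simp: pformulas_def)
  ultimately show ?thesis by (auto simp: Def_def)
qed

lemma map_nth_vars: "a \<in> tup n \<Longrightarrow> map (case_sum ((!) a) id) (map Inl [0..<n]) = a"
  by (auto simp: comp_def map_nth tuples_def)

lemma definable_mem:
  assumes "X \<in> Def C n" "C \<subseteq> U"
  shows "definable L M {..<n} C (\<lambda>v. map (case_sum v id) (map Inl [0..<n]) \<in> X)"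
  by (rule definable_Def[OF assms(1)]) (use assms(2) in auto)

lemma Def_compl: "X \<in> Def C n \<Longrightarrow> C \<subseteq> U \<Longrightarrow> tup n - X \<in> Def C n"
  by (rule DefI[OF definable_neg[OF definable_mem]]) (auto simp: map_nth_vars simp del: map_map)

lemma Def_Inter:
  assumes "finite S" "\<And>X. X \<in> S \<Longrightarrow> X \<in> Def C n" "C \<subseteq> U"
  shows "{a \<in> tup n. \<forall>X\<in>S. a \<in> X} \<in> Def C n"
proof (rule DefI[OF definable_Ball[OF U_ne assms(1) definable_mem[OF assms(2,3)]]])
  show "{a \<in> tup n. \<forall>X\<in>S. a \<in> X} =
      {a \<in> tup n. \<forall>X\<in>S. map (case_sum ((!) a) id) (map Inl [0..<n]) \<in> X}"
    by (intro Collect_cong conj_cong refl) (simp only: map_nth_vars)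
qed

lemma Def_Int: "X \<in> Def C n \<Longrightarrow> Y \<in> Def C n \<Longrightarrow> C \<subseteq> U \<Longrightarrow> X \<inter> Y \<in> Def C n"
proof -
  assume "X \<in> Def C n" "Y \<in> Def C n" "C \<subseteq> U"
  then have "{a \<in> tup n. \<forall>Z\<in>{X, Y}. a \<in> Z} \<in> Def C n" by (intro Def_Inter) auto
  moreover have "{a \<in> tup n. \<forall>Z\<in>{X, Y}. a \<in> Z} = X \<inter> Y"
    using Def_subset[OF \<open>X \<in> Def C n\<close>] by auto
  ultimately show ?thesis by simp
qed

lemma Def_full: "tup n \<in> Def C n"
  by (rule DefI[OF definable_True[OF U_ne]]) auto

lemma Def_preimage:
  assumes "X \<in> Def C n" "set ts \<subseteq> {..<m} <+> C" "length ts = n" "C \<subseteq> U"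
  shows "{a \<in> tup m. map (case_sum ((!) a) id) ts \<in> X} \<in> Def C m"
  by (rule DefI[OF definable_Def[OF assms]]) simp

lemma Def_fiber:
  assumes "X \<in> Def C (n + length d)" "set d \<subseteq> U" "C \<subseteq> U"
  shows "{a \<in> tup n. a @ d \<in> X} \<in> Def (C \<union> set d) n"
proof -
  let ?ts = "map Inl [0..<n] @ map Inr d"
  have "{a \<in> tup n. map (case_sum ((!) a) id) ?ts \<in> X} \<in> Def (C \<union> set d) n"
    using assms by (intro Def_preimage[OF Def_mono[OF assms(1)]]) auto
  moreover have "map (case_sum ((!) a) id) ?ts = a @ d" if "a \<in> tup n" for a
    using that by (auto simp: tuples_def comp_def map_nth)
  then have "{a \<in> tup n. map (case_sum ((!) a) id) ?ts \<in> X} = {a \<in> tup n. a @ d \<in> X}"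
    by (intro Collect_cong conj_cong refl) (simp only:)
  ultimately show ?thesis by (simp only:)
qed

lemma Def_fiber_left:
  assumes "X \<in> Def C (length d + n)" "set d \<subseteq> U" "C \<subseteq> U"
  shows "{a \<in> tup n. d @ a \<in> X} \<in> Def (C \<union> set d) n"
proof -
  let ?ts = "map Inr d @ map Inl [0..<n]"
  have "{a \<in> tup n. map (case_sum ((!) a) id) ?ts \<in> X} \<in> Def (C \<union> set d) n"
    using assms by (intro Def_preimage[OF Def_mono[OF assms(1)]]) auto
  moreover have "map (case_sum ((!) a) id) ?ts = d @ a" if "a \<in> tup n" for a
    using that by (auto simp: tuples_def comp_def map_nth)
  then have "{a \<in> tup n. map (case_sum ((!) a) id) ?ts \<in> X} = {a \<in> tup n. d @ a \<in> X}"
    by (intro Collect_cong conj_cong refl) (simp only:)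
  ultimately show ?thesis by (simp only:)
qed

text \<open>Turning the parameters in B into variables exhibits X as the fibre over d of a set
  defined over C alone. An automorphism over C then moves X by moving d, while W stays
  fixed.\<close>

lemma Def_split:
  assumes "X \<in> Def (C \<union> B) n" "C \<subseteq> U" "B \<subseteq> U"
  obtains d W where "set d \<subseteq> B" "W \<in> Def C (n + length d)" "X = {a \<in> tup n. a @ d \<in> W}"
proof -
  obtain \<phi> c where c: "c \<in> lists (C \<union> B)" "\<phi> \<in> formulas L (n + length c)" "X = dset n (\<phi>, c)"
    using assms by (auto simp: Def_def pformulas_def)
  define d where "d = filter (\<lambda>x. x \<in> B) c"
  define W0 where "W0 = dset (n + length c) (\<phi>, [])"
  have W0: "W0 \<in> Def C (n + length c)" unfolding Def_def W0_def using c(2) by (auto simp: pformulas_def)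
  have "\<exists>t. (t \<in> {n..<n + length d} <+> C) \<and> case_sum (\<lambda>i. d ! (i - n)) id t = x" if x: "x \<in> set c" for x
  proof (cases "x \<in> B")
    case True
    then have "x \<in> set d" using x by (simp add: d_def)
    then obtain i where "i < length d" "d ! i = x" by (auto simp: in_set_conv_nth)
    then show ?thesis by (intro exI[of _ "Inl (n + i)"]) auto
  next
    case False
    then show ?thesis using x c(1) by (intro exI[of _ "Inr x"]) auto
  qed
  \<comment> \<open>g replaces an entry of c by a variable if it lies in B and keeps it as a
    parameter otherwise; \<open>W0\<close> has all entries of c as variables.\<close>
  then obtain g where g: "\<And>x. x \<in> set c \<Longrightarrow> g x \<in> {n..<n + length d} <+> C"
    "\<And>x. x \<in> set c \<Longrightarrow> case_sum (\<lambda>i. d ! (i - n)) id (g x) = x" by metis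
  let ?ts = "map Inl [0..<n] @ map g c"
  let ?W = "{a \<in> tup (n + length d). map (case_sum ((!) a) id) ?ts \<in> W0}"
  have "set ?ts \<subseteq> {..<n + length d} <+> C"
  proof
    fix t assume "t \<in> set ?ts"
    then consider i where "i < n" "t = Inl i" | x where "x \<in> set c" "t = g x" by auto
    then show "t \<in> {..<n + length d} <+> C"
    proof cases
      case 2
      then have "t \<in> {n..<n + length d} <+> C" using g(1) by simp
      then show ?thesis by auto
    qed auto
  qed
  then have "?W \<in> Def C (n + length d)" using assms(2) by (intro Def_preimage[OF W0]) auto
  moreover have "X = {a \<in> tup n. a @ d \<in> ?W}"
  proof -
    have dB: "set d \<subseteq> B" by (auto simp: d_def)
    have "a \<in> X \<longleftrightarrow> a @ d \<in> ?W" if a: "a \<in> tup n" for a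
    proof -
      have "case_sum ((!) (a @ d)) id (g x) = x" if "x \<in> set c" for x
        using g[OF that] a by (cases "g x") (auto simp: nth_append tuples_def)
      then have "map (case_sum ((!) (a @ d)) id) (map g c) = c" by (simp add: map_idI)
      moreover have "map (case_sum ((!) (a @ d)) id) (map Inl [0..<n]) = a"
        using a by (auto simp: tuples_def comp_def nth_append intro: nth_equalityI)
      ultimately have "map (case_sum ((!) (a @ d)) id) ?ts = a @ c" by simp
      moreover have "a @ d \<in> tup (n + length d)" using a dB assms(3) by (auto simp: tuples_def)
      moreover have "a @ c \<in> tup (n + length c)" using a c(1) assms(2,3) by (auto simp: tuples_def)
      ultimately show ?thesis using a by (simp add: c(3) W0_def dset_def)
    qed
    then show ?thesis using c(3) by (auto simp: dset_def)
  qed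
  ultimately show ?thesis using that[of d ?W] by (auto simp: d_def)
qed

lemma saturation:
  assumes S: "S \<subseteq> Def C n" and C: "small_in C"
    and fin: "\<And>S0. finite S0 \<Longrightarrow> S0 \<subseteq> S \<Longrightarrow> \<exists>a\<in>tup n. \<forall>X\<in>S0. a \<in> X"
  shows "\<exists>a\<in>tup n. \<forall>X\<in>S. a \<in> X"
proof -
  define p where "p = {\<psi> \<in> pformulas L C n. dset n \<psi> \<in> S}"
  have iff: "realizes M a q \<longleftrightarrow> (\<forall>\<psi>\<in>q. a \<in> dset n \<psi>)" if "a \<in> tup n" for a q
    using that by (simp add: realizes_def dset_def case_prod_beta)
  have "finitely_satisfiable M n p"
    unfolding finitely_satisfiable_def
  proof (intro allI impI)
    fix p0 assume p0: "finite p0 \<and> p0 \<subseteq> p"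
    then obtain a where "a \<in> tup n" "\<forall>X\<in>dset n ` p0. a \<in> X"
      using fin[of "dset n ` p0"] by (auto simp: p_def)
    then show "\<exists>a\<in>tup n. realizes M a p0" using iff by auto
  qed
  moreover have "saturated L \<kappa> M" using monster by (simp add: monster_model_def)
  moreover have "p \<subseteq> pformulas L C n" by (auto simp: p_def)
  moreover have "C \<subseteq> U" "small \<kappa> C" using C by (auto simp: small_in_def)
  ultimately have "\<exists>a\<in>tup n. realizes M a p" unfolding saturated_def by simp
  then obtain a where a: "a \<in> tup n" "realizes M a p" by blast
  have "a \<in> X" if X: "X \<in> S" for X
  proof -
    obtain \<psi> where "\<psi> \<in> pformulas L C n" "X = dset n \<psi>"
      using S X unfolding Def_def by blast
    then have "\<psi> \<in> p" using X by (simp add: p_def)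
    then show ?thesis using a(2) iff[OF a(1)] \<open>X = dset n \<psi>\<close> by blast
  qed
  with a(1) show ?thesis by blast
qed

section \<open>Compactness for countably many variables\<close>

definition prefix_sat :: "((nat \<Rightarrow> 'm) \<Rightarrow> bool) set \<Rightarrow> 'm list \<Rightarrow> bool" where
  "prefix_sat F a \<longleftrightarrow> set a \<subseteq> U \<and> (\<forall>F0. finite F0 \<and> F0 \<subseteq> F \<longrightarrow>
     (\<exists>v. range v \<subseteq> U \<and> (\<forall>i<length a. v i = a ! i) \<and> (\<forall>P\<in>F0. P v)))"

text \<open>\<open>saturated\<close> supplies only finite tuples, so a solution of F in infinitely
  many variables is built one entry at a time. For finite F0, the entries m after which F0 remains
  solvable form a definable set: the finitely many later coordinates that F0 reads are quantified
  away. Saturation finds an m that lies in all these sets.\<close>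

lemma compactness_step:
  assumes F: "\<And>P. P \<in> F \<Longrightarrow> definable L M UNIV C P" and C: "small_in C" and a: "prefix_sat F a"
  shows "\<exists>m. prefix_sat F (a @ [m])"
proof -
  let ?l = "length a"
  define ext where "ext F0 m \<longleftrightarrow>
      (\<exists>v. range v \<subseteq> U \<and> (\<forall>i<length (a @ [m]). v i = (a @ [m]) ! i) \<and> (\<forall>P\<in>F0. P v))" for F0 m
  define Q where "Q F0 = {[m] | m. m \<in> U \<and> ext F0 m}" for F0
  have Q_iff: "[m] \<in> Q F0 \<longleftrightarrow> m \<in> U \<and> ext F0 m" for m F0
    unfolding Q_def by blast
  have Q_Def: "Q F0 \<in> Def (C \<union> set a) 1" if F0: "finite F0" "F0 \<subseteq> F" for F0
  proof -
    let ?C = "C \<union> set a"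
    have CU: "?C \<subseteq> U" using C a by (auto simp: prefix_sat_def small_in_def)
    have "definable L M UNIV C (\<lambda>v. \<forall>P\<in>F0. P v)" using F F0 by (intro definable_Ball[OF U_ne]) auto
    then obtain ts \<phi> where t: "set ts \<subseteq> UNIV <+> C" "\<phi> \<in> formulas L (length ts)"
      "\<And>v. range v \<subseteq> U \<Longrightarrow> ((\<forall>P\<in>F0. P v) \<longleftrightarrow> holds M \<phi> (map (case_sum v id) ts))"
      unfolding definable_def by blast
    have "finite {i. Inl i \<in> set ts}"
      by (rule finite_subset[of _ "projl ` set ts"]) force+
    then obtain N where N: "\<And>i. Inl i \<in> set ts \<Longrightarrow> i < N"
      unfolding finite_nat_set_iff_bounded by auto
    define P where "P v \<longleftrightarrow> holds M \<phi> (map (case_sum v id) ts)" for v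
    have P: "definable L M {..<N} C P" unfolding definable_def P_def
    proof (intro exI conjI allI impI)
      show "set ts \<subseteq> {..<N} <+> C"
      proof
        fix x assume "x \<in> set ts"
        then show "x \<in> {..<N} <+> C" using t(1) N by (cases x) auto
      qed
    qed (use t(2) in auto)
    \<comment> \<open>Coordinates before \<open>?l\<close> become parameters, coordinate
      \<open>?l\<close> becomes the one free variable, and the later ones are read from the
      quantified tuple of length N.\<close>
    define s :: "nat \<Rightarrow> (nat + nat) + 'm" where
      "s i = (if i < ?l then Inr (a ! i) else if i = ?l then Inl (Inr 0) else Inl (Inl i))" for i
    have "definable L M (Inl ` {..<N} \<union> Inr ` {..<1}) ?C (\<lambda>w. P (\<lambda>i. case_sum w id (s i)))"
      by (rule definable_subst[OF P _ _ CU]) (auto simp: s_def)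
    then have "definable L M {..<1} ?C (\<lambda>w. \<exists>x\<in>tup N. P (\<lambda>i. case_sum (case_sum ((!) x) w) id (s i)))"
      by (rule definable_ex)
    then show ?thesis
    proof (rule DefI)
      have "[m] \<in> Q F0 \<longleftrightarrow> (\<exists>x\<in>tup N. P (\<lambda>i. case_sum (case_sum ((!) x) ((!) [m])) id (s i)))"
        (is "_ \<longleftrightarrow> ?r") if m: "m \<in> U" for m
      proof
        assume "[m] \<in> Q F0"
        then obtain v where v: "range v \<subseteq> U" "\<And>i. i < Suc ?l \<Longrightarrow> v i = (a @ [m]) ! i" "\<forall>P\<in>F0. P v"
          unfolding Q_iff ext_def length_append_singleton by blast
        let ?x = "map v [0..<N]"
        have "map (case_sum v id) ts = map (case_sum (\<lambda>i. case_sum (case_sum ((!) ?x) ((!) [m])) id (s i)) id) ts"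
        proof (rule map_cong[OF refl])
          fix t assume t: "t \<in> set ts"
          show "case_sum v id t = case_sum (\<lambda>i. case_sum (case_sum ((!) ?x) ((!) [m])) id (s i)) id t"
          proof (cases t)
            case (Inl i)
            then have "i < N" using N t by blast
            then show ?thesis using Inl v(2)[of i] by (auto simp: s_def nth_append)
          qed simp
        qed
        moreover have "P v" using t(3)[OF v(1)] v(3) by (simp add: P_def)
        moreover have "?x \<in> tup N" using v(1) by (auto simp: tuples_def image_subset_iff)
        ultimately show ?r unfolding P_def by metis
      next
        assume ?r
        then obtain x where x: "x \<in> tup N" "P (\<lambda>i. case_sum (case_sum ((!) x) ((!) [m])) id (s i))" by blast
        \<comment> \<open>Coordinate \<open>?l\<close> has to be m. Coordinates from N on, which the
          formula for F0 does not read, take m as a default.\<close>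
        define v where "v i = (if i < ?l then a ! i else if i < N \<and> i \<noteq> ?l then x ! i else m)" for i
        have xU: "x ! i \<in> U" if "i < N" for i using x(1) that by (auto simp: tuples_def in_lists_conv_set)
        have "range v \<subseteq> U"
          using m a by (auto simp: v_def prefix_sat_def intro: xU)
        moreover have "map (case_sum v id) ts = map (case_sum (\<lambda>i. case_sum (case_sum ((!) x) ((!) [m])) id (s i)) id) ts"
        proof (rule map_cong[OF refl])
          fix t assume t: "t \<in> set ts"
          show "case_sum v id t = case_sum (\<lambda>i. case_sum (case_sum ((!) x) ((!) [m])) id (s i)) id t"
          proof (cases t)
            case (Inl i)
            then have "i < N" using N t by blast
            then show ?thesis using Inl by (auto simp: s_def v_def)
          qed simp
        qed
        then have "P v" using x(2) unfolding P_def by metis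
        ultimately have "\<forall>P\<in>F0. P v" using t(3) by (simp add: P_def)
        moreover have "\<forall>i<length (a @ [m]). v i = (a @ [m]) ! i" by (simp add: v_def nth_append)
        ultimately show "[m] \<in> Q F0" unfolding Q_iff ext_def using m \<open>range v \<subseteq> U\<close>
          by (intro conjI exI[of _ v])
      qed
      note * = this
      show "Q F0 = {b \<in> tup 1. \<exists>x\<in>tup N. P (\<lambda>i. case_sum (case_sum ((!) x) ((!) b)) id (s i))}" (is "_ = ?R")
      proof (rule set_eqI)
        fix b
        show "b \<in> Q F0 \<longleftrightarrow> b \<in> ?R"
        proof (cases "\<exists>m\<in>U. b = [m]")
          case True
          then show ?thesis using * by (auto simp: tuples_def)
        next
          case False
          then have "b \<notin> Q F0" by (auto simp: Q_def)
          moreover have "b \<notin> tup 1" using False by (auto simp: tuples_def length_Suc_conv)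
          ultimately show ?thesis by blast
        qed
      qed
    qed
  qed
  let ?S = "Q ` {F0. finite F0 \<and> F0 \<subseteq> F}"
  have S: "?S \<subseteq> Def (C \<union> set a) 1" using Q_Def by auto
  have smC: "small_in (C \<union> set a)" using C a by (intro small_in_Un[OF C] small_in_finite) (simp_all add: prefix_sat_def)
  have fin: "\<exists>b\<in>tup 1. \<forall>X\<in>S0. b \<in> X" if S0: "finite S0" "S0 \<subseteq> ?S" for S0
  proof -
    obtain G where G: "finite G" "G \<subseteq> {F0. finite F0 \<and> F0 \<subseteq> F}" "S0 = Q ` G"
      using finite_subset_image[OF S0] by blast
    \<comment> \<open>One solution of the finite set \<open>\<Union>G\<close> serves all members of
      G at once: its entry at \<open>?l\<close> lies in every \<open>Q F0\<close>.\<close>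
    then have "finite (\<Union>G)" "\<Union>G \<subseteq> F" by auto
    then have "\<exists>v. range v \<subseteq> U \<and> (\<forall>i<?l. v i = a ! i) \<and> (\<forall>P\<in>\<Union>G. P v)"
      using a[unfolded prefix_sat_def, THEN conjunct2, rule_format, of "\<Union>G"] by simp
    then obtain v where v: "range v \<subseteq> U" "\<And>i. i < ?l \<Longrightarrow> v i = a ! i" "\<forall>P\<in>\<Union>G. P v" by blast
    have "[v ?l] \<in> Q F0" if "F0 \<in> G" for F0
    proof -
      have "\<forall>i<length (a @ [v ?l]). v i = (a @ [v ?l]) ! i" using v(2) by (simp add: nth_append less_Suc_eq)
      moreover have "\<forall>P\<in>F0. P v" using v(3) that by blast
      moreover have "v ?l \<in> U" using v(1) by blast
      ultimately show ?thesis using v(1) unfolding Q_iff ext_def by (intro conjI exI[of _ v])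
    qed
    moreover have "[v ?l] \<in> tup 1" using v(1) by (auto simp: tuples_def image_subset_iff)
    ultimately show ?thesis using G(3) by blast
  qed
  obtain b where b: "b \<in> tup 1" "\<forall>X\<in>?S. b \<in> X"
    by (rule bexE[OF saturation[OF S smC fin]])
  then obtain m where m: "b = [m]" "m \<in> U" by (auto simp: tuples_def length_Suc_conv)
  have "\<exists>v. range v \<subseteq> U \<and> (\<forall>i<length (a @ [m]). v i = (a @ [m]) ! i) \<and> (\<forall>P\<in>F0. P v)"
    if "finite F0 \<and> F0 \<subseteq> F" for F0
  proof -
    have "[m] \<in> Q F0" using b(2) m(1) that by blast
    then have "ext F0 m" by (simp only: Q_iff)
    then show ?thesis by (simp only: ext_def)
  qed
  then have "prefix_sat F (a @ [m])" unfolding prefix_sat_def using a m(2) by (auto simp: prefix_sat_def)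
  then show ?thesis by blast
qed

text \<open>Each P reads finitely many coordinates, so a long enough prefix of the constructed
  sequence decides it; that prefix extends to some w satisfying P.\<close>

lemma compactness_nat:
  assumes F: "\<And>P. P \<in> F \<Longrightarrow> definable L M UNIV C P" and C: "small_in C"
    and fin: "\<And>F0. finite F0 \<Longrightarrow> F0 \<subseteq> F \<Longrightarrow> \<exists>v. range v \<subseteq> U \<and> (\<forall>P\<in>F0. P v)"
  obtains v :: "nat \<Rightarrow> 'm" where "range v \<subseteq> U" "\<And>P. P \<in> F \<Longrightarrow> P v"
proof -
  define next_elt where "next_elt a = (SOME m. prefix_sat F (a @ [m]))" for a
  define pre where "pre = rec_nat [] (\<lambda>_ a. a @ [next_elt a])"
  have pre_simps: "pre 0 = []" "pre (Suc n) = pre n @ [next_elt (pre n)]" for n by (simp_all add: pre_def)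
  have len: "length (pre n) = n" for n by (induction n) (auto simp: pre_simps)
  have pre: "prefix_sat F (pre n)" for n
  proof (induction n)
    case 0
    then show ?case using fin by (auto simp: prefix_sat_def pre_simps)
  next
    case (Suc n)
    then show ?case unfolding pre_simps next_elt_def
      using someI_ex[OF compactness_step[OF F C Suc]] by simp
  qed
  define v where "v n = next_elt (pre n)" for n
  have pre_nth: "i < n \<Longrightarrow> pre n ! i = v i" for i n
    by (induction n) (auto simp: pre_simps nth_append len less_Suc_eq v_def)
  have vU: "range v \<subseteq> U"
    using pre[of "Suc _"] by (auto simp: prefix_sat_def pre_simps v_def)
  have "P v" if PF: "P \<in> F" for P
  proof -
    obtain ts \<phi> where t: "set ts \<subseteq> UNIV <+> C" "\<phi> \<in> formulas L (length ts)"
      "\<And>v. range v \<subseteq> U \<Longrightarrow> (P v \<longleftrightarrow> holds M \<phi> (map (case_sum v id) ts))"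
      using F[OF PF] unfolding definable_def by blast
    have "finite {i. Inl i \<in> set ts}"
      by (rule finite_subset[of _ "projl ` set ts"]) force+
    then obtain N where N: "\<And>i. Inl i \<in> set ts \<Longrightarrow> i < N"
      unfolding finite_nat_set_iff_bounded by auto
    obtain w where w: "range w \<subseteq> U" "\<And>i. i < N \<Longrightarrow> w i = v i" "P w"
      using pre[of N] PF unfolding prefix_sat_def len
      by (metis (no_types, lifting) empty_subsetI finite.emptyI finite_insert insertI1 insert_subset pre_nth)
    have "map (case_sum v id) ts = map (case_sum w id) ts"
    proof (rule map_cong[OF refl])
      fix t assume t: "t \<in> set ts"
      show "case_sum v id t = case_sum w id t"
        by (cases t) (use t N w(2) in auto)
    qed
    then show ?thesis using t(3)[OF vU] t(3)[OF w(1)] w(3) by (simp only:)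
  qed
  with vU show ?thesis using that by blast
qed

text \<open>The arrays and trees of tuples needed later are indexed by other countable types;
  \<open>to_nat\<close> reduces them to sequences.\<close>

lemma compactness:
  fixes F :: "(('i :: countable \<Rightarrow> 'm) \<Rightarrow> bool) set"
  assumes F: "\<And>P. P \<in> F \<Longrightarrow> definable L M UNIV C P" and C: "small_in C"
    and fin: "\<And>F0. finite F0 \<Longrightarrow> F0 \<subseteq> F \<Longrightarrow> \<exists>v. range v \<subseteq> U \<and> (\<forall>P\<in>F0. P v)"
  obtains v where "range v \<subseteq> U" "\<And>P. P \<in> F \<Longrightarrow> P v"
proof -
  define h :: "(('i \<Rightarrow> 'm) \<Rightarrow> bool) \<Rightarrow> (nat \<Rightarrow> 'm) \<Rightarrow> bool" where "h P w = P (\<lambda>i. w (to_nat i))" for P w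
  have definable_h: "definable L M UNIV C Q" if Q: "Q \<in> h ` F" for Q
  proof -
    obtain P where P: "P \<in> F" "Q = h P" using Q by blast
    have "definable L M UNIV C (\<lambda>w. P (\<lambda>i. case_sum w id (Inl (to_nat i))))"
      using C by (intro definable_subst[OF F[OF P(1)]]) (auto simp: small_in_def)
    then show ?thesis by (simp add: P(2) h_def[abs_def])
  qed
  have fin_h: "\<exists>w. range w \<subseteq> U \<and> (\<forall>Q\<in>G. Q w)" if G: "finite G" "G \<subseteq> h ` F" for G
  proof -
    obtain F0 where "finite F0" "F0 \<subseteq> F" "G = h ` F0" using finite_subset_image[OF G] by blast
    then obtain v where "range v \<subseteq> U" "\<forall>P\<in>F0. P v" using fin by blast
    then show ?thesis using \<open>G = h ` F0\<close>
      by (intro exI[of _ "\<lambda>n. v (from_nat n)"]) (auto simp: h_def)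
  qed
  obtain w where w: "range w \<subseteq> U" "\<And>Q. Q \<in> h ` F \<Longrightarrow> Q w"
    using compactness_nat[OF definable_h C fin_h] by blast
  show ?thesis
    by (rule that[of "\<lambda>i. w (to_nat i)"]) (use w in \<open>force simp: h_def\<close>)+
qed

subsection \<open>Automorphisms\<close>

definition Aut :: "'m set \<Rightarrow> ('m \<Rightarrow> 'm) set" where
  "Aut D = {f. automorphism L M f \<and> (\<forall>d\<in>D. f d = d)}"

lemma Aut_mono: "f \<in> Aut D \<Longrightarrow> D' \<subseteq> D \<Longrightarrow> f \<in> Aut D'"
  by (auto simp: Aut_def)

lemma Aut_bij: "f \<in> Aut D \<Longrightarrow> bij_betw f U U"
  by (auto simp: Aut_def automorphism_def)

lemma Aut_U: "f \<in> Aut D \<Longrightarrow> x \<in> U \<Longrightarrow> f x \<in> U"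
  using Aut_bij bij_betw_apply by metis

lemma Aut_fix: "f \<in> Aut D \<Longrightarrow> d \<in> D \<Longrightarrow> f d = d"
  by (auto simp: Aut_def)

lemma Aut_fix_image: "f \<in> Aut D \<Longrightarrow> B \<subseteq> D \<Longrightarrow> f ` B = B"
  by (force simp: Aut_def)

lemma Aut_fix_map: "f \<in> Aut D \<Longrightarrow> set a \<subseteq> D \<Longrightarrow> map f a = a"
  by (intro map_idI) (auto simp: Aut_def)

lemma Aut_image_U: "f \<in> Aut D \<Longrightarrow> A \<subseteq> U \<Longrightarrow> f ` A \<subseteq> U"
  using Aut_U by blast

lemma Aut_tuples: "f \<in> Aut D \<Longrightarrow> a \<in> tup n \<Longrightarrow> map f a \<in> tup n"
  using Aut_U by (auto simp: tuples_def)

lemma Aut_id: "id \<in> Aut D"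
  by (auto simp: Aut_def automorphism_def)

lemma Aut_comp:
  assumes "\<sigma> \<in> Aut D" "g \<in> Aut D"
  shows "\<sigma> \<circ> g \<in> Aut D"
proof -
  have tup: "map g a \<in> tup n" if "a \<in> tup n" for a n by (rule Aut_tuples[OF assms(2) that])
  have "bij_betw (\<sigma> \<circ> g) U U" using Aut_bij assms bij_betw_trans by blast
  moreover have "(\<sigma> \<circ> g) (fun_int M f a) = fun_int M f (map (\<sigma> \<circ> g) a)"
    if "fun_arity L f = Some n" "a \<in> tup n" for f n a
    using assms that tup by (simp add: Aut_def automorphism_def flip: map_map)
  moreover have "rel_int M r a \<longleftrightarrow> rel_int M r (map (\<sigma> \<circ> g) a)"
    if "rel_arity L r = Some n" "a \<in> tup n" for r n a
    using assms that tup by (simp add: Aut_def automorphism_def flip: map_map)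
  ultimately show ?thesis using assms unfolding Aut_def automorphism_def by simp
qed

text \<open>An automorphism is a bijection only on U, so the inverse is taken there, and the
  compositions are the identity on U.\<close>

lemma Aut_inverse:
  assumes "\<sigma> \<in> Aut D" "D \<subseteq> U"
  obtains h where "h \<in> Aut D" "\<And>x. x \<in> U \<Longrightarrow> h (\<sigma> x) = x" "\<And>x. x \<in> U \<Longrightarrow> \<sigma> (h x) = x"
proof -
  let ?h = "inv_into U \<sigma>"
  have bij: "bij_betw \<sigma> U U" by (rule Aut_bij[OF assms(1)])
  have inv: "?h (\<sigma> x) = x" "\<sigma> (?h x) = x" "?h x \<in> U" if "x \<in> U" for x
    using bij that by (auto simp: bij_betw_def f_inv_into_f inv_into_into)
  have map_inv: "map \<sigma> (map ?h a) = a" "map ?h a \<in> tup n" if "a \<in> tup n" for a n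
    using that inv by (auto simp: tuples_def intro!: map_idI)
  have "?h (fun_int M f a) = fun_int M f (map ?h a)"
    if f: "fun_arity L f = Some n" and a: "a \<in> tup n" for f n a
  proof -
    have "fun_int M f (map ?h a) \<in> U" using struct f map_inv(2)[OF a] by (auto simp: is_structure_def)
    moreover have "\<sigma> (fun_int M f (map ?h a)) = fun_int M f a"
      using assms(1) f map_inv[OF a] by (simp add: Aut_def automorphism_def del: map_map)
    ultimately show ?thesis using inv(1) by metis
  qed
  moreover have "rel_int M r a \<longleftrightarrow> rel_int M r (map ?h a)"
    if r: "rel_arity L r = Some n" and a: "a \<in> tup n" for r n a
    using assms(1) r map_inv[OF a] by (simp add: Aut_def automorphism_def del: map_map)
  moreover have "?h d = d" if "d \<in> D" for d using inv(1)[of d] Aut_fix[OF assms(1) that] assms(2) that by auto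
  ultimately have "?h \<in> Aut D"
    using bij_betw_inv_into[OF bij] by (simp add: Aut_def automorphism_def)
  then show ?thesis using inv that by blast
qed

lemma eval_tm_U: "wf_tm L t \<Longrightarrow> range v \<subseteq> U \<Longrightarrow> eval_tm M v t \<in> U"
proof (induction t)
  case (App f ts)
  then have "map (eval_tm M v) ts \<in> tup (length ts)" by (auto simp: tuples_def)
  then show ?case using App.prems(1) struct by (auto simp: is_structure_def)
qed auto

lemma eval_tm_Aut:
  "wf_tm L t \<Longrightarrow> range v \<subseteq> U \<Longrightarrow> \<sigma> \<in> Aut D \<Longrightarrow> \<sigma> (eval_tm M v t) = eval_tm M (\<lambda>i. \<sigma> (v i)) t"
proof (induction t)
  case (App f ts)
  have "map (eval_tm M v) ts \<in> tup (length ts)"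
    using App.prems eval_tm_U by (auto simp: tuples_def)
  then have "\<sigma> (fun_int M f (map (eval_tm M v) ts)) = fun_int M f (map \<sigma> (map (eval_tm M v) ts))"
    using App.prems(1,3) unfolding Aut_def automorphism_def by auto
  moreover have "map \<sigma> (map (eval_tm M v) ts) = map (eval_tm M (\<lambda>i. \<sigma> (v i))) ts"
    using App by simp
  ultimately show ?case by (simp del: map_map)
qed simp

lemma sat_Aut:
  "wf_fm L \<phi> \<Longrightarrow> range v \<subseteq> U \<Longrightarrow> f \<in> Aut D \<Longrightarrow> sat M v \<phi> \<longleftrightarrow> sat M (\<lambda>i. f (v i)) \<phi>"
proof (induction \<phi> arbitrary: v)
  case (Eq s t)
  have inj: "inj_on f U" using Aut_bij[OF Eq(3)] by (simp add: bij_betw_def)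
  then show ?case using Eq eval_tm_U eval_tm_Aut[symmetric, OF _ Eq(2,3)]
    by (simp add: inj_on_eq_iff)
next
  case (Rel r ts)
  have "map (eval_tm M v) ts \<in> tup (length ts)"
    using Rel eval_tm_U by (auto simp: tuples_def)
  then have "rel_int M r (map (eval_tm M v) ts) = rel_int M r (map f (map (eval_tm M v) ts))"
    using Rel(1,3) unfolding Aut_def automorphism_def by auto
  moreover have "map f (map (eval_tm M v) ts) = map (eval_tm M (\<lambda>i. f (v i))) ts"
    using Rel eval_tm_Aut by auto
  ultimately show ?case by (simp del: map_map)
next
  case (Neg \<phi>)
  then show ?case by simp
next
  case (Con \<phi>1 \<phi>2)
  then show ?case by simp
next
  case (Ex i \<phi>)
  have upd: "(\<lambda>j. f ((v(i := m)) j)) = (\<lambda>j. f (v j))(i := f m)" for m by auto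
  have IH: "sat M (v(i := m)) \<phi> \<longleftrightarrow> sat M ((\<lambda>j. f (v j))(i := f m)) \<phi>" if "m \<in> U" for m
  proof -
    have "range (v(i := m)) \<subseteq> U" using Ex.prems(2) that by (auto simp: image_subset_iff)
    moreover have "wf_fm L \<phi>" using Ex.prems(1) by simp
    ultimately show ?thesis using Ex.IH[of "v(i := m)"] Ex.prems(3) unfolding upd by blast
  qed
  have surj: "f ` U = U" using Aut_bij[OF Ex.prems(3)] by (simp add: bij_betw_def)
  have "(\<exists>m\<in>U. sat M ((\<lambda>j. f (v j))(i := m)) \<phi>) \<longleftrightarrow> (\<exists>m\<in>f ` U. sat M ((\<lambda>j. f (v j))(i := m)) \<phi>)"
    by (simp only: surj)
  then show ?case using IH by simp
qed

lemma holds_Aut: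
  assumes "f \<in> Aut D" "set a \<subseteq> U" "\<phi> \<in> formulas L (length a)"
  shows "holds M \<phi> (map f a) \<longleftrightarrow> holds M \<phi> a"
proof -
  obtain u where u: "u \<in> U" using U_ne by blast
  \<comment> \<open>\<open>sat_Aut\<close> needs a valuation into U, whereas \<open>(!) a\<close> is
    unspecified beyond the length of a; hence the default u.\<close>
  define v where "v i = (if i < length a then a ! i else u)" for i
  have "range v \<subseteq> U" using assms(2) u by (auto simp: v_def)
  then have "sat M v \<phi> \<longleftrightarrow> sat M (\<lambda>i. f (v i)) \<phi>"
    using assms by (intro sat_Aut) (auto simp: formulas_def)
  moreover have "sat M v \<phi> \<longleftrightarrow> sat M ((!) a) \<phi>"
    using assms(3) by (intro sat_cong) (auto simp: formulas_def v_def)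
  moreover have "sat M (\<lambda>i. f (v i)) \<phi> \<longleftrightarrow> sat M ((!) (map f a)) \<phi>"
    using assms(3) by (intro sat_cong) (auto simp: formulas_def v_def subset_iff)
  ultimately show ?thesis by (simp add: holds_def)
qed

section \<open>Conjugate sets and conjugate tuples\<close>

lemma mem_image_Aut:
  assumes "f \<in> Aut D" "X \<subseteq> tup n" "a \<in> tup n"
  shows "map f a \<in> map f ` X \<longleftrightarrow> a \<in> X"
proof
  assume "map f a \<in> map f ` X"
  then obtain b where b: "b \<in> X" "map f a = map f b" by blast
  have "inj_on f U" using Aut_bij[OF assms(1)] by (simp add: bij_betw_def)
  moreover have "set a \<union> set b \<subseteq> U" using assms(2,3) b(1) tuplesD[of a n] tuplesD[of b n] by blast
  ultimately have "inj_on f (set a \<union> set b)" by (rule inj_on_subset)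
  then show "a \<in> X" using b inj_on_map_eq_map[of f a b] by simp
qed simp

lemma image_Aut_tuples:
  assumes "f \<in> Aut D" "X \<subseteq> tup n"
  shows "map f ` X \<subseteq> tup n"
  using assms Aut_tuples by blast

lemma image_Aut_eqI:
  assumes "f \<in> Aut D" "X \<subseteq> tup n" "Y \<subseteq> tup n"
    and "\<And>a. a \<in> tup n \<Longrightarrow> map f a \<in> Y \<longleftrightarrow> a \<in> X"
  shows "map f ` X = Y"
proof
  show "map f ` X \<subseteq> Y" using assms(2,4) by blast
  show "Y \<subseteq> map f ` X"
  proof
    fix b assume b: "b \<in> Y"
    obtain h where h: "h \<in> Aut {}" "\<And>x. x \<in> U \<Longrightarrow> f (h x) = x"
      using Aut_inverse[OF Aut_mono[OF assms(1)], of "{}"] by (metis empty_subsetI)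
    have "set b \<subseteq> U" using b assms(3) tuplesD by blast
    then have eq: "map f (map h b) = b" unfolding map_map by (intro map_idI) (simp add: h(2) subsetD)
    have "map h b \<in> tup n" by (rule Aut_tuples[OF h(1) subsetD[OF assms(3) b]])
    from assms(4)[OF this] have "map h b \<in> X" unfolding eq using b by simp
    then show "b \<in> map f ` X" by (intro image_eqI[where x = "map h b"]) (simp_all only: eq)
  qed
qed

lemma dset_Aut:
  assumes "(\<phi>, c) \<in> pformulas L U n" "f \<in> Aut D"
  shows "map f ` dset n (\<phi>, c) = dset n (\<phi>, map f c)"
proof (rule image_Aut_eqI[OF assms(2)])
  fix a assume a: "a \<in> tup n"
  have "holds M \<phi> (map f (a @ c)) \<longleftrightarrow> holds M \<phi> (a @ c)"
    using a assms(1) by (intro holds_Aut[OF assms(2)]) (auto simp: tuples_def pformulas_def)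
  then show "map f a \<in> dset n (\<phi>, map f c) \<longleftrightarrow> a \<in> dset n (\<phi>, c)"
    using a Aut_tuples[OF assms(2) a] by (simp add: dset_def)
qed (auto simp: dset_def)

lemma Def_Aut:
  assumes "X \<in> Def C n" "f \<in> Aut D" "C \<subseteq> U"
  shows "map f ` X \<in> Def (f ` C) n"
proof -
  obtain \<phi> c where c: "c \<in> lists C" "\<phi> \<in> formulas L (n + length c)" "X = dset n (\<phi>, c)"
    using assms by (auto simp: Def_def pformulas_def)
  have "(\<phi>, c) \<in> pformulas L U n" using c assms(3) by (auto simp: pformulas_def)
  then have "map f ` X = dset n (\<phi>, map f c)" using dset_Aut[OF _ assms(2)] c(3) by simp
  moreover have "(\<phi>, map f c) \<in> pformulas L (f ` C) n" using c by (auto simp: pformulas_def)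
  ultimately show ?thesis unfolding Def_def by blast
qed

lemma Def_fix:
  assumes "X \<in> Def C n" "f \<in> Aut C" "C \<subseteq> U" "a \<in> tup n"
  shows "map f a \<in> X \<longleftrightarrow> a \<in> X"
proof -
  obtain \<phi> c where c: "c \<in> lists C" "\<phi> \<in> formulas L (n + length c)" "X = dset n (\<phi>, c)"
    using assms by (auto simp: Def_def pformulas_def)
  have "holds M \<phi> (map f (a @ c)) \<longleftrightarrow> holds M \<phi> (a @ c)"
    using assms c by (intro holds_Aut[OF assms(2)]) (auto simp: tuples_def)
  moreover have "map f c = c" using c(1) by (intro Aut_fix_map[OF assms(2)]) auto
  ultimately show ?thesis using assms(4) Aut_tuples[OF assms(2,4)] by (simp add: c(3) dset_def)
qed

lemma Def_fix_image:
  assumes "X \<in> Def C n" "f \<in> Aut C" "C \<subseteq> U"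
  shows "map f ` X = X"
  using Def_subset[OF assms(1)] Def_fix[OF assms] by (intro image_Aut_eqI[OF assms(2)]) auto

text \<open>The map that sends a to b and fixes C is elementary, so strong homogeneity extends it to
  an automorphism. Inclusion of the types is enough because complements of definable sets are
  definable.\<close>

lemma homogeneity:
  assumes ab: "a \<in> tup n" "b \<in> tup n" and C: "small_in C"
    and tp: "\<And>X. X \<in> Def C n \<Longrightarrow> a \<in> X \<Longrightarrow> b \<in> X"
  obtains \<sigma> where "\<sigma> \<in> Aut C" "map \<sigma> a = b"
proof -
  have CU: "C \<subseteq> U" using C by (simp add: small_in_def)
  have iff: "a \<in> X \<longleftrightarrow> b \<in> X" if "X \<in> Def C n" for X
    using tp[OF that] tp[OF Def_compl[OF that CU]] ab by blast
  have len: "length a = n" "length b = n" using ab by (auto simp: tuples_def)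
  \<comment> \<open>Each element of a and C will receive one arbitrarily chosen name, a position in
    a or a parameter. \<open>eq1\<close> and \<open>eq2\<close> say that b respects all coincidences
    of names, so the map comes out the same for every choice.\<close>
  have eq1: "b ! i = b ! j" if "i < n" "j < n" "a ! i = a ! j" for i j
  proof -
    have "dset n (Eq (Var i) (Var j), []) \<in> Def C n"
      unfolding Def_def using that by (auto simp: pformulas_def formulas_def)
    from iff[OF this] show ?thesis using that ab by (simp add: dset_def holds_def)
  qed
  have eq2: "b ! i = a ! i" if "i < n" "a ! i \<in> C" for i
  proof -
    have "dset n (Eq (Var i) (Var n), [a ! i]) \<in> Def C n"
      unfolding Def_def using that by (auto simp: pformulas_def formulas_def)
    from iff[OF this] show ?thesis using that ab len by (simp add: dset_def holds_def nth_append)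
  qed
  have "\<exists>t. t \<in> {..<n} <+> C \<and> case_sum ((!) a) id t = x" if "x \<in> set a \<union> C" for x
  proof (cases "x \<in> C")
    case True
    then show ?thesis by (intro exI[of _ "Inr x"]) auto
  next
    case False
    then have "x \<in> set a" using that by blast
    then obtain i where "i < n" "a ! i = x" using len by (auto simp: in_set_conv_nth)
    then show ?thesis by (intro exI[of _ "Inl i"]) auto
  qed
  then obtain t where t: "\<And>x. x \<in> set a \<union> C \<Longrightarrow> t x \<in> {..<n} <+> C"
    "\<And>x. x \<in> set a \<union> C \<Longrightarrow> case_sum ((!) a) id (t x) = x" by metis
  define g where "g x = case_sum ((!) b) id (t x)" for x
  have g_a: "g (a ! i) = b ! i" if "i < n" for i
  proof -
    have x: "a ! i \<in> set a \<union> C" using that len by simp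
    show ?thesis
    proof (cases "t (a ! i)")
      case (Inl j)
      then have "j < n" "a ! j = a ! i" using t[OF x] by auto
      then show ?thesis using eq1[of j i] that Inl by (simp add: g_def)
    next
      case (Inr c)
      then have "a ! i = c" "c \<in> C" using t[OF x] by auto
      then show ?thesis using eq2[of i] that Inr by (simp add: g_def)
    qed
  qed
  have g_C: "g c = c" if "c \<in> C" for c
  proof (cases "t c")
    case (Inl j)
    then have "j < n" "a ! j = c" using t[of c] that by auto
    then show ?thesis using eq2[of j] that Inl by (simp add: g_def)
  next
    case (Inr d)
    then show ?thesis using t(2)[of c] that by (simp add: g_def)
  qed
  have "elementary_map L M (set a \<union> C) g"
    unfolding elementary_map_def
  proof (intro conjI ballI)
    show "set a \<union> C \<subseteq> U" using ab(1) CU by (auto simp: tuples_def)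
    show "g ` (set a \<union> C) \<subseteq> U"
    proof
      fix y assume "y \<in> g ` (set a \<union> C)"
      then consider i where "i < n" "y = g (a ! i)" | "y \<in> C"
        using g_C len by (force simp: in_set_conv_nth)
      then show "y \<in> U"
      proof cases
        case 1
        then show ?thesis using g_a ab(2) len nth_mem[of i b] by (auto simp: tuples_def)
      qed (use CU in auto)
    qed
    fix w \<phi> assume w: "w \<in> lists (set a \<union> C)" "\<phi> \<in> formulas L (length w)"
    have ts: "set (map t w) \<subseteq> {..<n} <+> C" using t(1) w(1) by auto
    have "definable L M {..<n} C (\<lambda>v. holds M \<phi> (map (case_sum v id) (map t w)))"
      unfolding definable_def using ts w(2) by (intro exI[of _ "map t w"] exI[of _ \<phi>]) simp
    then have "{x \<in> tup n. holds M \<phi> (map (case_sum ((!) x) id) (map t w))} \<in> Def C n"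
      by (rule DefI) simp
    from iff[OF this] ab
    have "holds M \<phi> (map (case_sum ((!) a) id) (map t w)) \<longleftrightarrow> holds M \<phi> (map (case_sum ((!) b) id) (map t w))"
      by blast
    moreover have "map (case_sum ((!) a) id) (map t w) = w" using t(2) w(1) by (auto intro!: map_idI)
    moreover have "map (case_sum ((!) b) id) (map t w) = map g w" by (simp add: g_def)
    ultimately show "holds M \<phi> w \<longleftrightarrow> holds M \<phi> (map g w)" by (simp only:)
  qed
  moreover have "small \<kappa> (set a \<union> C)"
    using small_in_Un[OF small_in_finite[of "set a"] C] ab(1) by (auto simp: small_in_def tuples_def)
  ultimately obtain \<sigma> where \<sigma>: "automorphism L M \<sigma>" "\<forall>x\<in>set a \<union> C. \<sigma> x = g x"
    using monster unfolding monster_model_def strongly_homogeneous_def by blast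
  have "\<sigma> \<in> Aut C" using \<sigma> g_C by (auto simp: Aut_def)
  moreover have "map \<sigma> a = b" using \<sigma>(2) g_a len by (intro nth_equalityI) auto
  ultimately show ?thesis using that by blast
qed


subsection \<open>Dividing and forking\<close>

text \<open>By strong homogeneity, the tuples with the type of \<open>b\<close> over \<open>D\<close> are its conjugates under \<open>Aut D\<close>, so
  dividing of \<open>\<phi>(x, b)\<close> over \<open>D\<close> is a property of the set it defines.\<close>

definition k_divides :: "nat \<Rightarrow> 'm set \<Rightarrow> 'm list set \<Rightarrow> bool" where
  "k_divides k D Y \<longleftrightarrow> (\<exists>f :: nat \<Rightarrow> 'm \<Rightarrow> 'm. (\<forall>i. f i \<in> Aut D) \<and>
     (\<forall>I. finite I \<and> card I = k \<longrightarrow> (\<Inter>i\<in>I. map (f i) ` Y) = {}))"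

definition forking :: "'m set \<Rightarrow> nat \<Rightarrow> 'm list set \<Rightarrow> bool" where
  "forking D n X \<longleftrightarrow> (\<exists>S. finite S \<and> S \<subseteq> Def U n \<and> (\<forall>Y\<in>S. \<exists>k. k_divides k D Y) \<and> X \<subseteq> \<Union>S)"

text \<open>Single sets of the type are tested instead of the whole type: by compactness a type
  forks iff one of its sets does. \<open>forks_iff\<close> makes the link to
  \<open>forks\<close>.\<close>

definition nonforking :: "'m list \<Rightarrow> 'm set \<Rightarrow> 'm set \<Rightarrow> bool" where
  "nonforking a D B \<longleftrightarrow> (\<forall>X\<in>Def (B \<union> D) (length a). a \<in> X \<longrightarrow> \<not> forking D (length a) X)"

lemma tp_iff: "set a \<subseteq> U \<Longrightarrow> \<psi> \<in> tp L M a C \<longleftrightarrow> \<psi> \<in> pformulas L C (length a) \<and> a \<in> dset (length a) \<psi>"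
  by (cases \<psi>) (auto simp: tp_def dset_def tuples_def)

lemma tp_eq_Def:
  assumes "tp L M a C = tp L M b C" "length a = length b" "set a \<subseteq> U" "set b \<subseteq> U" "X \<in> Def C (length a)"
  shows "a \<in> X \<longleftrightarrow> b \<in> X"
proof -
  obtain \<psi> where \<psi>: "\<psi> \<in> pformulas L C (length a)" "X = dset (length a) \<psi>"
    using assms(5) unfolding Def_def by blast
  then show ?thesis using assms(1,2) tp_iff[OF assms(3), of \<psi> C] tp_iff[OF assms(4), of \<psi> C] by simp
qed

lemma tp_Aut:
  assumes "f \<in> Aut C" "set a \<subseteq> U" "C \<subseteq> U"
  shows "tp L M (map f a) C = tp L M a C"
proof (rule set_eqI)
  fix \<psi>
  have "set (map f a) \<subseteq> U" using Aut_image_U[OF assms(1,2)] by simp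
  moreover have "map f a \<in> dset (length a) \<psi> \<longleftrightarrow> a \<in> dset (length a) \<psi>"
    if "\<psi> \<in> pformulas L C (length a)"
    using that assms by (intro Def_fix[OF _ assms(1,3)]) (auto simp: Def_def tuplesI)
  ultimately show "\<psi> \<in> tp L M (map f a) C \<longleftrightarrow> \<psi> \<in> tp L M a C"
    using assms(2) by (auto simp: tp_iff simp del: set_map)
qed

lemma k_inconsistent_iff:
  "k_inconsistent M n \<phi> k b \<longleftrightarrow> (\<forall>I. finite I \<and> card I = k \<longrightarrow> (\<Inter>i\<in>I. dset n (\<phi>, b i)) = {})"
proof -
  \<comment> \<open>For empty I the intersection is \<open>UNIV\<close> and the left side says that
    \<open>tup n\<close> is nonempty, so both sides are true.\<close>
  have "(\<exists>a\<in>tup n. \<forall>i\<in>I. holds M \<phi> (a @ b i)) \<longleftrightarrow> (\<Inter>i\<in>I. dset n (\<phi>, b i)) \<noteq> {}" for I :: "nat set"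
    using tuples_ne by (cases "I = {}") (auto simp: dset_def)
  then show ?thesis unfolding k_inconsistent_def by simp
qed

lemma divides_iff:
  assumes "(\<phi>, b) \<in> pformulas L U n" "small_in D"
  shows "divides L M n (\<phi>, b) D \<longleftrightarrow> (\<exists>k. k_divides k D (dset n (\<phi>, b)))"
proof
  have b: "set b \<subseteq> U" using assms(1) by (auto simp: pformulas_def)
  { assume "divides L M n (\<phi>, b) D"
    then obtain k b' where b': "\<And>i::nat. b' i \<in> tup (length b)" "\<And>i. tp L M (b' i) D = tp L M b D"
      "k_inconsistent M n \<phi> k b'" unfolding divides_def by auto
    have "\<exists>f. f \<in> Aut D \<and> map f b = b' i" for i
    proof -
      have "b' i \<in> X" if "X \<in> Def D (length b)" "b \<in> X" for X
        using tp_eq_Def[OF b'(2)[of i, symmetric] _ b _ that(1)] that(2) tuplesD[OF b'(1)[of i]] by simp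
      then show ?thesis using homogeneity[OF tuplesI[OF b refl] b'(1) assms(2)] by metis
    qed
    then obtain f where f: "\<And>i. f i \<in> Aut D" "\<And>i. map (f i) b = b' i" by metis
    have "map (f i) ` dset n (\<phi>, b) = dset n (\<phi>, b' i)" for i
      using dset_Aut[OF assms(1) f(1)] f(2) by simp
    then show "\<exists>k. k_divides k D (dset n (\<phi>, b))" using b'(3) f(1) unfolding k_inconsistent_iff k_divides_def
      by (intro exI[of _ k] exI[of _ f]) auto }
  { assume "\<exists>k. k_divides k D (dset n (\<phi>, b))"
    then obtain k f where f: "\<And>i::nat. f i \<in> Aut D"
      "\<And>I. finite I \<and> card I = k \<longrightarrow> (\<Inter>i\<in>I. map (f i) ` dset n (\<phi>, b)) = {}"
      unfolding k_divides_def by blast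
    have "map (f i) ` dset n (\<phi>, b) = dset n (\<phi>, map (f i) b)" for i
      using dset_Aut[OF assms(1) f(1)] by simp
    then have "k_inconsistent M n \<phi> k (\<lambda>i. map (f i) b)" unfolding k_inconsistent_iff using f(2) by simp
    moreover have "map (f i) b \<in> tup (length b)" for i by (rule Aut_tuples[OF f(1) tuplesI[OF b refl]])
    moreover have "tp L M (map (f i) b) D = tp L M b D" for i
      using tp_Aut[OF f(1) b] assms(2) by (simp add: small_in_def)
    ultimately show "divides L M n (\<phi>, b) D" unfolding divides_def
      by (simp only: prod.case) (intro exI[of _ k] exI[of _ "\<lambda>i. map (f i) b"], simp) }
qed

lemma forking_mono: "forking D n X \<Longrightarrow> Y \<subseteq> X \<Longrightarrow> forking D n Y"
  unfolding forking_def by (meson subset_trans)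

lemma forking_Union:
  assumes "finite F" "\<And>X. X \<in> F \<Longrightarrow> forking D n X"
  shows "forking D n (\<Union>F)"
proof -
  have "\<forall>X\<in>F. \<exists>S. finite S \<and> S \<subseteq> Def U n \<and> (\<forall>Y\<in>S. \<exists>k. k_divides k D Y) \<and> X \<subseteq> \<Union>S"
    using assms(2) unfolding forking_def by blast
  then obtain S where S: "\<And>X. X \<in> F \<Longrightarrow> finite (S X) \<and> S X \<subseteq> Def U n \<and> (\<forall>Y\<in>S X. \<exists>k. k_divides k D Y) \<and> X \<subseteq> \<Union>(S X)"
    by metis
  have "finite (\<Union>(S ` F))" using S assms(1) by blast
  moreover have "\<Union>(S ` F) \<subseteq> Def U n" by (simp add: UN_subset_iff S)
  moreover have "\<forall>Y\<in>\<Union>(S ` F). \<exists>k. k_divides k D Y" by (simp add: S)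
  moreover have "\<Union>F \<subseteq> \<Union>(\<Union>(S ` F))"
  proof
    fix x assume "x \<in> \<Union>F"
    then obtain X where X: "X \<in> F" "x \<in> X" by (elim UnionE)
    then have "x \<in> \<Union>(S X)" using S[OF X(1)] by (meson subsetD)
    then show "x \<in> \<Union>(\<Union>(S ` F))" using X(1) by auto
  qed
  ultimately show ?thesis unfolding forking_def by (intro exI[of _ "\<Union>(S ` F)"] conjI)
qed

lemma forking_sdivk: "k_divides k D X \<Longrightarrow> X \<in> Def C n \<Longrightarrow> C \<subseteq> U \<Longrightarrow> forking D n X"
  unfolding forking_def using Def_mono[of X C n U] by (intro exI[of _ "{X}"]) auto

lemma Def_finite_params:
  assumes "finite S" "S \<subseteq> Def C n"
  obtains B where "finite B" "B \<subseteq> C" "S \<subseteq> Def B n"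
proof -
  have "\<forall>X\<in>S. \<exists>B. finite B \<and> B \<subseteq> C \<and> X \<in> Def B n" using assms(2) Def_finite_support by (metis subsetD)
  then obtain B where B: "\<And>X. X \<in> S \<Longrightarrow> finite (B X) \<and> B X \<subseteq> C \<and> X \<in> Def (B X) n" by metis
  show ?thesis
  proof (rule that)
    show "finite (\<Union>(B ` S))" "\<Union>(B ` S) \<subseteq> C" using assms(1) B by auto
    show "S \<subseteq> Def (\<Union>(B ` S)) n"
    proof
      fix X assume X: "X \<in> S"
      show "X \<in> Def (\<Union>(B ` S)) n" using Def_mono[OF _ UN_upper[OF X]] B[OF X] by simp
    qed
  qed
qed

lemma type_finite_part:
  assumes "finite S0" "\<And>X. X \<in> S0 \<Longrightarrow> X \<in> Def C n \<and> a \<in> X" "a \<in> tup n" "C \<subseteq> U"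
  obtains Z where "Z \<in> Def C n" "a \<in> Z" "\<And>X. X \<in> S0 \<Longrightarrow> Z \<subseteq> X"
proof (rule that)
  show "{x \<in> tup n. \<forall>X\<in>S0. x \<in> X} \<in> Def C n" using assms by (intro Def_Inter) auto
qed (use assms in auto)

text \<open>Saturation is applied to the type of a over C together with the complements of the
  members of H. Below, H is the family of forking sets (\<open>extension\<close>) or a cover by
  dividing sets (\<open>forks_iff\<close>).\<close>

lemma realize_avoiding:
  assumes a: "a \<in> tup n" and C: "small_in C'" "C \<subseteq> C'" and H: "H \<subseteq> Def C' n"
    and avoid: "\<And>Z H0. Z \<in> Def C n \<Longrightarrow> a \<in> Z \<Longrightarrow> finite H0 \<Longrightarrow> H0 \<subseteq> H \<Longrightarrow> \<not> Z \<subseteq> \<Union>H0"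
  shows "\<exists>b\<in>tup n. (\<forall>X\<in>Def C n. a \<in> X \<longrightarrow> b \<in> X) \<and> b \<notin> \<Union>H"
proof -
  have C'U: "C' \<subseteq> U" using C(1) by (rule small_inD)
  define G where "G = {X \<in> Def C n. a \<in> X}"
  let ?F = "G \<union> (\<lambda>X. tup n - X) ` H"
  have sub: "?F \<subseteq> Def C' n"
    using Def_mono[OF _ C(2)] Def_compl[OF subsetD[OF H] C'U] by (auto simp: G_def)
  have fin: "\<exists>x\<in>tup n. \<forall>X\<in>S0. x \<in> X" if S0: "finite S0" "S0 \<subseteq> ?F" for S0
  proof -
    obtain H0 where H0: "H0 \<subseteq> H" "finite H0" "S0 - G = (\<lambda>X. tup n - X) ` H0"
      using finite_subset_image[of "S0 - G" "\<lambda>X. tup n - X" H] S0 by blast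
    have finG: "finite (S0 \<inter> G)" using S0(1) by simp
    have mem: "X \<in> Def C n \<and> a \<in> X" if "X \<in> S0 \<inter> G" for X using that by (simp add: G_def)
    obtain Z where Z: "Z \<in> Def C n" "a \<in> Z" "\<And>X. X \<in> S0 \<inter> G \<Longrightarrow> Z \<subseteq> X"
      using type_finite_part[OF finG mem a subset_trans[OF C(2) C'U]] by metis
    obtain x where x: "x \<in> Z" "x \<notin> \<Union>H0" using avoid[OF Z(1,2) H0(2,1)] by blast
    have xt: "x \<in> tup n" using x(1) Def_subset[OF Z(1)] by blast
    have "x \<in> X" if X: "X \<in> S0" for X
    proof (cases "X \<in> G")
      case False
      then have "X \<in> (\<lambda>X. tup n - X) ` H0" using X H0(3) by blast
      then show ?thesis using x(2) xt by blast
    qed (use x(1) Z(3) X in blast)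
    with xt show ?thesis by blast
  qed
  obtain b where b: "b \<in> tup n" "\<forall>X\<in>?F. b \<in> X" by (rule bexE[OF saturation[OF sub C(1) fin]])
  have "\<forall>X\<in>Def C n. a \<in> X \<longrightarrow> b \<in> X" using b(2) by (simp add: G_def)
  moreover have "b \<notin> \<Union>H" using b(2) by auto
  ultimately show ?thesis using b(1) by blast
qed

text \<open>The direction from \<open>forks\<close> needs compactness: as every realization of the
  type lies in one of the dividing sets, some single set of the type is already covered by
  them.\<close>

lemma forks_iff:
  assumes D: "small_in D" and B: "small_in B" and a: "set a \<subseteq> U"
  shows "forks L M (length a) (tp L M a (B \<union> D)) D \<longleftrightarrow> \<not> nonforking a D B"
proof
  let ?n = "length a"
  have BD: "B \<union> D \<subseteq> U" using B D by (auto simp: small_in_def)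
  have at: "a \<in> tup ?n" using a by (simp add: tuplesI)
  have real: "realizes M x q \<longleftrightarrow> (\<forall>\<psi>\<in>q. x \<in> dset ?n \<psi>)" if "x \<in> tup ?n" for x q
    using that by (simp add: realizes_def dset_def case_prod_beta)
  { assume "\<not> nonforking a D B"
    then obtain X S where X: "X \<in> Def (B \<union> D) ?n" "a \<in> X"
      and S: "finite S" "S \<subseteq> Def U ?n" "\<forall>Y\<in>S. \<exists>k. k_divides k D Y" "X \<subseteq> \<Union>S"
      unfolding nonforking_def forking_def by blast
    obtain \<chi> where \<chi>: "\<chi> \<in> pformulas L (B \<union> D) ?n" "X = dset ?n \<chi>" using X(1) unfolding Def_def by blast
    have "\<forall>Y\<in>S. \<exists>\<psi>. \<psi> \<in> pformulas L U ?n \<and> Y = dset ?n \<psi>" using S(2) unfolding Def_def by blast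
    then obtain f where f: "\<And>Y. Y \<in> S \<Longrightarrow> f Y \<in> pformulas L U ?n \<and> Y = dset ?n (f Y)" by metis
    have div: "\<forall>\<psi>\<in>f ` S. divides L M ?n \<psi> D"
    proof
      fix \<psi> assume "\<psi> \<in> f ` S"
      then obtain Y where Y: "Y \<in> S" "\<psi> = f Y" by blast
      then show "divides L M ?n \<psi> D"
        using divides_iff[of "fst \<psi>" "snd \<psi>" ?n, OF _ D] f[OF Y(1)] S(3) by (metis prod.collapse)
    qed
    have "\<exists>\<psi>\<in>f ` S. realizes M x {\<psi>}" if x: "x \<in> tup ?n" "realizes M x (tp L M a (B \<union> D))" for x
    proof -
      have "\<chi> \<in> tp L M a (B \<union> D)" using \<chi> X(2) tp_iff[OF a] by simp
      then have "x \<in> X" using x \<chi>(2) real[OF x(1)] by blast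
      then obtain Y where "Y \<in> S" "x \<in> Y" using S(4) by blast
      then show ?thesis using f real[OF x(1)] by (intro bexI[of _ "f Y"]) auto
    qed
    then show "forks L M ?n (tp L M a (B \<union> D)) D"
      unfolding forks_def using S(1) f div by (intro exI[of _ "f ` S"]) auto }
  { assume "forks L M ?n (tp L M a (B \<union> D)) D"
    then obtain \<Psi> where \<Psi>: "finite \<Psi>" "\<Psi> \<subseteq> pformulas L U ?n" "\<And>\<psi>. \<psi> \<in> \<Psi> \<Longrightarrow> divides L M ?n \<psi> D"
      "\<And>x. x \<in> tup ?n \<Longrightarrow> realizes M x (tp L M a (B \<union> D)) \<Longrightarrow> \<exists>\<psi>\<in>\<Psi>. realizes M x {\<psi>}"
      unfolding forks_def by blast
    define S where "S = dset ?n ` \<Psi>"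
    have S: "finite S" "S \<subseteq> Def U ?n" using \<Psi>(1,2) by (auto simp: S_def Def_def)
    have sdiv: "\<forall>Y\<in>S. \<exists>k. k_divides k D Y"
    proof
      fix Y assume "Y \<in> S"
      then obtain \<psi> where \<psi>: "\<psi> \<in> \<Psi>" "Y = dset ?n \<psi>" by (auto simp: S_def simp del: split_paired_Ex)
      then show "\<exists>k. k_divides k D Y"
        using divides_iff[of "fst \<psi>" "snd \<psi>" ?n, OF _ D] \<Psi>(3)[OF \<psi>(1)] subsetD[OF \<Psi>(2) \<psi>(1)] by simp
    qed
    obtain B1 where B1: "finite B1" "B1 \<subseteq> U" "S \<subseteq> Def B1 ?n" using Def_finite_params[OF S] by blast
    have "small_in (B \<union> D \<union> B1)" using B D B1 by (simp add: small_in_Un small_in_finite)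
    moreover have "S \<subseteq> Def (B \<union> D \<union> B1) ?n" using B1(3) Def_mono[of _ B1 ?n "B \<union> D \<union> B1"] by auto
    moreover have False if x: "x \<in> tup ?n" "\<And>X. X \<in> Def (B \<union> D) ?n \<Longrightarrow> a \<in> X \<Longrightarrow> x \<in> X" "x \<notin> \<Union>S" for x
    proof -
      have "x \<in> dset ?n \<psi>" if "\<psi> \<in> tp L M a (B \<union> D)" for \<psi>
        using that tp_iff[OF a] by (intro x(2)) (simp_all add: Def_def)
      then have "realizes M x (tp L M a (B \<union> D))" using real[OF x(1)] by blast
      then obtain \<psi> where "\<psi> \<in> \<Psi>" "x \<in> dset ?n \<psi>" using \<Psi>(4)[OF x(1)] real[OF x(1)] by blast
      then show False using x(3) by (auto simp: S_def)
    qed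
    ultimately obtain Z H0 where Z: "Z \<in> Def (B \<union> D) ?n" "a \<in> Z" "H0 \<subseteq> S" "Z \<subseteq> \<Union>H0"
      using realize_avoiding[OF at, of "B \<union> D \<union> B1" "B \<union> D" S] by (metis sup_ge1)
    then have "Z \<subseteq> \<Union>S" by blast
    then have "forking D ?n Z" unfolding forking_def using S sdiv by blast
    then show "\<not> nonforking a D B" unfolding nonforking_def using Z by blast }
qed

lemma nonforking_mono: "nonforking a D B \<Longrightarrow> B' \<subseteq> B \<union> D \<Longrightarrow> nonforking a D B'"
  unfolding nonforking_def using Def_mono[of _ "B' \<union> D" "length a" "B \<union> D"] by blast

text \<open>Finite unions of forking sets fork, so no set of the type of a is covered by finitely
  many of them. Hence some realization avoids all forking sets over the larger parameter set, and it
  is conjugate to a over \<open>D \<union> B\<close>.\<close>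

lemma extension:
  assumes nonforking: "nonforking a D B" and D: "small_in D" and B: "small_in B" and C: "small_in C" and a: "set a \<subseteq> U"
  obtains f where "f \<in> Aut (D \<union> B)" "nonforking (map f a) D (B \<union> C)"
proof -
  let ?n = "length a"
  have at: "a \<in> tup ?n" using a by (simp add: tuplesI)
  define H where "H = {X \<in> Def (B \<union> C \<union> D) ?n. forking D ?n X}"
  have C': "small_in (B \<union> C \<union> D)" "B \<union> D \<subseteq> B \<union> C \<union> D" using B C D by (auto intro: small_in_Un)
  have avoid: "\<not> Z \<subseteq> \<Union>H0" if "Z \<in> Def (B \<union> D) ?n" "a \<in> Z" "finite H0" "H0 \<subseteq> H" for Z H0
  proof
    assume "Z \<subseteq> \<Union>H0"
    moreover have "forking D ?n (\<Union>H0)" using that(3,4) by (intro forking_Union) (auto simp: H_def)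
    ultimately show False using nonforking that(1,2) forking_mono unfolding nonforking_def by metis
  qed
  have H: "H \<subseteq> Def (B \<union> C \<union> D) ?n" by (auto simp: H_def)
  have "\<exists>b\<in>tup ?n. (\<forall>X\<in>Def (B \<union> D) ?n. a \<in> X \<longrightarrow> b \<in> X) \<and> b \<notin> \<Union>H"
    by (rule realize_avoiding[OF at C' H avoid])
  then obtain b where b: "b \<in> tup ?n"
    "\<forall>X\<in>Def (B \<union> D) ?n. a \<in> X \<longrightarrow> b \<in> X" "b \<notin> \<Union>H" by blast
  obtain f where f: "f \<in> Aut (B \<union> D)" "map f a = b"
    using homogeneity[OF at b(1) small_in_Un[OF B D]] b(2) by blast
  have "nonforking b D (B \<union> C)" unfolding nonforking_def using b(1,3) tuplesD[OF b(1)] by (auto simp: H_def)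
  then show ?thesis using that f by (simp add: Un_commute)
qed

lemma k_divides_Aut:
  assumes "k_divides k D Y" "h \<in> Aut {}" "Y \<subseteq> tup n" "D \<subseteq> U"
  shows "k_divides k (h ` D) (map h ` Y)"
proof -
  obtain f where f: "\<And>i::nat. f i \<in> Aut D"
    "\<And>I. finite I \<and> card I = k \<Longrightarrow> (\<Inter>i\<in>I. map (f i) ` Y) = {}"
    using assms(1) unfolding k_divides_def by blast
  obtain g where g: "g \<in> Aut {}" "\<And>x. x \<in> U \<Longrightarrow> g (h x) = x"
    using Aut_inverse[OF assms(2)] by (metis empty_subsetI)
  have "h \<circ> f i \<circ> g \<in> Aut (h ` D)" for i
  proof -
    have "h \<circ> f i \<circ> g \<in> Aut {}" using assms(2) g(1) Aut_mono[OF f(1), of "{}"] by (intro Aut_comp) auto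
    moreover have "(h \<circ> f i \<circ> g) x = x" if "x \<in> h ` D" for x
      using that g(2) Aut_fix[OF f(1)] assms(4) by auto
    ultimately show ?thesis by (simp add: Aut_def)
  qed
  moreover have "(\<Inter>i\<in>I. map (h \<circ> f i \<circ> g) ` map h ` Y) = {}" if I: "finite I \<and> card I = k" for I
  proof (rule ccontr)
    assume "\<not> ?thesis"
    then obtain z where z: "\<And>i. i \<in> I \<Longrightarrow> z \<in> map (h \<circ> f i \<circ> g) ` map h ` Y" by blast
    have "map g z \<in> map (f i) ` Y" if i: "i \<in> I" for i
    proof -
      obtain y where y: "y \<in> Y" "z = map (h \<circ> f i \<circ> g) (map h y)" using z[OF i] by blast
      have yU: "x \<in> U" if "x \<in> set y" for x using y(1) assms(3) tuplesD[of y n] that by blast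
      have "map g z = map (f i) y" using yU g(2) Aut_U[OF f(1)] by (simp add: y(2))
      then show ?thesis using y(1) by blast
    qed
    then show False using f(2)[OF I] by blast
  qed
  ultimately show ?thesis unfolding k_divides_def by (intro exI[of _ "\<lambda>i. h \<circ> f i \<circ> g"]) blast
qed

lemma forking_Aut:
  assumes "forking D n X" "h \<in> Aut {}" "D \<subseteq> U"
  shows "forking (h ` D) n (map h ` X)"
proof -
  obtain S where S: "finite S" "S \<subseteq> Def U n" "\<forall>Y\<in>S. \<exists>k. k_divides k D Y" "X \<subseteq> \<Union>S"
    using assms(1) unfolding forking_def by blast
  have "h ` U = U" using Aut_bij[OF assms(2)] by (simp add: bij_betw_def)
  then have "map h ` Y \<in> Def U n" if "Y \<in> S" for Y
    using Def_Aut[OF subsetD[OF S(2) that] assms(2)] by simp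
  moreover have "\<exists>k. k_divides k (h ` D) (map h ` Y)" if "Y \<in> S" for Y
    using k_divides_Aut[OF _ assms(2) _ assms(3)] S(2,3) Def_subset that by (meson subsetD)
  moreover have "map h ` X \<subseteq> \<Union>((`) (map h) ` S)" using S(4) by blast
  ultimately show ?thesis unfolding forking_def
    using S(1) by (intro exI[of _ "(`) (map h) ` S"]) auto
qed

lemma nonforking_Aut:
  assumes nonforking: "nonforking a D B" and f: "f \<in> Aut E" and a: "set a \<subseteq> U" and D: "D \<subseteq> U" and B: "B \<subseteq> U"
  shows "nonforking (map f a) (f ` D) (f ` B)"
  unfolding nonforking_def
proof (intro ballI impI notI)
  have f0: "f \<in> Aut {}" by (rule Aut_mono[OF f]) simp
  obtain h where h: "h \<in> Aut {}" "\<And>x. x \<in> U \<Longrightarrow> h (f x) = x"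
    using Aut_inverse[OF f0] by (metis empty_subsetI)
  have hf: "h ` f ` A = A" if "A \<subseteq> U" for A
    using that h(2) by (force simp: image_image)
  fix X assume X: "X \<in> Def (f ` B \<union> f ` D) (length (map f a))" "map f a \<in> X"
    "forking (f ` D) (length (map f a)) X"
  have U: "f ` B \<union> f ` D \<subseteq> U" using Aut_image_U[OF f] D B by simp
  have "map h ` X \<in> Def (B \<union> D) (length a)"
    using Def_Aut[OF X(1) h(1) U] hf B D by (simp add: image_Un)
  moreover have "map h (map f a) = a" unfolding map_map by (rule map_idI) (use a h(2) in auto)
  then have "a \<in> map h ` X" using X(2) by (metis imageI)
  moreover have "forking D (length a) (map h ` X)"
    using forking_Aut[OF X(3) h(1)] U hf[OF D] by simp
  ultimately show False using nonforking unfolding nonforking_def by blast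
qed

section \<open>Dividing over a larger base and left transitivity\<close>

lemma fiber_Aut:
  assumes "W \<in> Def {} (n + length d)" "f \<in> Aut D" "set d \<subseteq> U"
  shows "map f ` {y \<in> tup n. y @ d \<in> W} = {y \<in> tup n. y @ map f d \<in> W}"
proof (rule image_Aut_eqI[OF assms(2)])
  fix a assume a: "a \<in> tup n"
  have f: "f \<in> Aut {}" by (rule Aut_mono[OF assms(2)]) simp
  have "a @ d \<in> tup (n + length d)" using a assms(3) by (auto simp: tuples_def)
  from Def_fix[OF assms(1) f _ this]
  show "map f a \<in> {y \<in> tup n. y @ map f d \<in> W} \<longleftrightarrow> a \<in> {y \<in> tup n. y @ d \<in> W}"
    using a Aut_tuples[OF assms(2) a] by simp
qed auto

text \<open>Expresses that finitely many instances of W are jointly consistent; its negation states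
  k-inconsistency in compactness arguments. The coordinate \<open>g t j\<close> holds entry j of the
  t-th parameter tuple.\<close>

lemma definable_fiber:
  fixes g :: "'t \<Rightarrow> nat \<Rightarrow> 'i"
  assumes W: "W \<in> Def C (n + m)" and C: "C \<subseteq> U" and I: "finite I"
  shows "definable L M UNIV C (\<lambda>v. \<exists>x\<in>tup n. \<forall>t\<in>I. x @ map (\<lambda>j. v (g t j)) [0..<m] \<in> W)"
proof -
  let ?ts = "\<lambda>t. map (\<lambda>i. Inl (Inl i)) [0..<n] @ map (\<lambda>j. Inl (Inr (g t j))) [0..<m]
      :: ((nat + 'i) + 'm) list"
  have "definable L M (Inl ` {..<n} \<union> Inr ` UNIV) C (\<lambda>w. map (case_sum w id) (?ts t) \<in> W)" for t
    by (rule definable_Def[OF W]) (use C in auto)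
  then have "definable L M (Inl ` {..<n} \<union> Inr ` UNIV) C (\<lambda>w. \<forall>t\<in>I. map (case_sum w id) (?ts t) \<in> W)"
    by (intro definable_Ball[OF U_ne I])
  then have *: "definable L M UNIV C (\<lambda>v. \<exists>x\<in>tup n. \<forall>t\<in>I. map (case_sum (case_sum ((!) x) v) id) (?ts t) \<in> W)"
    by (rule definable_ex)
  have "map (case_sum (case_sum ((!) x) v) id) (?ts t) = x @ map (\<lambda>j. v (g t j)) [0..<m]"
    if "x \<in> tup n" for x v t
    using that by (auto simp: comp_def map_nth tuples_def)
  then show ?thesis by (intro definable_cong[OF *]) (simp only: cong: bex_cong)
qed

text \<open>Let d be the parameters of Y and let the \<open>f i\<close> witness dividing. A set in
  the type of c over B and D does not fork, so it does not divide along the \<open>f i\<close>: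
  arbitrarily many of its images share a point. By compactness there are a single copy of c and
  infinitely many k-inconsistent copies of d that all form with it a copy of the pair c d over D.
  Carrying the copy of c back to c gives automorphisms that fix c, and k has not changed.\<close>

lemma k_divides_extend:
  assumes div: "k_divides k D Y" and Y: "Y \<in> Def B n" and nonforking: "nonforking c D B"
    and D: "small_in D" and B: "B \<subseteq> U" and c: "set c \<subseteq> U"
  shows "k_divides k (D \<union> set c) Y"
proof -
  let ?l = "length c"
  have DU: "D \<subseteq> U" using D by (rule small_inD)
  obtain f where f: "\<And>i::nat. f i \<in> Aut D"
    "\<And>I. finite I \<and> card I = k \<Longrightarrow> (\<Inter>i\<in>I. map (f i) ` Y) = {}"
    using div unfolding k_divides_def by blast
  obtain d W where d: "set d \<subseteq> B" and W: "W \<in> Def {} (n + length d)"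
    and Y_eq: "Y = {y \<in> tup n. y @ d \<in> W}"
    using Def_split[of Y "{}" B n] Y B by auto
  let ?m = "length d"
  have dU: "set d \<subseteq> U" using d B by blast
  have cd: "c @ d \<in> tup (?l + ?m)" using c dU by (auto simp: tuples_def)
  have image_Y: "map g ` Y = {y \<in> tup n. y @ map g d \<in> W}" if "g \<in> Aut D" for g
    unfolding Y_eq by (rule fiber_Aut[OF W that dU])
  \<comment> \<open>\<open>Inl i\<close> is entry i of the common copy of c, and
    \<open>Inr (t, j)\<close> is entry j of the t-th copy of d.\<close>
  define xs where "xs v = map (\<lambda>i. v (Inl i)) [0..<?l]" for v :: "nat + nat \<times> nat \<Rightarrow> 'm"
  define ys where "ys v t = map (\<lambda>j. v (Inr (t, j))) [0..<?m]" for v :: "nat + nat \<times> nat \<Rightarrow> 'm" and t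
  define G where "G = {Z \<in> Def D (?l + ?m). c @ d \<in> Z}"
  define P where "P Z t v \<longleftrightarrow> xs v @ ys v t \<in> Z" for Z t v
  define Q where "Q I v \<longleftrightarrow> \<not> (\<exists>x\<in>tup n. \<forall>t\<in>I. x @ ys v t \<in> W)" for I v
  \<comment> \<open>\<open>Idx\<close> names the conditions for compactness: P puts the pair with
    the t-th copy of d into a set of the type of \<open>c @ d\<close>, and Q makes k copies
    inconsistent.\<close>
  define h where "h = case_sum (\<lambda>(Z, t). P Z t) Q"
  define Idx :: "('m list set \<times> nat + nat set) set" where
    "Idx = (G \<times> UNIV) <+> {I. finite I \<and> card I = k}"
  have definable_P: "definable L M UNIV D (P Z t)" if Z: "Z \<in> Def D (?l + ?m)" for Z t
  proof -
    let ?ts = "map (\<lambda>i. Inl (Inl i)) [0..<?l] @ map (\<lambda>j. Inl (Inr (t, j))) [0..<?m]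
        :: ((nat + nat \<times> nat) + 'm) list"
    have "definable L M UNIV D (\<lambda>v. map (case_sum v id) ?ts \<in> Z)"
      by (rule definable_Def[OF Z]) (use DU in auto)
    then show ?thesis by (simp add: P_def[abs_def] xs_def ys_def comp_def)
  qed
  have definable_Q: "definable L M UNIV D (Q I)" if I: "finite I" for I
    using definable_neg[OF definable_fiber[OF Def_mono[OF W empty_subsetI] DU I, of "\<lambda>t j. Inr (t, j)"]]
    by (simp add: Q_def[abs_def] ys_def)
  have sat: "\<exists>v. range v \<subseteq> U \<and> (\<forall>Z\<in>G0. \<forall>t<N. P Z t v) \<and> (\<forall>I. I \<subseteq> {..<N} \<and> card I = k \<longrightarrow> Q I v)"
    if G0: "finite G0" "G0 \<subseteq> G" for G0 N
  proof -
    have mem: "Z \<in> Def D (?l + ?m) \<and> c @ d \<in> Z" if "Z \<in> G0" for Z using that G0(2) by (auto simp: G_def)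
    obtain Z0 where Z0: "Z0 \<in> Def D (?l + ?m)" "c @ d \<in> Z0" "\<And>Z. Z \<in> G0 \<Longrightarrow> Z0 \<subseteq> Z"
      using type_finite_part[OF G0(1) mem cd DU] by metis
    define Z' where "Z' = {x \<in> tup ?l. x @ d \<in> Z0}"
    have Z'_Def: "Z' \<in> Def (B \<union> D) ?l"
      unfolding Z'_def using Def_mono[OF Def_fiber[OF Z0(1) dU DU]] d by blast
    moreover have "c \<in> Z'" using Z0(2) c by (simp add: Z'_def tuplesI)
    ultimately have "\<not> forking D ?l Z'" using nonforking unfolding nonforking_def by blast
    \<comment> \<open>\<open>Suc N\<close> indices instead of N guarantee that there is one even for
      N = 0, so that the common point \<open>x0\<close> is a tuple of the right length.\<close>
    then have "\<not> k_divides (Suc N) D Z'" using forking_sdivk[OF _ Z'_Def] B DU by blast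
    then have "\<not> (\<forall>I. finite I \<and> card I = Suc N \<longrightarrow> (\<Inter>i\<in>I. map (f i) ` Z') = {})"
      using f(1) unfolding k_divides_def by metis
    then obtain I where I: "finite I" "card I = Suc N" "(\<Inter>i\<in>I. map (f i) ` Z') \<noteq> {}" by blast
    then obtain x0 where x0: "\<And>i. i \<in> I \<Longrightarrow> x0 \<in> map (f i) ` Z'" by blast
    obtain e where e: "bij_betw e {0..<Suc N} I" using ex_bij_betw_nat_finite[OF I(1)] I(2) by auto
    have eI: "e t \<in> I" if "t < Suc N" for t using bij_betw_apply[OF e] that by simp
    have "x0 \<in> map (f (e 0)) ` Z'" using x0 eI by simp
    then have x0t: "x0 \<in> tup ?l" using Aut_tuples[OF f(1)] by (auto simp: Z'_def)
    have x0_Z0: "x0 @ map (f i) d \<in> Z0" if "i \<in> I" for i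
    proof -
      obtain z where z: "z \<in> Z'" "x0 = map (f i) z" using x0[OF \<open>i \<in> I\<close>] by blast
      have "z @ d \<in> Z0" "z @ d \<in> tup (?l + ?m)" using z(1) dU by (auto simp: Z'_def tuples_def)
      then have "map (f i) (z @ d) \<in> Z0" using Def_fix[OF Z0(1) f(1) DU] by blast
      then show ?thesis by (simp add: z(2))
    qed
    obtain u where u: "u \<in> U" using U_ne by blast
    define v where "v = case_sum (\<lambda>i. if i < ?l then x0 ! i else u)
      (\<lambda>(t, j). if t < N \<and> j < ?m then f (e t) (d ! j) else u)"
    have xs_v: "xs v = x0" using x0t by (auto simp: xs_def v_def tuples_def intro: nth_equalityI)
    have ys_v: "ys v t = map (f (e t)) d" if "t < N" for t
      using that by (auto simp: ys_def v_def intro: nth_equalityI)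
    have "v i \<in> U" for i
    proof (cases i)
      case (Inl j)
      then show ?thesis using tuplesD[OF x0t] u nth_mem[of j x0] by (auto simp: v_def)
    next
      case (Inr p)
      then show ?thesis using Aut_U[OF f(1)] dU u nth_mem[of "snd p" d]
        by (cases p) (auto simp: v_def subset_iff)
    qed
    then have "range v \<subseteq> U" by blast
    moreover have "\<forall>Z\<in>G0. \<forall>t<N. P Z t v"
    proof (intro ballI allI impI)
      fix Z t assume "Z \<in> G0" "t < N"
      then show "P Z t v" using x0_Z0[OF eI[of t]] Z0(3) by (auto simp: P_def xs_v ys_v)
    qed
    moreover have "Q I0 v" if I0: "I0 \<subseteq> {..<N}" "card I0 = k" for I0
      unfolding Q_def
    proof
      assume "\<exists>x\<in>tup n. \<forall>t\<in>I0. x @ ys v t \<in> W"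
      then obtain x where x: "x \<in> tup n" "\<forall>t\<in>I0. x @ ys v t \<in> W" by blast
      have "x \<in> map (f (e t)) ` Y" if "t \<in> I0" for t
      proof -
        have "t < N" using I0(1) that by blast
        moreover have "x @ ys v t \<in> W" using x(2) that by blast
        ultimately show ?thesis using x(1) by (simp add: image_Y[OF f(1)] ys_v)
      qed
      then have "x \<in> (\<Inter>i\<in>e ` I0. map (f i) ` Y)" by simp
      moreover have "inj_on e {0..<Suc N}" using e by (simp add: bij_betw_def)
      then have "inj_on e I0" by (rule inj_on_subset) (use I0(1) in auto)
      then have "card (e ` I0) = k" using I0(2) by (simp add: card_image)
      moreover have "finite (e ` I0)" using I0(1) finite_subset by blast
      ultimately show False using f(2) by blast
    qed
    ultimately show ?thesis by blast
  qed
  have fin: "\<exists>v. range v \<subseteq> U \<and> (\<forall>R\<in>F0. R v)" if F0: "finite F0" "F0 \<subseteq> h ` Idx" for F0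
  proof -
    obtain S where S: "S \<subseteq> Idx" "finite S" "F0 = h ` S" using finite_subset_image[OF F0] by blast
    define G0 where "G0 = fst ` projl ` (S \<inter> range Inl)"
    define N0 where "N0 = snd ` projl ` (S \<inter> range Inl) \<union> \<Union>(projr ` (S \<inter> range Inr))"
    have "finite I" if "Inr I \<in> S" for I using S(1) that by (auto simp: Idx_def)
    then have "finite N0" using S(2) by (auto simp: N0_def)
    then obtain N where N: "\<forall>t\<in>N0. t < N" unfolding finite_nat_set_iff_bounded by blast
    have "finite G0" "G0 \<subseteq> G" using S by (auto simp: G0_def Idx_def)
    from sat[OF this, of N] obtain v where v: "range v \<subseteq> U" "\<forall>Z\<in>G0. \<forall>t<N. P Z t v"
      "\<forall>I. I \<subseteq> {..<N} \<and> card I = k \<longrightarrow> Q I v"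
      by (elim exE conjE)
    have "h s v" if s: "s \<in> S" for s
    proof (cases s)
      case (Inl p)
      obtain Z t where p: "p = (Z, t)" by (cases p)
      have p': "p \<in> projl ` (S \<inter> range Inl)"
        by (rule image_eqI[of _ _ "Inl p"]) (use s Inl in auto)
      have "Z \<in> fst ` projl ` (S \<inter> range Inl)" by (rule image_eqI[OF _ p']) (simp add: p)
      moreover have "t \<in> snd ` projl ` (S \<inter> range Inl)" by (rule image_eqI[OF _ p']) (simp add: p)
      ultimately have "Z \<in> G0" "t \<in> N0" unfolding G0_def N0_def by simp_all
      then show ?thesis using v(2) N by (simp add: h_def Inl p)
    next
      case (Inr I)
      have "I \<in> projr ` (S \<inter> range Inr)"
        by (rule image_eqI[of _ _ "Inr I"]) (use s Inr in auto)
      then have "I \<subseteq> N0" by (auto simp: N0_def)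
      moreover have "card I = k" using s S(1) Inr by (auto simp: Idx_def)
      ultimately show ?thesis using v(3) N by (auto simp: h_def Inr)
    qed
    then show ?thesis using v(1) S(3) by blast
  qed
  have definable_h: "definable L M UNIV D R" if R: "R \<in> h ` Idx" for R
    using R definable_P definable_Q by (auto simp: h_def Idx_def G_def)
  obtain v where v: "range v \<subseteq> U" "\<And>R. R \<in> h ` Idx \<Longrightarrow> R v"
    using compactness[OF definable_h D fin] by metis
  have P: "xs v @ ys v t \<in> Z" if "Z \<in> Def D (?l + ?m)" "c @ d \<in> Z" for Z t
  proof -
    have "Inl (Z, t) \<in> Idx" using that by (auto simp: Idx_def G_def)
    from v(2)[OF imageI[OF this]] show ?thesis by (simp add: h_def P_def)
  qed
  have Q: "\<not> (\<exists>x\<in>tup n. \<forall>t\<in>I. x @ ys v t \<in> W)" if "finite I" "card I = k" for I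
  proof -
    have "Inr I \<in> Idx" using that by (auto simp: Idx_def)
    from v(2)[OF imageI[OF this]] show ?thesis by (simp add: h_def Q_def)
  qed
  have len: "length (xs v) = ?l" "length (ys v t) = ?m" for t by (simp_all add: xs_def ys_def)
  have "\<exists>g. g \<in> Aut D \<and> map g (c @ d) = xs v @ ys v t" for t
  proof -
    have "xs v @ ys v t \<in> tup (?l + ?m)"
      using v(1) by (intro tuplesI) (auto simp: xs_def ys_def image_subset_iff)
    then show ?thesis using homogeneity[OF cd _ D P] by metis
  qed
  then obtain g where g: "\<And>t. g t \<in> Aut D" "\<And>t. map (g t) (c @ d) = xs v @ ys v t" by metis
  have g_c: "map (g t) c = xs v" and g_d: "map (g t) d = ys v t" for t
    using g(2)[of t] len by auto
  \<comment> \<open>All \<open>g t\<close> agree on c, so composing them with the inverse of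
    \<open>g 0\<close> makes them fix c.\<close>
  obtain \<rho> where \<rho>: "\<rho> \<in> Aut D" "\<And>x. x \<in> U \<Longrightarrow> \<rho> (g 0 x) = x" "\<And>x. x \<in> U \<Longrightarrow> g 0 (\<rho> x) = x"
    using Aut_inverse[OF g(1) DU] by metis
  have "\<rho> \<circ> g t \<in> Aut (D \<union> set c)" for t
  proof -
    have "\<rho> \<circ> g t \<in> Aut D" by (rule Aut_comp[OF \<rho>(1) g(1)])
    moreover have "(\<rho> \<circ> g t) x = x" if "x \<in> set c" for x
    proof -
      have "g t x = g 0 x" using g_c[of t] g_c[of 0] that by (metis map_eq_conv)
      then show ?thesis using \<rho>(2) that c by auto
    qed
    ultimately show ?thesis by (auto simp: Aut_def)
  qed
  moreover have "(\<Inter>t\<in>I. map (\<rho> \<circ> g t) ` Y) = {}" if I: "finite I \<and> card I = k" for I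
  proof (rule ccontr)
    assume "\<not> ?thesis"
    then obtain z where z: "\<And>t. t \<in> I \<Longrightarrow> z \<in> map (\<rho> \<circ> g t) ` Y" by blast
    \<comment> \<open>The intersection over the empty set would be \<open>UNIV\<close>; hence k is
      positive.\<close>
    have "I \<noteq> {}" using f(2)[OF I] by auto
    have Y_sub: "Y \<subseteq> tup n" by (rule Def_subset[OF Y])
    have z': "map (g 0) z \<in> map (g t) ` Y" if t: "t \<in> I" for t
    proof -
      obtain y where y: "y \<in> Y" "z = map (\<rho> \<circ> g t) y" using z[OF t] by blast
      have "set y \<subseteq> U" using y(1) Y_sub tuplesD by blast
      then have "map (g 0) z = map (g t) y" using \<rho>(3) Aut_U[OF g(1)] by (auto simp: y(2))
      then show ?thesis using y(1) by blast
    qed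
    then have "map (g 0) z \<in> tup n" "\<forall>t\<in>I. map (g 0) z @ ys v t \<in> W"
      using \<open>I \<noteq> {}\<close> image_Y[OF g(1)] g_d by auto
    then show False using Q I by blast
  qed
  ultimately show ?thesis unfolding k_divides_def by (intro exI[of _ "\<lambda>t. \<rho> \<circ> g t"]) blast
qed

text \<open>Suppose a set of the type of \<open>a @ c\<close> is covered by dividing sets with
  parameters \<open>B1\<close>. Moving a, and then c, makes both independent from \<open>B1\<close>
  as well, each over its own base. The moved pair lies in a covering set Y, which still divides over
  D and the moved a by \<open>k_divides_extend\<close>. So does the fibre of Y at the moved a, but
  this fibre contains the moved c.\<close>

lemma nonforking_append:
  assumes a: "nonforking a D B" and c: "nonforking c (D \<union> set a) B"
    and D: "small_in D" and B: "small_in B" and aU: "set a \<subseteq> U" and cU: "set c \<subseteq> U"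
  shows "nonforking (a @ c) D B"
  unfolding nonforking_def
proof (intro ballI impI notI)
  let ?n = "length a" let ?m = "length c"
  fix X assume X: "X \<in> Def (B \<union> D) (length (a @ c))" "a @ c \<in> X" "forking D (length (a @ c)) X"
  obtain S where S: "finite S" "S \<subseteq> Def U (?n + ?m)" "\<And>Y. Y \<in> S \<Longrightarrow> \<exists>k. k_divides k D Y" "X \<subseteq> \<Union>S"
    using X(3) unfolding forking_def by auto
  obtain B1 where B1: "finite B1" "B1 \<subseteq> U" "S \<subseteq> Def B1 (?n + ?m)" using Def_finite_params[OF S(1,2)] by metis
  have smB1: "small_in B1" using B1(1,2) by (rule small_in_finite)
  have DU: "D \<subseteq> U" and BU: "B \<subseteq> U" using D B by (auto simp: small_in_def)
  obtain f where f: "f \<in> Aut (D \<union> B)" "nonforking (map f a) D (B \<union> B1)"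
    by (rule extension[OF a D B smB1 aU])
  let ?a = "map f a"
  have a'U: "set ?a \<subseteq> U" using Aut_image_U[OF f(1) aU] by simp
  have "nonforking (map f c) (f ` (D \<union> set a)) (f ` B)"
    using DU aU by (intro nonforking_Aut[OF c f(1) cU _ BU]) simp
  moreover have "f ` D = D" "f ` B = B" using Aut_fix_image[OF f(1)] by auto
  ultimately have "nonforking (map f c) (D \<union> set ?a) B" by (simp add: image_Un)
  moreover have "small_in (D \<union> set ?a)" using D small_in_finite[OF _ a'U] small_in_Un by simp
  moreover have "set (map f c) \<subseteq> U" using Aut_image_U[OF f(1) cU] by simp
  ultimately obtain g where g: "g \<in> Aut (D \<union> set ?a \<union> B)" "nonforking (map g (map f c)) (D \<union> set ?a) (B \<union> B1)"
    using extension[OF _ _ B smB1] by metis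
  let ?c = "map g (map f c)"
  have "set (map f c) \<subseteq> U" using Aut_image_U[OF f(1) cU] by simp
  from Aut_image_U[OF g(1) this] have c'U: "set ?c \<subseteq> U" by (simp only: set_map)
  have "g \<circ> f \<in> Aut (B \<union> D)"
    using Aut_comp[OF Aut_mono[OF g(1), of "B \<union> D"] Aut_mono[OF f(1), of "B \<union> D"]] by blast
  moreover have "a @ c \<in> tup (length (a @ c))" using aU cU by (simp add: tuplesI)
  ultimately have "map (g \<circ> f) (a @ c) \<in> X"
    using Def_fix[OF X(1), of "g \<circ> f" "a @ c"] X(2) BU DU by simp
  moreover have "map g ?a = ?a" by (rule Aut_fix_map[OF g(1)]) auto
  then have "map (g \<circ> f) (a @ c) = ?a @ ?c" by (simp only: map_append map_map[symmetric])
  ultimately have "?a @ ?c \<in> X" by (simp only:)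
  then obtain Y where Y: "Y \<in> S" "?a @ ?c \<in> Y" using S(4) by blast
  have YB1: "Y \<in> Def B1 (length ?a + ?m)" using subsetD[OF B1(3) Y(1)] by simp
  obtain k where "k_divides k D Y" using S(3)[OF Y(1)] by (elim exE)
  moreover have "nonforking ?a D B1" by (rule nonforking_mono[OF f(2)]) auto
  ultimately have "k_divides k (D \<union> set ?a) Y" using k_divides_extend[OF _ YB1 _ D B1(2) a'U] by simp
  then obtain h where h: "\<And>i::nat. h i \<in> Aut (D \<union> set ?a)"
    "\<And>I. finite I \<and> card I = k \<Longrightarrow> (\<Inter>i\<in>I. map (h i) ` Y) = {}"
    unfolding k_divides_def by metis
  \<comment> \<open>The witnesses for Y fix \<open>?a\<close>, so they witness that the fibre over
    \<open>?a\<close> divides too.\<close>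
  define Y' where "Y' = {y \<in> tup ?m. ?a @ y \<in> Y}"
  have Y'_Def: "Y' \<in> Def (B \<union> B1 \<union> (D \<union> set ?a)) (length ?c)"
    using Def_mono[OF Def_fiber_left[OF YB1 a'U B1(2)], of "B \<union> B1 \<union> (D \<union> set ?a)"] by (auto simp: Y'_def)
  have "(\<Inter>i\<in>I. map (h i) ` Y') = {}" if I: "finite I \<and> card I = k" for I
  proof (rule ccontr)
    assume "\<not> ?thesis"
    then obtain y where y: "\<And>i. i \<in> I \<Longrightarrow> y \<in> map (h i) ` Y'" by blast
    have "?a @ y \<in> map (h i) ` Y" if i: "i \<in> I" for i
    proof -
      obtain z where z: "z \<in> Y'" "y = map (h i) z" using y[OF i] by blast
      have "map (h i) ?a = ?a" by (rule Aut_fix_map[OF h(1)]) auto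
      then have "?a @ y = map (h i) (?a @ z)" by (simp add: z(2))
      then show ?thesis using z(1) unfolding Y'_def by blast
    qed
    then have "?a @ y \<in> (\<Inter>i\<in>I. map (h i) ` Y)" by simp
    then show False using h(2)[OF I] by simp
  qed
  then have "k_divides k (D \<union> set ?a) Y'" unfolding k_divides_def using h(1) by (intro exI[of _ h]) simp
  moreover have "B \<union> B1 \<union> (D \<union> set ?a) \<subseteq> U" using BU B1(2) DU a'U by simp
  ultimately have "forking (D \<union> set ?a) (length ?c) Y'" by (rule forking_sdivk[OF _ Y'_Def])
  moreover have "?c \<in> Y'" using Y(2) c'U by (simp add: Y'_def tuplesI)
  ultimately show False using g(2) Y'_Def unfolding nonforking_def by blast
qed

text \<open>The entries of b are read off from a by a coordinate map that commutes with
  automorphisms, and preimages of dividing sets under it divide.\<close>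

lemma nonforking_subset:
  assumes nonforking: "nonforking a D B" and sub: "set b \<subseteq> set a" and a: "set a \<subseteq> U" and D: "D \<subseteq> U" and B: "B \<subseteq> U"
  shows "nonforking b D B"
  unfolding nonforking_def
proof (intro ballI impI notI)
  let ?n = "length a" let ?m = "length b"
  fix X assume X: "X \<in> Def (B \<union> D) ?m" "b \<in> X" "forking D ?m X"
  have "\<forall>x\<in>set b. \<exists>i<?n. a ! i = x" using sub by (metis in_set_conv_nth subsetD)
  then obtain g where g: "\<And>x. x \<in> set b \<Longrightarrow> g x < ?n \<and> a ! g x = x" by metis
  define f :: "'m list \<Rightarrow> 'm list" where "f x = map (\<lambda>y. x ! g y) b" for x
  have f_a: "f a = b" unfolding f_def by (rule map_idI) (simp add: g)
  have f_Aut: "f (map \<sigma> x) = map \<sigma> (f x)" if "x \<in> tup ?n" for \<sigma> x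
    using that g by (simp add: f_def tuples_def)
  define pre where "pre Y = {x \<in> tup ?n. f x \<in> Y}" for Y
  have pre_Def: "pre Y \<in> Def C ?n" if "Y \<in> Def C ?m" "C \<subseteq> U" for Y C
  proof -
    have "{x \<in> tup ?n. map (case_sum ((!) x) id) (map (\<lambda>y. Inl (g y)) b) \<in> Y} \<in> Def C ?n"
      using g that by (intro Def_preimage) auto
    then show ?thesis by (simp add: pre_def f_def comp_def)
  qed
  obtain S where S: "finite S" "S \<subseteq> Def U ?m" "\<And>Y. Y \<in> S \<Longrightarrow> \<exists>k. k_divides k D Y" "X \<subseteq> \<Union>S"
    using X(3) unfolding forking_def by auto
  have "\<exists>k. k_divides k D (pre Y)" if YS: "Y \<in> S" for Y
  proof -
    obtain k \<sigma> where \<sigma>: "\<And>i::nat. \<sigma> i \<in> Aut D" "\<And>I. finite I \<and> card I = k \<Longrightarrow> (\<Inter>i\<in>I. map (\<sigma> i) ` Y) = {}"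
      using S(3)[OF YS] unfolding k_divides_def by auto
    have "(\<Inter>i\<in>I. map (\<sigma> i) ` pre Y) = {}" if I: "finite I \<and> card I = k" for I
    proof (rule ccontr)
      assume "\<not> ?thesis"
      then obtain y where y: "\<And>i. i \<in> I \<Longrightarrow> y \<in> map (\<sigma> i) ` pre Y" by blast
      have "f y \<in> map (\<sigma> i) ` Y" if i: "i \<in> I" for i
      proof -
        obtain z where "z \<in> pre Y" "y = map (\<sigma> i) z" using y[OF i] by blast
        then show ?thesis using f_Aut by (auto simp: pre_def)
      qed
      then have "f y \<in> (\<Inter>i\<in>I. map (\<sigma> i) ` Y)" by simp
      then show False using \<sigma>(2)[OF I] by simp
    qed
    then show ?thesis unfolding k_divides_def using \<sigma>(1) by (intro exI[of _ k] exI[of _ \<sigma>]) simp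
  qed
  moreover have "pre ` S \<subseteq> Def U ?n" using S(2) pre_Def by blast
  moreover have "pre X \<subseteq> \<Union>(pre ` S)" using S(4) unfolding pre_def by blast
  ultimately have "forking D ?n (pre X)" unfolding forking_def using S(1)
    by (intro exI[of _ "pre ` S"]) simp
  moreover have "a \<in> pre X" using X(2) a f_a by (simp add: pre_def tuplesI)
  moreover have "pre X \<in> Def (B \<union> D) ?n" using X(1) B D by (intro pre_Def) auto
  ultimately show False using nonforking unfolding nonforking_def by blast
qed

lemma indep_iff:
  assumes "small_in D" "small_in B" "set a \<subseteq> U"
  shows "ind (set a) D B \<longleftrightarrow> nonforking a D B"
proof
  assume "ind (set a) D B"
  then show "nonforking a D B" using forks_iff[OF assms] unfolding indep_def by blast
next
  assume nonforking: "nonforking a D B"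
  show "ind (set a) D B" unfolding indep_def
  proof
    fix b assume "b \<in> lists (set a)"
    then have b: "set b \<subseteq> set a" by auto
    then have "nonforking b D B" using nonforking_subset[OF nonforking b assms(3)] assms(1,2) by (simp add: small_in_def)
    then show "\<not> forks L M (length b) (tp L M b (B \<union> D)) D"
      using forks_iff[OF assms(1,2), of b] b assms(3) by auto
  qed
qed

end

subsection \<open>Rank\<close>

text \<open>\<open>rank_ge \<Delta> j X\<close> is Shelah's \<open>D(X, \<Delta>) \<ge> j\<close>. An element \<open>(F, k)\<close> of \<open>\<Delta>\<close> stands for a formula, given by the
  family \<open>F\<close> of its instances, together with the bound for the inconsistency.\<close>

primrec rank_ge :: "('a set set \<times> nat) set \<Rightarrow> nat \<Rightarrow> 'a set \<Rightarrow> bool" where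
  "rank_ge \<Delta> 0 X \<longleftrightarrow> X \<noteq> {}"
| "rank_ge \<Delta> (Suc j) X \<longleftrightarrow> (\<exists>\<delta>\<in>\<Delta>. \<exists>Y :: nat \<Rightarrow> 'a set. (\<forall>i. Y i \<in> fst \<delta>) \<and>
     (\<forall>I. finite I \<and> card I = snd \<delta> \<longrightarrow> (\<Inter>i\<in>I. Y i) = {}) \<and> (\<forall>i. rank_ge \<Delta> j (X \<inter> Y i)))"

lemma rank_ge_SucE:
  assumes "rank_ge \<Delta> (Suc j) X"
  obtains \<delta> Y where "\<delta> \<in> \<Delta>" "\<And>i::nat. Y i \<in> fst \<delta>"
    "\<And>I. finite I \<Longrightarrow> card I = snd \<delta> \<Longrightarrow> (\<Inter>i\<in>I. Y i) = {}" "\<And>i. rank_ge \<Delta> j (X \<inter> Y i)"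
proof -
  obtain \<delta> Y where "\<delta> \<in> \<Delta>" "\<forall>i::nat. Y i \<in> fst \<delta>"
    "\<forall>I. finite I \<and> card I = snd \<delta> \<longrightarrow> (\<Inter>i\<in>I. Y i) = {}" "\<forall>i. rank_ge \<Delta> j (X \<inter> Y i)"
    using assms unfolding rank_ge.simps by (elim bexE exE conjE)
  then show ?thesis by (intro that[of \<delta> Y]) simp_all
qed

lemma rank_ge_SucI:
  assumes "\<delta> \<in> \<Delta>" "\<And>i::nat. Y i \<in> fst \<delta>"
    "\<And>I. finite I \<Longrightarrow> card I = snd \<delta> \<Longrightarrow> (\<Inter>i\<in>I. Y i) = {}" "\<And>i. rank_ge \<Delta> j (X \<inter> Y i)"
  shows "rank_ge \<Delta> (Suc j) X"
  unfolding rank_ge.simps using assms by (intro bexI[of _ \<delta>] exI[of _ Y]) simp_all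

lemma rank_ge_mono: "rank_ge \<Delta> j X \<Longrightarrow> X \<subseteq> X' \<Longrightarrow> rank_ge \<Delta> j X'"
proof (induction j arbitrary: X X')
  case (Suc j)
  obtain \<delta> Y where \<delta>: "\<delta> \<in> \<Delta>" "\<And>i::nat. Y i \<in> fst \<delta>"
    "\<And>I. finite I \<Longrightarrow> card I = snd \<delta> \<Longrightarrow> (\<Inter>i\<in>I. Y i) = {}" "\<And>i. rank_ge \<Delta> j (X \<inter> Y i)"
    using rank_ge_SucE[OF Suc.prems(1)] by metis
  have "rank_ge \<Delta> j (X' \<inter> Y i)" for i by (rule Suc.IH[OF \<delta>(4)[of i]]) (use Suc.prems(2) in blast)
  with \<delta>(1-3) show ?case by (rule rank_ge_SucI)
qed auto

lemma rank_ge_Suc: "rank_ge \<Delta> (Suc j) X \<Longrightarrow> rank_ge \<Delta> j X"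
  using rank_ge_SucE rank_ge_mono by (metis inf_le1)

lemma rank_ge_nonempty: "rank_ge \<Delta> j X \<Longrightarrow> X \<noteq> {}"
  by (induction j) (use rank_ge_Suc in \<open>auto simp del: rank_ge.simps(2)\<close>)

text \<open>For infinitely many i the same one of X and \<open>X'\<close> inherits the rank inside
  \<open>Y i\<close>, and passing to a subsequence preserves the inconsistency condition.\<close>

lemma rank_ge_Un: "rank_ge \<Delta> j (X \<union> X') \<Longrightarrow> rank_ge \<Delta> j X \<or> rank_ge \<Delta> j X'"
proof (induction j arbitrary: X X')
  case (Suc j)
  obtain \<delta> Y where \<delta>: "\<delta> \<in> \<Delta>" "\<And>i::nat. Y i \<in> fst \<delta>"
    "\<And>I. finite I \<Longrightarrow> card I = snd \<delta> \<Longrightarrow> (\<Inter>i\<in>I. Y i) = {}" "\<And>i. rank_ge \<Delta> j ((X \<union> X') \<inter> Y i)"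
    using rank_ge_SucE[OF Suc.prems] by metis
  have pass: "rank_ge \<Delta> (Suc j) Z" if inf: "infinite {i. rank_ge \<Delta> j (Z \<inter> Y i)}" for Z
  proof -
    obtain e :: "nat \<Rightarrow> nat" where e: "inj e" "range e \<subseteq> {i. rank_ge \<Delta> j (Z \<inter> Y i)}"
      using infinite_countable_subset[OF inf] by blast
    show ?thesis
    proof (rule rank_ge_SucI[OF \<delta>(1)])
      show "(\<Inter>i\<in>I. Y (e i)) = {}" if "finite I" "card I = snd \<delta>" for I
      proof -
        have "card (e ` I) = snd \<delta>" using that(2) e(1) by (simp add: card_image inj_on_subset)
        then show ?thesis using \<delta>(3)[of "e ` I"] that(1) by simp
      qed
    qed (use \<delta>(2) e(2) in auto)
  qed
  have "{i. rank_ge \<Delta> j (X \<inter> Y i)} \<union> {i. rank_ge \<Delta> j (X' \<inter> Y i)} = UNIV"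
    using Suc.IH \<delta>(4) by (auto simp: Int_Un_distrib2)
  then have "infinite {i. rank_ge \<Delta> j (X \<inter> Y i)} \<or> infinite {i. rank_ge \<Delta> j (X' \<inter> Y i)}"
    by (metis finite_UnI infinite_UNIV_nat)
  then show ?case using pass by metis
qed auto

lemma rank_ge_Union:
  assumes "finite S" "rank_ge \<Delta> j X" "X \<subseteq> \<Union>S"
  shows "\<exists>Y\<in>S. rank_ge \<Delta> j (X \<inter> Y)"
  using assms
proof (induction S arbitrary: X)
  case empty
  then show ?case using rank_ge_nonempty by fastforce
next
  case (insert Z S)
  have "rank_ge \<Delta> j ((X \<inter> Z) \<union> (X \<inter> \<Union>S))" by (rule rank_ge_mono[OF insert.prems(1)]) (use insert.prems(2) in blast)
  then consider "rank_ge \<Delta> j (X \<inter> Z)" | "rank_ge \<Delta> j (X \<inter> \<Union>S)" using rank_ge_Un by metis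
  then show ?case
  proof cases
    case 2
    then obtain Y where Y: "Y \<in> S" "rank_ge \<Delta> j (X \<inter> \<Union>S \<inter> Y)" using insert.IH by blast
    then have "rank_ge \<Delta> j (X \<inter> Y)" by (elim rank_ge_mono) blast
    then show ?thesis using Y(1) by blast
  qed blast
qed

text \<open>The first step of the rank uses some \<delta>. With the value of N at \<delta> lowered
  by one, the induction hypothesis applies inside each \<open>Y i\<close>. Either another element of
  \<Delta> reaches its value in one of them, or \<delta> does in all of them, and then the family Y
  supplies the missing step.\<close>

lemma rank_ge_pigeonhole:
  assumes "finite \<Delta>" "rank_ge \<Delta> (Suc (\<Sum>\<delta>\<in>\<Delta>. N \<delta>)) X"
  shows "\<exists>\<delta>\<in>\<Delta>. rank_ge {\<delta>} (N \<delta>) X"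
  using assms(2)
proof (induction "\<Sum>\<delta>\<in>\<Delta>. N \<delta>" arbitrary: N X rule: less_induct)
  case less
  obtain \<delta> Y where \<delta>: "\<delta> \<in> \<Delta>" "\<And>i::nat. Y i \<in> fst \<delta>"
    "\<And>I. finite I \<Longrightarrow> card I = snd \<delta> \<Longrightarrow> (\<Inter>i\<in>I. Y i) = {}" "\<And>i. rank_ge \<Delta> (\<Sum>\<delta>\<in>\<Delta>. N \<delta>) (X \<inter> Y i)"
    using rank_ge_SucE[OF less.prems] by metis
  show ?case
  proof (cases "N \<delta>")
    case 0
    then show ?thesis using \<delta>(1) rank_ge_nonempty[OF less.prems] by (intro bexI[of _ \<delta>]) auto
  next
    case (Suc p)
    define N' where "N' = N(\<delta> := p)"
    have sum: "(\<Sum>\<delta>\<in>\<Delta>. N \<delta>) = Suc (\<Sum>\<delta>\<in>\<Delta>. N' \<delta>)"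
      using sum.remove[OF assms(1) \<delta>(1), of N] sum.remove[OF assms(1) \<delta>(1), of N'] Suc
      by (simp add: N'_def)
    have IH: "\<exists>\<epsilon>\<in>\<Delta>. rank_ge {\<epsilon>} (N' \<epsilon>) (X \<inter> Y i)" for i
      using less.hyps[of N' "X \<inter> Y i"] \<delta>(4)[of i] sum by simp
    show ?thesis
    proof (cases "\<exists>i. \<exists>\<epsilon>\<in>\<Delta>. \<epsilon> \<noteq> \<delta> \<and> rank_ge {\<epsilon>} (N' \<epsilon>) (X \<inter> Y i)")
      case True
      then obtain i \<epsilon> where \<epsilon>: "\<epsilon> \<in> \<Delta>" "\<epsilon> \<noteq> \<delta>" "rank_ge {\<epsilon>} (N' \<epsilon>) (X \<inter> Y i)" by blast
      then have "rank_ge {\<epsilon>} (N \<epsilon>) X" using rank_ge_mono[OF \<epsilon>(3), of X] by (simp add: N'_def)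
      then show ?thesis using \<epsilon>(1) by blast
    next
      case False
      then have "rank_ge {\<delta>} p (X \<inter> Y i)" for i using IH[of i] by (metis N'_def fun_upd_same)
      then have "rank_ge {\<delta>} (Suc p) X" by (intro rank_ge_SucI[of \<delta> _ Y]) (use \<delta> in auto)
      then have "rank_ge {\<delta>} (N \<delta>) X" by (simp only: Suc)
      then show ?thesis using \<delta>(1) by blast
    qed
  qed
qed

context monster
begin

section \<open>Ranks of formulas and the tree property\<close>

definition instances :: "('f, 'r) fm \<Rightarrow> nat \<Rightarrow> nat \<Rightarrow> 'm list set set" where
  "instances \<phi> n m = (\<lambda>b. dset n (\<phi>, b)) ` tup m"

lemma instances_Aut:
  assumes "Y \<in> instances \<phi> n m" "f \<in> Aut D" "\<phi> \<in> formulas L (n + m)"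
  shows "map f ` Y \<in> instances \<phi> n m"
proof -
  obtain b where b: "b \<in> tup m" "Y = dset n (\<phi>, b)" using assms(1) by (auto simp: instances_def)
  have "(\<phi>, b) \<in> pformulas L U n" using b(1) assms(3) by (auto simp: pformulas_def tuples_def)
  from dset_Aut[OF this assms(2)] show ?thesis using b Aut_tuples[OF assms(2) b(1)] by (auto simp: instances_def)
qed

lemma inj_on_map_Aut: "f \<in> Aut D \<Longrightarrow> inj_on (map f) (tup n)"
proof (rule inj_onI)
  fix x y assume f: "f \<in> Aut D" and xy: "x \<in> tup n" "y \<in> tup n" "map f x = map f y"
  then have "map f x \<in> map f ` {y}" by simp
  then show "x = y" using mem_image_Aut[OF f, of "{y}" n x] xy by simp
qed

lemma rank_ge_Aut:
  assumes f: "f \<in> Aut D" and \<Delta>: "\<And>\<delta> Y. \<delta> \<in> \<Delta> \<Longrightarrow> Y \<in> fst \<delta> \<Longrightarrow> Y \<subseteq> tup n \<and> map f ` Y \<in> fst \<delta>"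
  shows "rank_ge \<Delta> j X \<Longrightarrow> X \<subseteq> tup n \<Longrightarrow> rank_ge \<Delta> j (map f ` X)"
proof (induction j arbitrary: X)
  case (Suc j)
  obtain \<delta> Y where \<delta>: "\<delta> \<in> \<Delta>" "\<And>i::nat. Y i \<in> fst \<delta>"
    "\<And>I. finite I \<Longrightarrow> card I = snd \<delta> \<Longrightarrow> (\<Inter>i\<in>I. Y i) = {}" "\<And>i. rank_ge \<Delta> j (X \<inter> Y i)"
    using rank_ge_SucE[OF Suc.prems(1)] by metis
  have Yt: "Y i \<subseteq> tup n" for i using \<Delta>[OF \<delta>(1,2)] by simp
  show ?case
  proof (rule rank_ge_SucI[OF \<delta>(1)])
    show "map f ` Y i \<in> fst \<delta>" for i using \<Delta>[OF \<delta>(1,2)] by simp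
    show "(\<Inter>i\<in>I. map f ` Y i) = {}" if I: "finite I" "card I = snd \<delta>" for I
    proof (rule ccontr)
      assume "\<not> ?thesis"
      then obtain z where z: "\<And>i. i \<in> I \<Longrightarrow> z \<in> map f ` Y i" by blast
      have "I \<noteq> {}" using \<delta>(3)[OF I] by auto
      then obtain i0 where i0: "i0 \<in> I" by blast
      obtain y where y: "y \<in> Y i0" "z = map f y" using z[OF i0] by blast
      have "y \<in> Y i" if "i \<in> I" for i
        using z[OF that] mem_image_Aut[OF f Yt] y Yt by (metis subsetD)
      then show False using \<delta>(3)[OF I] by blast
    qed
    show "rank_ge \<Delta> j (map f ` X \<inter> map f ` Y i)" for i
    proof -
      have "map f ` (X \<inter> Y i) = map f ` X \<inter> map f ` Y i"
        by (rule inj_on_image_Int[OF inj_on_map_Aut[OF f] Suc.prems(2) Yt])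
      moreover have "rank_ge \<Delta> j (map f ` (X \<inter> Y i))" using Suc.IH[OF \<delta>(4)] Suc.prems(2) by blast
      ultimately show ?thesis by simp
    qed
  qed
qed auto

text \<open>Unfolding the rank, the family chosen at a node supplies the parameters of its children.
  Both conditions mention nonempty nodes only, so the root carries a default.\<close>

lemma rank_ge_tree:
  assumes "rank_ge {(instances \<phi> n m, k)} N X"
  shows "\<exists>b :: nat list \<Rightarrow> 'm list. (\<forall>s. b s \<in> tup m) \<and>
    (\<forall>s. length s < N \<longrightarrow> (\<forall>I. finite I \<and> card I = k \<longrightarrow> (\<Inter>i\<in>I. dset n (\<phi>, b (s @ [i]))) = {})) \<and>
    (\<forall>s. length s \<le> N \<longrightarrow> (\<exists>x\<in>X. \<forall>j\<in>{1..length s}. x \<in> dset n (\<phi>, b (take j s))))"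
  using assms
proof (induction N arbitrary: X)
  case 0
  obtain u where "u \<in> tup m" using tuples_ne by blast
  then show ?case using 0 by (intro exI[of _ "\<lambda>_. u"]) auto
next
  case (Suc N)
  obtain u where u: "u \<in> tup m" using tuples_ne by blast
  obtain Y where Y: "\<And>i::nat. Y i \<in> instances \<phi> n m"
    "\<And>I. finite I \<Longrightarrow> card I = k \<Longrightarrow> (\<Inter>i\<in>I. Y i) = {}" "\<And>i. rank_ge {(instances \<phi> n m, k)} N (X \<inter> Y i)"
    using rank_ge_SucE[OF Suc.prems] by (metis fst_conv singletonD snd_conv)
  have "\<forall>i. \<exists>c. c \<in> tup m \<and> Y i = dset n (\<phi>, c)" using Y(1) by (auto simp: instances_def)
  then obtain c where c: "\<And>i. c i \<in> tup m" "\<And>i. Y i = dset n (\<phi>, c i)" by metis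
  let ?good = "\<lambda>i (b :: nat list \<Rightarrow> 'm list). (\<forall>s. b s \<in> tup m) \<and>
    (\<forall>s. length s < N \<longrightarrow> (\<forall>I. finite I \<and> card I = k \<longrightarrow> (\<Inter>i\<in>I. dset n (\<phi>, b (s @ [i]))) = {})) \<and>
    (\<forall>s. length s \<le> N \<longrightarrow> (\<exists>x\<in>X \<inter> Y i. \<forall>j\<in>{1..length s}. x \<in> dset n (\<phi>, b (take j s))))"
  have "\<forall>i. \<exists>b. ?good i b" by (intro allI Suc.IH[OF Y(3)])
  from choice[OF this] obtain B where B: "\<forall>i. ?good i (B i)" by (elim exE)
  \<comment> \<open>Child i gets the parameter \<open>c i\<close>; below it hangs the tree
    \<open>B i\<close> of the induction hypothesis, whose branches are realized inside
    \<open>X \<inter> Y i\<close>.\<close>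
  define b where "b s = (case s of [] \<Rightarrow> u | i # r \<Rightarrow> if r = [] then c i else B i r)" for s
  show ?case
  proof (intro exI[of _ b] conjI allI impI)
    show "b s \<in> tup m" for s using u c(1) B[THEN spec, THEN conjunct1] by (auto simp: b_def split: list.split)
    fix s :: "nat list" and I :: "nat set" assume s: "length s < Suc N" and I: "finite I \<and> card I = k"
    show "(\<Inter>i\<in>I. dset n (\<phi>, b (s @ [i]))) = {}"
    proof (cases s)
      case Nil
      then show ?thesis using Y(2)[of I] I by (simp add: b_def c(2))
    next
      case (Cons i r)
      then have "length r < N" using s by simp
      then have "(\<Inter>i'\<in>I. dset n (\<phi>, B i (r @ [i']))) = {}" using B[rule_format, of i] I by blast
      then show ?thesis by (simp add: Cons b_def)
    qed
  next
    fix s :: "nat list" assume s: "length s \<le> Suc N"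
    show "\<exists>x\<in>X. \<forall>j\<in>{1..length s}. x \<in> dset n (\<phi>, b (take j s))"
    proof (cases s)
      case Nil
      then show ?thesis using rank_ge_nonempty[OF Suc.prems] by auto
    next
      case (Cons i r)
      then have "length r \<le> N" using s by simp
      from B[THEN spec, THEN conjunct2, THEN conjunct2, rule_format, OF this, of i]
      obtain x where "x \<in> X \<inter> Y i" and x': "\<forall>j\<in>{1..length r}. x \<in> dset n (\<phi>, B i (take j r))" by (elim bexE)
      then have x: "x \<in> X" "x \<in> Y i" by simp_all
      have "x \<in> dset n (\<phi>, b (take j s))" if j: "j \<in> {1..length s}" for j
      proof (cases "j = 1")
        case True
        then show ?thesis using x(2) by (simp add: Cons b_def c(2))
      next
        case False
        then obtain j' where j': "j = Suc j'" "j' \<in> {1..length r}" using j Cons by (cases j) auto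
        then have "take j' r \<noteq> []" by auto
        then show ?thesis using bspec[OF x' j'(2)] by (simp add: Cons b_def j'(1))
      qed
      then show ?thesis using x(1) by blast
    qed
  qed
qed

text \<open>The ranks give trees of every finite height with one and the same k; compactness over
  the countably many nodes joins them to an infinite tree.\<close>

lemma tree_propertyI:
  assumes \<phi>: "\<phi> \<in> formulas L (n + m)" and rank_ge: "\<And>N. rank_ge {(instances \<phi> n m, k)} N (tup n)"
  shows "tree_property M n m \<phi>"
proof -
  define W where "W = dset (n + m) (\<phi>, [])"
  have W: "W \<in> Def {} (n + m)" unfolding Def_def W_def using \<phi> by (auto simp: pformulas_def)
  have W_iff: "x @ y \<in> W \<longleftrightarrow> x \<in> dset n (\<phi>, y)" if "x \<in> tup n" "y \<in> tup m" for x y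
    using that by (auto simp: W_def dset_def tuples_def)
  define ys where "ys v s = map (\<lambda>j. v (s, j)) [0..<m]" for v :: "nat list \<times> nat \<Rightarrow> 'm" and s
  define R where "R J v \<longleftrightarrow> (\<exists>x\<in>tup n. \<forall>s\<in>J. x @ ys v s \<in> W)" for J v
  \<comment> \<open>\<open>Inl (s, I)\<close> stands for inconsistency of the children of s with
    numbers in I, \<open>Inr s\<close> for consistency of the path from the root to s.\<close>
  define h where "h = case_sum (\<lambda>(s, I) v. \<not> R ((\<lambda>i. s @ [i]) ` I) v) (\<lambda>s v. R ((\<lambda>j. take j s) ` {1..length s}) v)"
  define Idx :: "(nat list \<times> nat set + nat list) set" where
    "Idx = (UNIV \<times> {I. finite I \<and> card I = k}) <+> UNIV"
  have definable_R: "definable L M UNIV {} (R J)" if J: "finite J" for J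
    using definable_fiber[OF W _ J, of "\<lambda>s j. (s, j)"] by (simp add: R_def[abs_def] ys_def)
  have definable_h: "definable L M UNIV {} Q" if "Q \<in> h ` Idx" for Q
    using that definable_R definable_neg[OF definable_R] by (auto simp: h_def Idx_def)
  have fin: "\<exists>v. range v \<subseteq> U \<and> (\<forall>Q\<in>F0. Q v)" if F0: "finite F0" "F0 \<subseteq> h ` Idx" for F0
  proof -
    obtain S where S: "S \<subseteq> Idx" "finite S" "F0 = h ` S" using finite_subset_image[OF F0] by blast
    have "finite (case_sum (\<lambda>(s, I). length s) length ` S)" using S(2) by simp
    then obtain N where N: "\<forall>l\<in>case_sum (\<lambda>(s, I). length s) length ` S. l < N"
      unfolding finite_nat_set_iff_bounded by blast
    obtain b :: "nat list \<Rightarrow> 'm list" where b: "\<And>s. b s \<in> tup m"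
      "\<And>s I. length s < N \<Longrightarrow> finite I \<and> card I = k \<Longrightarrow> (\<Inter>i\<in>I. dset n (\<phi>, b (s @ [i]))) = {}"
      "\<And>s. length s \<le> N \<Longrightarrow> \<exists>x\<in>tup n. \<forall>j\<in>{1..length s}. x \<in> dset n (\<phi>, b (take j s))"
    proof -
      from rank_ge_tree[OF rank_ge[of N]] obtain b :: "nat list \<Rightarrow> 'm list" where "\<forall>s. b s \<in> tup m"
        "\<forall>s. length s < N \<longrightarrow> (\<forall>I. finite I \<and> card I = k \<longrightarrow> (\<Inter>i\<in>I. dset n (\<phi>, b (s @ [i]))) = {})"
        "\<forall>s. length s \<le> N \<longrightarrow> (\<exists>x\<in>tup n. \<forall>j\<in>{1..length s}. x \<in> dset n (\<phi>, b (take j s)))"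
        by (elim exE conjE)
      then show thesis by (intro that[of b]) simp_all
    qed
    obtain u where u: "u \<in> U" using U_ne by blast
    define v where "v = (\<lambda>(s, j). if j < m then b s ! j else u)"
    have ys_v: "ys v s = b s" for s
      using tuplesD[OF b(1)[of s]] by (auto simp: ys_def v_def intro: nth_equalityI)
    have "v p \<in> U" for p
      using tuplesD[OF b(1)[of "fst p"]] nth_mem[of "snd p" "b (fst p)"] u
      by (auto simp: v_def case_prod_beta)
    then have "range v \<subseteq> U" by blast
    moreover have "h t v" if t: "t \<in> S" for t
    proof (cases t)
      case (Inl p)
      obtain s I where p: "p = (s, I)" by (cases p)
      have "length s < N" using bspec[OF N imageI[OF t]] by (simp add: Inl p)
      moreover have "finite I \<and> card I = k" using subsetD[OF S(1) t] by (auto simp: Idx_def Inl p)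
      ultimately have e: "(\<Inter>i\<in>I. dset n (\<phi>, b (s @ [i]))) = {}" by (rule b(2))
      have "\<not> R ((\<lambda>i. s @ [i]) ` I) v"
      proof
        assume "R ((\<lambda>i. s @ [i]) ` I) v"
        then obtain x where "x \<in> tup n" "\<forall>s'\<in>(\<lambda>i. s @ [i]) ` I. x @ b s' \<in> W"
          unfolding R_def ys_v by (elim bexE)
        then have "x \<in> (\<Inter>i\<in>I. dset n (\<phi>, b (s @ [i])))" using W_iff b(1) by simp
        then show False using e by simp
      qed
      then show ?thesis by (simp add: h_def Inl p)
    next
      case (Inr s)
      have "length s \<le> N" using bspec[OF N imageI[OF t]] by (simp add: Inr)
      then obtain x where "x \<in> tup n" "\<forall>j\<in>{1..length s}. x \<in> dset n (\<phi>, b (take j s))"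
        using b(3) by blast
      then have "R ((\<lambda>j. take j s) ` {1..length s}) v"
        unfolding R_def ys_v using W_iff b(1) by (intro bexI[of _ x]) auto
      then show ?thesis by (simp add: h_def Inr)
    qed
    ultimately show ?thesis using S(3) by blast
  qed
  have sm0: "small_in {}" by (rule small_in_finite) auto
  obtain v where v: "range v \<subseteq> U" "\<And>Q. Q \<in> h ` Idx \<Longrightarrow> Q v"
    using compactness[OF definable_h sm0 fin] by metis
  have ys: "ys v s \<in> tup m" for s
    using v(1) by (intro tuplesI) (auto simp: ys_def image_subset_iff)
  show ?thesis unfolding tree_property_def
  proof (intro exI[of _ k] exI[of _ "ys v"] conjI allI)
    show "ys v s \<in> tup m" for s by (rule ys)
    show "k_inconsistent M n \<phi> k (\<lambda>i. ys v (s @ [i]))" for s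
      unfolding k_inconsistent_def
    proof (intro allI impI notI)
      fix I assume I: "finite I \<and> card I = k" and "\<exists>a\<in>tup n. \<forall>i\<in>I. holds M \<phi> (a @ ys v (s @ [i]))"
      then obtain a where a: "a \<in> tup n" "\<forall>i\<in>I. holds M \<phi> (a @ ys v (s @ [i]))" by blast
      then have "R ((\<lambda>i. s @ [i]) ` I) v" unfolding R_def using W_iff ys
        by (intro bexI[of _ a]) (auto simp: dset_def)
      moreover have "Inl (s, I) \<in> Idx" using I by (auto simp: Idx_def)
      from v(2)[OF imageI[OF this]] have "\<not> R ((\<lambda>i. s @ [i]) ` I) v" by (simp add: h_def)
      ultimately show False by blast
    qed
    fix \<beta> :: "nat \<Rightarrow> nat"
    show "finitely_satisfiable M n {(\<phi>, ys v (map \<beta> [0..<j])) |j. j \<ge> 1}"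
      unfolding finitely_satisfiable_def
    proof (intro allI impI)
      fix p0 assume p0: "finite p0 \<and> p0 \<subseteq> {(\<phi>, ys v (map \<beta> [0..<j])) |j. j \<ge> 1}"
      then have "p0 \<subseteq> (\<lambda>j. (\<phi>, ys v (map \<beta> [0..<j]))) ` {1..}" by auto
      then obtain J where J: "J \<subseteq> {1..}" "finite J" "p0 = (\<lambda>j. (\<phi>, ys v (map \<beta> [0..<j]))) ` J"
        using finite_subset_image p0 by meson
      obtain N where N: "\<forall>j\<in>J. j < N" using J(2) unfolding finite_nat_set_iff_bounded by blast
      let ?s = "map \<beta> [0..<N]"
      have "Inr ?s \<in> Idx" by (auto simp: Idx_def)
      from v(2)[OF imageI[OF this]] have "R ((\<lambda>j. take j ?s) ` {1..length ?s}) v" by (simp only: h_def sum.case)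
      then obtain x where x: "x \<in> tup n" "\<And>j. j \<in> {1..length ?s} \<Longrightarrow> x @ ys v (take j ?s) \<in> W"
        unfolding R_def by blast
      have "holds M \<phi> (x @ ys v (map \<beta> [0..<j]))" if "j \<in> J" for j
      proof -
        have j: "j \<in> {1..length ?s}" using that N J(1) by force
        then have "take j ?s = map \<beta> [0..<j]" by (simp add: take_map)
        then show ?thesis using x(2)[OF j] W_iff[OF x(1) ys] by (simp add: dset_def)
      qed
      then show "\<exists>a\<in>tup n. realizes M a p0" using x(1) J(3) by (auto simp: realizes_def)
    qed
  qed
qed

end

subsection \<open>Symmetry and transitivity of independence\<close>

locale simple_monster = monster +
  assumes simple: "simple_theory L M"
begin

text \<open>A single formula with a fixed k has bounded rank, since otherwise
  \<open>tree_propertyI\<close> contradicts simplicity; \<open>rank_ge_pigeonhole\<close> combines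
  the bounds.\<close>

lemma finite_rank:
  assumes "finite \<Delta>"
    and "\<And>\<delta>. \<delta> \<in> \<Delta> \<Longrightarrow> \<exists>\<phi> m. \<phi> \<in> formulas L (n + m) \<and> fst \<delta> = instances \<phi> n m"
  obtains N where "\<not> rank_ge \<Delta> N (tup n)"
proof -
  have "\<exists>N. \<not> rank_ge {\<delta>} N (tup n)" if \<delta>: "\<delta> \<in> \<Delta>" for \<delta>
  proof (rule ccontr)
    assume no: "\<not> ?thesis"
    obtain \<phi> m where \<phi>: "\<phi> \<in> formulas L (n + m)" "fst \<delta> = instances \<phi> n m" using assms(2)[OF \<delta>] by (elim exE conjE)
    then have "\<delta> = (instances \<phi> n m, snd \<delta>)" by (metis prod.collapse)
    then have "tree_property M n m \<phi>" using no \<phi>(1) by (intro tree_propertyI[of \<phi> n m "snd \<delta>"]) simp_all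
    then show False using simple \<phi>(1) unfolding simple_theory_def by blast
  qed
  then obtain N where N: "\<And>\<delta>. \<delta> \<in> \<Delta> \<Longrightarrow> \<not> rank_ge {\<delta>} (N \<delta>) (tup n)" by metis
  show ?thesis
  proof (rule that, rule notI)
    assume "rank_ge \<Delta> (Suc (\<Sum>\<delta>\<in>\<Delta>. N \<delta>)) (tup n)"
    then show False using rank_ge_pigeonhole[OF assms(1)] N by blast
  qed
qed

text \<open>The only 0-tuple is fixed by every automorphism, so all conjugates of a set containing
  it share it and the set cannot divide.\<close>

lemma nonforking_Nil: "nonforking [] D B"
  unfolding nonforking_def
proof (intro ballI impI notI)
  fix X assume "[] \<in> X" "forking D (length []) X"
  then obtain S where "\<forall>Y\<in>S. \<exists>k. k_divides k D Y" "[] \<in> \<Union>S" unfolding forking_def by (meson subsetD)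
  then obtain Y k where Y: "[] \<in> Y" "k_divides k D Y" by (meson UnionE)
  from this(2) obtain f where "\<forall>i::nat. f i \<in> Aut D"
    "\<forall>I. finite I \<and> card I = k \<longrightarrow> (\<Inter>i\<in>I. map (f i) ` Y) = {}"
    unfolding k_divides_def by (elim exE conjE)
  from this(2)[rule_format, of "{..<k}"] have "(\<Inter>i\<in>{..<k}. map (f i) ` Y) = {}" by simp
  moreover have "[] \<in> map (f i) ` Y" for i using Y(1) by force
  ultimately show False by blast
qed

text \<open>Let X, a set of the type of b over a and D, be covered by a finite set S of dividing
  sets. Each copy of X under the \<open>f i\<close> still contains b. Intersecting with it lowers
  the rank of a set \<theta> defined over D and the earlier copies: otherwise a conjugate of some Y
  in S keeps that rank inside \<theta>. By \<open>k_divides_extend\<close> it divides over D and the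
  earlier copies, and its conjugates over them raise the rank of \<theta>. Asking for independence
  of the earlier copies from the next one is what makes \<open>k_divides_extend\<close> applicable
  before symmetry is known.\<close>

lemma weight:
  assumes D: "small_in D" and a: "set a \<subseteq> U" and b: "set b \<subseteq> U" and dep: "\<not> nonforking b D (set a)"
  obtains N where "\<And>f. (\<And>i. i < N \<Longrightarrow> f i \<in> Aut (D \<union> set b)) \<Longrightarrow>
    \<exists>i<N. \<not> nonforking (concat (map (\<lambda>j. map (f j) a) [0..<i])) D (set (map (f i) a))"
proof -
  let ?n = "length b"
  have DU: "D \<subseteq> U" using D by (rule small_inD)
  have bt: "b \<in> tup ?n" using b by (simp add: tuplesI)
  obtain X S where X: "X \<in> Def (set a \<union> D) ?n" "b \<in> X"
    and S: "finite S" "S \<subseteq> Def U ?n" "\<forall>Y\<in>S. \<exists>k. k_divides k D Y" "X \<subseteq> \<Union>S"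
    using dep unfolding nonforking_def forking_def by blast
  have "\<exists>\<phi> m k. \<phi> \<in> formulas L (?n + m) \<and> Y \<in> instances \<phi> ?n m \<and> k_divides k D Y" if Y: "Y \<in> S" for Y
  proof -
    have "Y \<in> Def U ?n" using S(2) Y by blast
    then obtain \<phi> d where d: "d \<in> lists U" "\<phi> \<in> formulas L (?n + length d)" "Y = dset ?n (\<phi>, d)"
      unfolding Def_def pformulas_def by auto
    have "d \<in> tup (length d)" using d(1) by (simp add: tuples_def)
    then have "Y \<in> instances \<phi> ?n (length d)" using d(3) by (simp add: instances_def)
    then show ?thesis using d(2) S(3) Y by blast
  qed
  then obtain \<phi> m k where instances: "\<And>Y. Y \<in> S \<Longrightarrow> \<phi> Y \<in> formulas L (?n + m Y) \<and> Y \<in> instances (\<phi> Y) ?n (m Y) \<and> k_divides (k Y) D Y"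
    by metis
  \<comment> \<open>\<Delta> is fixed before any copies are chosen, which makes N uniform. Its
    families are closed under automorphisms, so conjugates of members of S stay in them.\<close>
  define \<Delta> where "\<Delta> = (\<lambda>Y. (instances (\<phi> Y) ?n (m Y), k Y)) ` S"
  obtain N where N: "\<not> rank_ge \<Delta> N (tup ?n)"
  proof (rule finite_rank)
    show "finite \<Delta>" using S(1) by (simp add: \<Delta>_def)
    show "\<exists>\<phi> m. \<phi> \<in> formulas L (?n + m) \<and> fst \<delta> = instances \<phi> ?n m" if \<delta>: "\<delta> \<in> \<Delta>" for \<delta>
    proof -
      obtain Z where Z: "Z \<in> S" "\<delta> = (instances (\<phi> Z) ?n (m Z), k Z)" using \<delta> unfolding \<Delta>_def by blast
      then show ?thesis using instances[OF Z(1)] by (intro exI[of _ "\<phi> Z"] exI[of _ "m Z"]) simp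
    qed
  qed
  have \<Delta>_Aut: "Y \<subseteq> tup ?n \<and> map f ` Y \<in> fst \<delta>" if "\<delta> \<in> \<Delta>" "Y \<in> fst \<delta>" "f \<in> Aut E" for \<delta> Y f E
  proof -
    obtain Z where "Z \<in> S" "Y \<in> instances (\<phi> Z) ?n (m Z)" "fst \<delta> = instances (\<phi> Z) ?n (m Z)"
      using \<open>\<delta> \<in> \<Delta>\<close> \<open>Y \<in> fst \<delta>\<close> by (auto simp: \<Delta>_def)
    then show ?thesis using instances_Aut[OF _ that(3)] instances by (auto simp: instances_def dset_def)
  qed
  obtain B1 where B1: "finite B1" "B1 \<subseteq> U" "S \<subseteq> Def B1 ?n" using Def_finite_params[OF S(1,2)] by metis
  show ?thesis
  proof (rule that, rule ccontr)
    fix f assume f: "\<And>i. i < N \<Longrightarrow> f i \<in> Aut (D \<union> set b)"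
    define e where "e i = concat (map (\<lambda>j. map (f j) a) [0..<i])" for i
    assume "\<not> (\<exists>i<N. \<not> nonforking (concat (map (\<lambda>j. map (f j) a) [0..<i])) D (set (map (f i) a)))"
    then have nonforking: "\<And>i. i < N \<Longrightarrow> nonforking (e i) D (set (map (f i) a))" by (simp add: e_def)
    have ca: "set (map (f i) a) \<subseteq> U" if "i < N" for i using Aut_image_U[OF f[OF that] a] by simp
    have e_Suc: "e (Suc i) = e i @ map (f i) a" for i by (simp add: e_def)
    have eU: "set (e i) \<subseteq> U" if "i \<le> N" for i using that
    proof (induction i)
      case (Suc i)
      then show ?case using ca[of i] by (simp add: e_Suc)
    qed (simp add: e_def)
    \<comment> \<open>The bound drops by one per copy; for i = N it says that \<theta> is empty
      although it contains b.\<close>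
    have "\<exists>\<theta>\<in>Def (D \<union> set (e i)) ?n. b \<in> \<theta> \<and> \<not> rank_ge \<Delta> (N - i) \<theta>" if "i \<le> N" for i
      using that
    proof (induction i)
      case 0
      then show ?case using N bt by (intro bexI[of _ "tup ?n"] Def_full) simp
    next
      case (Suc i)
      then have i: "i < N" "N - i = Suc (N - Suc i)" by auto
      obtain \<theta> where \<theta>: "\<theta> \<in> Def (D \<union> set (e i)) ?n" "b \<in> \<theta>" "\<not> rank_ge \<Delta> (N - i) \<theta>"
        using Suc by auto
      let ?c = "map (f i) a" and ?X = "map (f i) ` X"
      have fD: "f i \<in> Aut D" using Aut_mono[OF f[OF i(1)]] by blast
      have eiU: "set (e i) \<subseteq> U" using eU i(1) by simp
      have "f i ` D = D" by (rule Aut_fix_image[OF fD]) simp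
      then have X': "?X \<in> Def (set ?c \<union> D) ?n"
        using Def_Aut[OF X(1) fD] a DU by (simp add: image_Un)
      have "map (f i) b = b" by (rule Aut_fix_map[OF f[OF i(1)]]) simp
      then have bX': "b \<in> ?X" using X(2) by (metis imageI)
      have "\<theta> \<inter> ?X \<in> Def (D \<union> set (e (Suc i))) ?n"
      proof (rule Def_Int)
        show "\<theta> \<in> Def (D \<union> set (e (Suc i))) ?n" by (rule Def_mono[OF \<theta>(1)]) (auto simp: e_Suc)
        show "?X \<in> Def (D \<union> set (e (Suc i))) ?n" by (rule Def_mono[OF X']) (auto simp: e_Suc)
        show "D \<union> set (e (Suc i)) \<subseteq> U" using DU eU[OF Suc.prems] by simp
      qed
      moreover have "\<not> rank_ge \<Delta> (N - Suc i) (\<theta> \<inter> ?X)"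
      proof
        assume rank_ge: "rank_ge \<Delta> (N - Suc i) (\<theta> \<inter> ?X)"
        have smc: "small_in (set ?c)" "small_in (f i ` B1)"
          using ca[OF i(1)] B1 Aut_image_U[OF fD B1(2)] by (simp_all add: small_in_finite)
        \<comment> \<open>\<open>e i\<close> need not be independent from the image of
          \<open>B1\<close> under \<open>f i\<close>. Moving \<open>e i\<close> by g over D and
          \<open>?c\<close> makes it so, and undoing the move by h yields a cover from whose
          parameters \<open>e i\<close> itself is independent. As h fixes D and \<open>?c\<close>,
          it is still a cover of \<open>?X\<close>.\<close>
        obtain g where g: "g \<in> Aut (D \<union> set ?c)" "nonforking (map g (e i)) D (set ?c \<union> f i ` B1)"
          by (rule extension[OF nonforking[OF i(1)] D smc eiU])
        have "D \<union> set ?c \<subseteq> U" using DU ca[OF i(1)] by simp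
        then obtain h where h: "h \<in> Aut (D \<union> set ?c)" "\<And>x. x \<in> U \<Longrightarrow> h (g x) = x"
          using Aut_inverse[OF g(1)] by metis
        have hD: "h \<in> Aut D" using Aut_mono[OF h(1)] by blast
        define \<omega> where "\<omega> = h \<circ> f i"
        have \<omega>: "\<omega> \<in> Aut D" unfolding \<omega>_def by (rule Aut_comp[OF hD fD])
        have \<omega>_image: "map \<omega> ` Y = map h ` map (f i) ` Y" for Y by (simp add: \<omega>_def image_comp)
        have \<omega>B1: "\<omega> ` B1 \<subseteq> U" by (rule Aut_image_U[OF \<omega> B1(2)])
        have "nonforking (map h (map g (e i))) (h ` D) (h ` (set ?c \<union> f i ` B1))"
        proof (rule nonforking_Aut[OF g(2) h(1) _ DU])
          show "set (map g (e i)) \<subseteq> U" using Aut_image_U[OF g(1) eiU] by simp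
          show "set ?c \<union> f i ` B1 \<subseteq> U" using smc by (simp add: small_in_def)
        qed
        moreover have "map h (map g (e i)) = e i"
          unfolding map_map by (rule map_idI) (use h(2) eiU in auto)
        moreover have "h ` D = D" by (rule Aut_fix_image[OF hD]) simp
        ultimately have "nonforking (e i) D (h ` (set ?c \<union> f i ` B1))" by (simp only:)
        then have nonforking': "nonforking (e i) D (\<omega> ` B1)" by (rule nonforking_mono) (auto simp: \<omega>_def)
        have "?X = map h ` ?X"
          using Def_fix_image[OF X', of h] h(1) DU ca[OF i(1)] by (simp add: Un_commute)
        then have X_eq: "?X = map \<omega> ` X" by (simp only: \<omega>_image)
        have "\<exists>Z\<in>(\<lambda>Y. map \<omega> ` Y) ` S. rank_ge \<Delta> (N - Suc i) ((\<theta> \<inter> ?X) \<inter> Z)"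
        proof (rule rank_ge_Union[OF _ rank_ge])
          have "map \<omega> ` X \<subseteq> \<Union>((\<lambda>Y. map \<omega> ` Y) ` S)" using S(4) by blast
          then show "\<theta> \<inter> ?X \<subseteq> \<Union>((\<lambda>Y. map \<omega> ` Y) ` S)" unfolding X_eq by blast
        qed (use S(1) in simp)
        then obtain Y where Y: "Y \<in> S" "rank_ge \<Delta> (N - Suc i) ((\<theta> \<inter> ?X) \<inter> map \<omega> ` Y)" by blast
        have rkY: "rank_ge \<Delta> (N - Suc i) (\<theta> \<inter> map \<omega> ` Y)" by (rule rank_ge_mono[OF Y(2)]) blast
        let ?Y = "map \<omega> ` Y"
        have Yt: "Y \<subseteq> tup ?n" using Def_subset S(2) Y(1) by blast
        have "k_divides (k Y) (\<omega> ` D) ?Y"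
          using instances[OF Y(1)] k_divides_Aut[OF _ Aut_mono[OF \<omega>] Yt DU] by simp
        moreover have "\<omega> ` D = D" by (rule Aut_fix_image[OF \<omega>]) simp
        ultimately have "k_divides (k Y) D ?Y" by simp
        moreover have "?Y \<in> Def (\<omega> ` B1) ?n" using Def_Aut[OF subsetD[OF B1(3) Y(1)] \<omega> B1(2)] .
        ultimately have "k_divides (k Y) (D \<union> set (e i)) ?Y" by (rule k_divides_extend[OF _ _ nonforking' D \<omega>B1 eiU])
        then obtain \<eta> where \<eta>': "\<forall>t::nat. \<eta> t \<in> Aut (D \<union> set (e i))"
          and \<eta>_inc: "\<forall>I. finite I \<and> card I = k Y \<longrightarrow> (\<Inter>t\<in>I. map (\<eta> t) ` ?Y) = {}"
          unfolding k_divides_def by (elim exE conjE)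
        have \<eta>: "\<eta> t \<in> Aut (D \<union> set (e i))" for t using \<eta>' by simp
        have Yf: "?Y \<in> instances (\<phi> Y) ?n (m Y)" using instances_Aut[OF _ \<omega>] instances[OF Y(1)] by blast
        \<comment> \<open>The automorphisms \<open>\<eta> t\<close> fix \<theta>, so all conjugates
          of \<open>?Y\<close> under them meet \<theta> in the same rank. They are k-inconsistent
          instances of one formula and give one more step.\<close>
        have "rank_ge \<Delta> (Suc (N - Suc i)) \<theta>"
        proof (rule rank_ge_SucI)
          show "(instances (\<phi> Y) ?n (m Y), k Y) \<in> \<Delta>" using Y(1) by (simp add: \<Delta>_def)
          show "map (\<eta> t) ` ?Y \<in> fst (instances (\<phi> Y) ?n (m Y), k Y)" for t
            using instances_Aut[OF Yf \<eta>] instances[OF Y(1)] by simp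
          show "(\<Inter>t\<in>I. map (\<eta> t) ` ?Y) = {}" if "finite I" "card I = snd (instances (\<phi> Y) ?n (m Y), k Y)" for I
            using \<eta>_inc that by simp
          show "rank_ge \<Delta> (N - Suc i) (\<theta> \<inter> map (\<eta> t) ` ?Y)" for t
          proof -
            have \<theta>t: "\<theta> \<subseteq> tup ?n" by (rule Def_subset[OF \<theta>(1)])
            have "map (\<eta> t) ` (\<theta> \<inter> ?Y) = map (\<eta> t) ` \<theta> \<inter> map (\<eta> t) ` ?Y"
              by (rule inj_on_image_Int[OF inj_on_map_Aut[OF \<eta>] \<theta>t image_Aut_tuples[OF \<omega> Yt]])
            moreover have "map (\<eta> t) ` \<theta> = \<theta>"
              using DU eiU by (intro Def_fix_image[OF \<theta>(1) \<eta>]) simp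
            moreover have "rank_ge \<Delta> (N - Suc i) (map (\<eta> t) ` (\<theta> \<inter> ?Y))"
            proof (rule rank_ge_Aut[OF \<eta> _ rkY])
              show "\<theta> \<inter> ?Y \<subseteq> tup ?n" using \<theta>t by (rule le_infI1)
              show "Z \<subseteq> tup ?n \<and> map (\<eta> t) ` Z \<in> fst \<delta>" if "\<delta> \<in> \<Delta>" "Z \<in> fst \<delta>" for \<delta> Z
                by (rule \<Delta>_Aut[OF that \<eta>])
            qed
            ultimately show ?thesis by simp
          qed
        qed
        then show False using \<theta>(3) i(2) by simp
      qed
      ultimately show ?case using \<theta>(2) bX' by (intro bexI[of _ "\<theta> \<inter> ?X"] conjI IntI)
    qed
    from this[of N] show False by auto
  qed
qed

text \<open>\<open>weight\<close> is applied with a the empty tuple, whose copies can never be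
  dependent.\<close>

lemma nonforking_existence:
  assumes "small_in D" "set b \<subseteq> U"
  shows "nonforking b D {}"
proof (rule ccontr)
  assume "\<not> ?thesis"
  then obtain N where N: "\<And>f. (\<And>i. i < N \<Longrightarrow> f i \<in> Aut (D \<union> set b)) \<Longrightarrow>
    \<exists>i<N. \<not> nonforking (concat (map (\<lambda>j. map (f j) []) [0..<i])) D (set (map (f i) []))"
    using weight[of D "[]" b] assms by (metis empty_set empty_subsetI)
  from N[of "\<lambda>_. id"] obtain i where "\<not> nonforking (concat (map (\<lambda>j. []) [0..<i])) D {}"
    using Aut_id by auto
  moreover have "concat (map (\<lambda>j. []) [0..<i]) = []" by simp
  ultimately show False using nonforking_Nil by metis
qed

text \<open>Automorphisms over the larger base are automorphisms over D, so dividing over the larger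
  base implies dividing over D.\<close>

lemma nonforking_base:
  assumes "nonforking a D B" "E \<subseteq> B \<union> D"
  shows "nonforking a (D \<union> E) B"
  unfolding nonforking_def
proof (intro ballI impI notI)
  fix X assume X: "X \<in> Def (B \<union> (D \<union> E)) (length a)" "a \<in> X" "forking (D \<union> E) (length a) X"
  have "B \<union> (D \<union> E) = B \<union> D" using assms(2) by blast
  then have "X \<in> Def (B \<union> D) (length a)" using X(1) by simp
  moreover have "k_divides k D Y" if "k_divides k (D \<union> E) Y" for k Y
    using that Aut_mono[of _ "D \<union> E" D] unfolding k_divides_def by blast
  then have "forking D (length a) X" using X(3) unfolding forking_def by meson
  ultimately show False using assms(1) X(2) unfolding nonforking_def by blast
qed

lemma nonforking_sym:
  assumes nonforking: "nonforking a D (set b)" and D: "small_in D" and a: "set a \<subseteq> U" and b: "set b \<subseteq> U"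
  shows "nonforking b D (set a)"
proof (rule ccontr)
  assume dep: "\<not> ?thesis"
  obtain N where N: "\<And>f. (\<And>i. i < N \<Longrightarrow> f i \<in> Aut (D \<union> set b)) \<Longrightarrow>
    \<exists>i<N. \<not> nonforking (concat (map (\<lambda>j. map (f j) a) [0..<i])) D (set (map (f i) a))"
    using weight[OF D a b dep] by metis
  have DU: "D \<subseteq> U" using D by (rule small_inD)
  \<comment> \<open>Each new copy is put in front of the list and is independent over D from b and
    all copies behind it.\<close>
  have "\<exists>ts. length ts = n \<and> set ts \<subseteq> Aut (D \<union> set b) \<and>
      (\<forall>i<n. nonforking (map (ts ! i) a) D (set b \<union> (\<Union>g\<in>set (drop (Suc i) ts). g ` set a)))" for n
  proof (induction n)
    case (Suc n)
    then obtain ts where ts: "length ts = n" "set ts \<subseteq> Aut (D \<union> set b)"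
      "\<And>i. i < n \<Longrightarrow> nonforking (map (ts ! i) a) D (set b \<union> (\<Union>g\<in>set (drop (Suc i) ts). g ` set a))" by auto
    let ?C = "\<Union>g\<in>set ts. g ` set a"
    have "?C \<subseteq> U" using Aut_image_U[OF _ a] ts(2) by blast
    then have smC: "small_in ?C" by (intro small_in_finite) auto
    have smb: "small_in (set b)" using b by (simp add: small_in_finite)
    obtain f where f: "f \<in> Aut (D \<union> set b)" "nonforking (map f a) D (set b \<union> ?C)"
      by (rule extension[OF nonforking D smb smC a])
    have "nonforking (map ((f # ts) ! i) a) D (set b \<union> (\<Union>g\<in>set (drop (Suc i) (f # ts)). g ` set a))" if "i < Suc n" for i
      using f(2) ts(3) that by (cases i) auto
    then show ?case using ts(1,2) f(1) by (intro exI[of _ "f # ts"]) simp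
  qed auto
  then obtain ts where ts: "length ts = N" "set ts \<subseteq> Aut (D \<union> set b)"
    "\<And>i. i < N \<Longrightarrow> nonforking (map (ts ! i) a) D (set b \<union> (\<Union>g\<in>set (drop (Suc i) ts). g ` set a))" by metis
  let ?c = "\<lambda>i. map (ts ! i) a"
  have cU: "set (?c i) \<subseteq> U" if "i < N" for i
  proof -
    have "ts ! i \<in> Aut (D \<union> set b)" using ts(1,2) that by auto
    from Aut_image_U[OF this a] show ?thesis by simp
  qed
  have sub: "set (?c j) \<subseteq> (\<Union>g\<in>set (drop (Suc i) ts). g ` set a)" if "i < j" "j < N" for i j
  proof -
    have "ts ! j \<in> set (drop (Suc i) ts)"
      using nth_mem[of "j - Suc i" "drop (Suc i) ts"] that ts(1) by simp
    then show ?thesis by auto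
  qed
  have "nonforking (concat (map ?c [0..<i])) D (set (?c i))" if i: "i < N" for i
  proof -
    \<comment> \<open>\<open>weight\<close> needs joint independence of the copies 0, ..., i - 1
      from copy i. They are collected from i - 1 down to 0: copy t is independent from copy i over D
      and the copies in between, and \<open>nonforking_append\<close> joins it to these.\<close>
    have "nonforking (concat (map ?c [i - d..<i])) D (set (?c i))" if "d \<le> i" for d
      using that
    proof (induction d)
      case 0
      then show ?case using nonforking_Nil by simp
    next
      case (Suc d)
      define t where "t = i - Suc d"
      have t: "t < i" "t < N" "i - d = Suc t" using Suc.prems i by (auto simp: t_def)
      let ?e = "concat (map ?c [Suc t..<i])"
      let ?L = "\<Union>g\<in>set (drop (Suc t) ts). g ` set a"
      have e: "nonforking ?e D (set (?c i))" using Suc t(3) by simp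
      have "set (?c j) \<subseteq> ?L" "set (?c j) \<subseteq> U" if "j \<in> set [Suc t..<i]" for j
        using sub[of t j] cU[of j] that i by simp_all
      moreover have "set ?e = (\<Union>j\<in>set [Suc t..<i]. set (?c j))" by simp
      ultimately have e_sub: "set ?e \<subseteq> ?L" "set ?e \<subseteq> U" by (simp_all only: UN_least)
      have ci: "set (?c i) \<subseteq> ?L" using sub t(1) i by simp
      have smci: "small_in (set (?c i))" using cU[OF i] by (simp add: small_in_finite)
      have "nonforking (?c t) (D \<union> set ?e) (set b \<union> ?L)"
        by (rule nonforking_base[OF ts(3)[OF t(2)]]) (use e_sub(1) in blast)
      then have "nonforking (?c t) (D \<union> set ?e) (set (?c i))" by (rule nonforking_mono) (use ci in blast)
      then have "nonforking (?e @ ?c t) D (set (?c i))" by (rule nonforking_append[OF e _ D smci e_sub(2) cU[OF t(2)]])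
      then have "nonforking (?c t @ ?e) D (set (?c i))"
        by (rule nonforking_subset[OF _ _ _ DU cU[OF i]]) (use e_sub(2) cU[OF t(2)] in auto)
      moreover have "[i - Suc d..<i] = t # [Suc t..<i]" using t(1) by (simp add: t_def upt_conv_Cons)
      ultimately show ?case by simp
    qed
    from this[of i] show ?thesis by simp
  qed
  moreover have "ts ! i \<in> Aut (D \<union> set b)" if "i < N" for i using ts(1,2) that by auto
  ultimately show False using N[of "\<lambda>i. ts ! i"] by blast
qed

section \<open>The independence calculus for sets\<close>

lemma small_in_Un_finite: "small_in D \<Longrightarrow> finite B \<Longrightarrow> B \<subseteq> U \<Longrightarrow> small_in (D \<union> B)"
  by (simp add: small_in_Un small_in_finite)

lemma indep_nonforking:
  assumes "small_in D" "small_in B" "A \<subseteq> U"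
  shows "ind A D B \<longleftrightarrow> (\<forall>a\<in>lists A. nonforking a D B)"
proof -
  have "set a \<subseteq> U" if "a \<in> lists A" for a using that assms(3) by auto
  then show ?thesis unfolding indep_def using forks_iff[OF assms(1,2)] by blast
qed

lemma indep_mono:
  assumes "ind A D B" "A' \<subseteq> A" "B' \<subseteq> B \<union> D" "small_in D" "A \<subseteq> U" "small_in B"
  shows "ind A' D B'"
proof -
  have B': "small_in B'" using small_in_subset[OF small_in_Un assms(3)] assms(4,6) by simp
  have "nonforking a D B'" if "a \<in> lists A'" for a
  proof (rule nonforking_mono[OF _ assms(3)])
    have "a \<in> lists A" using that assms(2) by auto
    then show "nonforking a D B" using assms(1) indep_nonforking[OF assms(4,6,5)] by blast
  qed
  then show ?thesis using indep_nonforking[OF assms(4) B', of A'] assms(2,5) by blast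
qed

text \<open>A forking set in a type has finitely many variables and finitely many
  parameters.\<close>

lemma not_indep_finite:
  assumes "\<not> ind A D B" "small_in D" "A \<subseteq> U" "small_in B"
  obtains A' B' where "finite A'" "A' \<subseteq> A" "finite B'" "B' \<subseteq> B" "\<not> ind A' D B'"
proof -
  obtain a where a: "a \<in> lists A" "\<not> nonforking a D B" using assms(1) indep_nonforking[OF assms(2,4,3)] by blast
  obtain X where X: "X \<in> Def (B \<union> D) (length a)" "a \<in> X" "forking D (length a) X"
    using a(2) unfolding nonforking_def by blast
  obtain C where C: "finite C" "C \<subseteq> B \<union> D" "X \<in> Def C (length a)" using Def_finite_support[OF X(1)] by metis
  have "X \<in> Def (C \<inter> B \<union> D) (length a)" by (rule Def_mono[OF C(3)]) (use C(2) in blast)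
  then have "\<not> nonforking a D (C \<inter> B)" using X(2,3) unfolding nonforking_def by blast
  moreover have aU: "set a \<subseteq> U" using a(1) assms(3) by auto
  moreover have "small_in (C \<inter> B)" by (rule small_in_subset[OF assms(4)]) simp
  ultimately have "\<not> ind (set a) D (C \<inter> B)" using indep_iff[OF assms(2)] by blast
  then show ?thesis using a(1) C(1) by (intro that[of "set a" "C \<inter> B"]) auto
qed

lemma indep_base:
  assumes "ind A D B" "E \<subseteq> B" "small_in D" "finite A" "A \<subseteq> U" "small_in B"
  shows "ind A (D \<union> E) B"
proof -
  obtain a where a: "set a = A" using assms(4) finite_list by metis
  have "small_in (D \<union> E)" by (rule small_in_Un[OF assms(3) small_in_subset[OF assms(6,2)]])
  moreover have "nonforking a D B" using indep_iff[of D B a] assms a by simp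
  then have "nonforking a (D \<union> E) B" by (rule nonforking_base) (use assms(2) in blast)
  ultimately show ?thesis using indep_iff[of "D \<union> E" B a] assms a by simp
qed

lemma indep_empty:
  assumes "small_in D" "finite A" "A \<subseteq> U"
  shows "ind A D {}"
proof -
  obtain a where a: "set a = A" using assms(2) finite_list by metis
  then show ?thesis using indep_iff[of D "{}" a] nonforking_existence[of D a] assms by (simp add: small_in_finite)
qed

lemma indep_sym:
  assumes "ind A D B" "small_in D" "finite A" "A \<subseteq> U" "finite B" "B \<subseteq> U"
  shows "ind B D A"
proof -
  obtain a b where ab: "set a = A" "set b = B" using assms(3,5) finite_list by metis
  have nonforking: "nonforking a D (set b)" using indep_iff[of D B a] assms ab by (simp add: small_in_finite)
  have "nonforking b D (set a)" by (rule nonforking_sym[OF nonforking assms(2)]) (use assms(4,6) ab in simp_all)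
  then show ?thesis using indep_iff[of D A b] assms ab by (simp add: small_in_finite)
qed

text \<open>\<open>nonforking_append\<close> is transitivity on the left; symmetry before and after
  it gives transitivity on the right.\<close>

lemma indep_trans:
  assumes "ind A D B" "ind A (D \<union> B) C"
    and "small_in D" "finite A" "A \<subseteq> U" "finite B" "B \<subseteq> U" "finite C" "C \<subseteq> U"
  shows "ind A D (B \<union> C)"
proof -
  obtain b c where bc: "set b = B" "set c = C" using assms(6,8) finite_list by metis
  have small_in: "small_in (D \<union> B)" "small_in A" using assms by (simp_all add: small_in_Un_finite small_in_finite)
  have "ind B D A" by (rule indep_sym[OF assms(1,3-7)])
  then have "nonforking b D A" using indep_iff[of D A b] assms bc small_in by simp
  moreover have "ind C (D \<union> B) A" by (rule indep_sym[OF assms(2) small_in(1) assms(4,5,8,9)])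
  then have "nonforking c (D \<union> set b) A" using indep_iff[of "D \<union> B" A c] assms bc small_in by simp
  ultimately have "nonforking (b @ c) D A" using assms bc small_in by (intro nonforking_append) auto
  then have "ind (B \<union> C) D A" using indep_iff[of D A "b @ c"] assms bc small_in by simp
  then show ?thesis by (rule indep_sym) (use assms in auto)
qed

lemma indep_Aut:
  assumes "ind A D B" "f \<in> Aut D" "small_in D" "finite A" "A \<subseteq> U" "finite B" "B \<subseteq> U"
  shows "ind (f ` A) D (f ` B)"
proof -
  obtain a where a: "set a = A" using assms(4) finite_list by metis
  have "nonforking a D B" using indep_iff[of D B a] assms a by (simp add: small_in_finite)
  then have "nonforking (map f a) (f ` D) (f ` B)" using assms a by (intro nonforking_Aut[OF _ assms(2)]) (auto simp: small_in_def)
  moreover have "f ` D = D" by (rule Aut_fix_image[OF assms(2)]) simp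
  moreover have "f ` A \<subseteq> U" "small_in (f ` B)"
    using Aut_image_U[OF assms(2)] assms by (simp_all add: small_in_finite)
  ultimately show ?thesis using indep_iff[of D "f ` B" "map f a"] assms(3) a by simp
qed

lemma indep_extension:
  assumes "ind A D B" "small_in D" "finite A" "A \<subseteq> U" "finite B" "B \<subseteq> U" "finite C" "C \<subseteq> U"
  obtains f where "f \<in> Aut (D \<union> B)" "ind (f ` A) D (B \<union> C)"
proof -
  obtain a where a: "set a = A" using assms(3) finite_list by metis
  have small_in: "small_in B" "small_in C" using assms by (simp_all add: small_in_finite)
  have nonforking: "nonforking a D B" using indep_iff[of D B a] assms a by (simp add: small_in_finite)
  have aU: "set a \<subseteq> U" using a assms(4) by simp
  obtain f where f: "f \<in> Aut (D \<union> B)" "nonforking (map f a) D (B \<union> C)"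
    by (rule extension[OF nonforking assms(2) small_in aU])
  have "ind (f ` A) D (B \<union> C)"
    using indep_iff[of D "B \<union> C" "map f a"] f Aut_image_U[OF f(1)] small_in_Un[OF small_in] assms(2,4) a by simp
  with f(1) show ?thesis by (rule that)
qed

lemma indep_weight:
  assumes "\<not> ind B D A" "small_in D" "finite A" "A \<subseteq> U" "finite B" "B \<subseteq> U"
  obtains N :: nat where "\<And>f. (\<And>i. i < N \<Longrightarrow> f i \<in> Aut (D \<union> B)) \<Longrightarrow>
    \<exists>i<N. \<not> ind (\<Union>j<i. f j ` A) D (f i ` A)"
proof -
  obtain a b where ab: "set a = A" "set b = B" using assms(3,5) finite_list by metis
  have "\<not> nonforking b D (set a)" using indep_iff[of D A b] assms ab by (simp add: small_in_finite)
  then obtain N where N: "\<And>f. (\<And>i. i < N \<Longrightarrow> f i \<in> Aut (D \<union> set b)) \<Longrightarrow>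
    \<exists>i<N. \<not> nonforking (concat (map (\<lambda>j. map (f j) a) [0..<i])) D (set (map (f i) a))"
    using weight[of D a b] assms ab by metis
  show ?thesis
  proof (rule that)
    fix f assume f: "\<And>i. i < N \<Longrightarrow> f i \<in> Aut (D \<union> B)"
    then obtain i where i: "i < N" "\<not> nonforking (concat (map (\<lambda>j. map (f j) a) [0..<i])) D (set (map (f i) a))"
      using N[of f] ab(2) by blast
    have img: "f j ` A \<subseteq> U" if "j < N" for j by (rule Aut_image_U[OF f[OF that] assms(4)])
    let ?e = "concat (map (\<lambda>j. map (f j) a) [0..<i])"
    have e: "set ?e = (\<Union>j<i. f j ` A)" by (simp add: ab(1) atLeast0LessThan)
    have "(\<Union>j<i. f j ` A) \<subseteq> U" using img i(1) by (intro UN_least) simp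
    moreover have "small_in (f i ` A)" using img[OF i(1)] assms(3) by (simp add: small_in_finite)
    ultimately have "\<not> ind (set ?e) D (f i ` A)"
      using indep_iff[of D "f i ` A" ?e] assms(2) i(2) ab(1) unfolding e by simp
    then show "\<exists>i<N. \<not> ind (\<Union>j<i. f j ` A) D (f i ` A)" unfolding e using i(1) by blast
  qed
qed

end

subsection \<open>Cycles\<close>

lemma subseq_set: "subseq xs ys \<Longrightarrow> set xs \<subseteq> set ys"
  by (induction rule: list_emb.induct) auto

text \<open>Reduces proper subsequences to those with a single entry deleted, the ones that
  \<open>is_cycle_iff\<close> tests.\<close>

lemma strict_subseq_drop:
  assumes "subseq bs as" "bs \<noteq> as"
  obtains us x vs where "as = us @ [x] @ vs" "subseq bs (us @ vs)"
proof -
  have "\<exists>us x vs. as = us @ [x] @ vs \<and> subseq bs (us @ vs)"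
    using assms
  proof (induction rule: list_emb.induct)
    case (list_emb_Nil ys)
    then obtain y zs where "ys = y # zs" by (cases ys) auto
    then show ?case by (intro exI[of _ "[]"] exI[of _ y] exI[of _ zs]) simp
  next
    case (list_emb_Cons xs ys y)
    then show ?case by (intro exI[of _ "[]"] exI[of _ y] exI[of _ ys]) simp
  next
    case (list_emb_Cons2 x y xs ys)
    then obtain us z vs where "ys = us @ [z] @ vs" "subseq xs (us @ vs)" by auto
    then show ?case using list_emb_Cons2.hyps(1)
      by (intro exI[of _ "y # us"] exI[of _ z] exI[of _ vs]) simp
  qed
  then show ?thesis using that by blast
qed

text \<open>Locates a deleted entry of a concatenation inside one group; needed for the long cycle,
  which is a concatenation of copies.\<close>

lemma concat_eq_append_ConsE:
  assumes "concat Gs = us @ [x] @ vs"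
  obtains G1 g1 g2 G2 where "Gs = G1 @ [g1 @ [x] @ g2] @ G2" "us = concat G1 @ g1" "vs = g2 @ concat G2"
proof -
  have "\<exists>G1 g1 g2 G2. Gs = G1 @ [g1 @ [x] @ g2] @ G2 \<and> us = concat G1 @ g1 \<and> vs = g2 @ concat G2"
    using assms
  proof (induction Gs arbitrary: us)
    case (Cons G Gs)
    have eq: "G @ concat Gs = us @ x # vs" using Cons.prems by simp
    then obtain zs where zs: "G = us @ zs \<and> zs @ concat Gs = x # vs \<or> G @ zs = us \<and> concat Gs = zs @ x # vs"
      unfolding append_eq_append_conv2 by (elim exE)
    consider ws where "us = G @ ws" "concat Gs = ws @ x # vs"
      | ws where "G = us @ x # ws" "vs = ws @ concat Gs"
      using zs by (cases zs) auto
    then show ?case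
    proof cases
      case 1
      then obtain G1 g1 g2 G2 where "Gs = G1 @ [g1 @ [x] @ g2] @ G2" "ws = concat G1 @ g1" "vs = g2 @ concat G2"
        using Cons.IH[of ws] by auto
      then show ?thesis using 1(1)
        by (intro exI[of _ "G # G1"] exI[of _ g1] exI[of _ g2] exI[of _ G2]) simp
    next
      case 2
      then show ?thesis
        by (intro exI[of _ "[]"] exI[of _ us] exI[of _ ws] exI[of _ Gs]) simp
    qed
  qed simp
  then show ?thesis using that by blast
qed

context simple_monster
begin

section \<open>Independent sequences of finite sets\<close>

definition fin_sets where
  "fin_sets as \<longleftrightarrow> (\<forall>A\<in>set as. finite A \<and> A \<subseteq> U)"

lemma fin_sets_simps [simp]:
  "fin_sets []" "fin_sets (A # as) \<longleftrightarrow> finite A \<and> A \<subseteq> U \<and> fin_sets as"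
  "fin_sets (as @ bs) \<longleftrightarrow> fin_sets as \<and> fin_sets bs"
  by (auto simp: fin_sets_def)

lemma fin_sets_Union:
  assumes "fin_sets as"
  shows "finite (\<Union>(set as))" "\<Union>(set as) \<subseteq> U" "small_in (\<Union>(set as))"
proof -
  show "finite (\<Union>(set as))" "\<Union>(set as) \<subseteq> U" using assms by (auto simp: fin_sets_def)
  then show "small_in (\<Union>(set as))" by (rule small_in_finite)
qed

lemma indep_seq_Nil [simp]: "ind_seq D []"
  by (simp add: indep_seq_def)

lemma indep_seq_snoc: "ind_seq D (as @ [x]) \<longleftrightarrow> ind_seq D as \<and> ind x D (\<Union>(set as))"
proof -
  have "set as = (!) as ` {..<length as}" by (auto simp: set_conv_nth)
  then have "(\<Union>j<length as. (as @ [x]) ! j) = \<Union>(set as)" by (simp add: nth_append)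
  moreover have "(\<Union>j<i. (as @ [x]) ! j) = (\<Union>j<i. as ! j)" if "i < length as" for i
    using that by (intro SUP_cong) (simp_all add: nth_append)
  ultimately have "ind ((as @ [x]) ! i) D (\<Union>j<i. (as @ [x]) ! j) \<longleftrightarrow>
      (if i < length as then ind (as ! i) D (\<Union>j<i. as ! j) else ind x D (\<Union>(set as)))"
    if "i < Suc (length as)" for i
    using that by (cases "i < length as") (simp_all add: nth_append less_Suc_eq)
  then show ?thesis unfolding indep_seq_def by (auto simp: less_Suc_eq)
qed

context
  fixes D assumes D: "small_in D"
begin

text \<open>The right side is symmetric in the two parts up to symmetry of independence; this is the
  source of the invariance under reordering.\<close>

lemma indep_seq_append:
  assumes "fin_sets as" "fin_sets bs"
  shows "ind_seq D (as @ bs) \<longleftrightarrow>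
    ind_seq D as \<and> ind_seq D bs \<and> ind (\<Union>(set as)) D (\<Union>(set bs))"
  using assms(2)
proof (induction bs rule: rev_induct)
  case Nil
  then show ?case using indep_empty[OF D fin_sets_Union(1,2)[OF assms(1)]] by simp
next
  case (snoc x bs)
  let ?A = "\<Union>(set as)" let ?B = "\<Union>(set bs)"
  have A: "finite ?A" "?A \<subseteq> U" "small_in ?A" by (rule fin_sets_Union[OF assms(1)])+
  have bs: "fin_sets bs" and x: "finite x" "x \<subseteq> U" using snoc.prems by auto
  have B: "finite ?B" "?B \<subseteq> U" "small_in ?B" by (rule fin_sets_Union[OF bs])+
  have smx: "small_in x" using x by (rule small_in_finite)
  have DB: "small_in (D \<union> ?B)" by (rule small_in_Un[OF D B(3)])
  \<comment> \<open>Both sides express joint independence of \<open>?A\<close>, \<open>?B\<close>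
    and x, read in different orders. Each direction passes to the base \<open>D \<union> ?B\<close>,
    swaps \<open>?A\<close> and x there, and returns by transitivity.\<close>
  have "ind ?A D ?B \<and> ind x D (?A \<union> ?B) \<longleftrightarrow> ind x D ?B \<and> ind ?A D (?B \<union> x)"
  proof
    assume l: "ind ?A D ?B \<and> ind x D (?A \<union> ?B)"
    then have "ind x (D \<union> ?B) (?A \<union> ?B)"
      using indep_base[of x D "?A \<union> ?B" ?B] D x small_in_Un[OF A(3) B(3)] by simp
    then have "ind x (D \<union> ?B) ?A"
      by (rule indep_mono) (use DB x small_in_Un[OF A(3) B(3)] in auto)
    then have "ind ?A (D \<union> ?B) x" using DB x A by (intro indep_sym[of x]) auto
    then have "ind ?A D (?B \<union> x)" using l D x A B by (intro indep_trans) auto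
    moreover have "ind x D ?B"
      by (rule indep_mono[OF conjunct2[OF l]]) (use D x small_in_Un[OF A(3) B(3)] in auto)
    ultimately show "ind x D ?B \<and> ind ?A D (?B \<union> x)" by blast
  next
    assume r: "ind x D ?B \<and> ind ?A D (?B \<union> x)"
    then have "ind ?A (D \<union> ?B) (?B \<union> x)"
      using indep_base[of ?A D "?B \<union> x" ?B] D A small_in_Un[OF B(3) smx] by simp
    then have "ind ?A (D \<union> ?B) x"
      by (rule indep_mono) (use DB A small_in_Un[OF B(3) smx] in auto)
    then have "ind x (D \<union> ?B) ?A" using DB x A by (intro indep_sym[of ?A]) auto
    then have "ind x D (?B \<union> ?A)" using r D x A B by (intro indep_trans) auto
    moreover have "ind ?A D ?B"
      by (rule indep_mono[OF conjunct2[OF r]]) (use D A small_in_Un[OF B(3) smx] in auto)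
    ultimately show "ind ?A D ?B \<and> ind x D (?A \<union> ?B)" by (simp add: Un_commute)
  qed
  moreover have "\<Union>(set (as @ bs)) = ?A \<union> ?B" "\<Union>(set (bs @ [x])) = ?B \<union> x" by auto
  ultimately show ?case
    using snoc.IH[OF bs] indep_seq_snoc[of D "as @ bs" x] indep_seq_snoc[of D bs x] by auto
qed

lemma indep_seq_single: "finite x \<Longrightarrow> x \<subseteq> U \<Longrightarrow> ind_seq D [x]"
  using indep_seq_snoc[of D "[]" x] indep_empty[OF D] by simp

lemma indep_seq_swap:
  assumes "fin_sets as" "fin_sets bs"
  shows "ind_seq D (as @ bs) \<longleftrightarrow> ind_seq D (bs @ as)"
  using indep_seq_append[OF assms] indep_seq_append[OF assms(2,1)]
    indep_sym[OF _ D fin_sets_Union(1,2)[OF assms(1)] fin_sets_Union(1,2)[OF assms(2)]]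
    indep_sym[OF _ D fin_sets_Union(1,2)[OF assms(2)] fin_sets_Union(1,2)[OF assms(1)]]
  by blast

text \<open>The entry G is rotated to the front, where it splits off by
  \<open>indep_seq_append\<close>.\<close>

lemma indep_seq_insert:
  assumes "fin_sets xs" "fin_sets ys" "finite G" "G \<subseteq> U"
  shows "ind_seq D (xs @ [G] @ ys) \<longleftrightarrow>
    ind_seq D (xs @ ys) \<and> ind G D (\<Union>(set xs) \<union> \<Union>(set ys))"
proof -
  have "ind_seq D (xs @ [G] @ ys) \<longleftrightarrow> ind_seq D ([G] @ ys @ xs)"
    using indep_seq_swap[of xs "[G] @ ys"] assms by simp
  also have "\<dots> \<longleftrightarrow> ind_seq D (ys @ xs) \<and> ind G D (\<Union>(set (ys @ xs)))"
    using indep_seq_append[of "[G]" "ys @ xs"] assms indep_seq_single by simp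
  also have "\<dots> \<longleftrightarrow> ind_seq D (xs @ ys) \<and> ind G D (\<Union>(set xs) \<union> \<Union>(set ys))"
    using indep_seq_swap[OF assms(1,2)] by (simp add: Un_commute)
  finally show ?thesis .
qed

lemma indep_seq_subseq:
  assumes "ind_seq D as" "fin_sets as" "subseq bs as"
  shows "ind_seq D bs"
  using assms
proof (induction "length as" arbitrary: as)
  case (Suc n)
  show ?case
  proof (cases "bs = as")
    case False
    obtain us x vs where as: "as = us @ [x] @ vs" and sub: "subseq bs (us @ vs)"
      by (rule strict_subseq_drop[OF Suc.prems(3) False])
    have "fin_sets us" "fin_sets vs" "finite x" "x \<subseteq> U" using Suc.prems(2) by (simp_all add: as)
    then have "ind_seq D (us @ vs)" using Suc.prems(1) unfolding as by (simp only: indep_seq_insert)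
    then show ?thesis using Suc.hyps(1)[of "us @ vs"] Suc.hyps(2) sub Suc.prems(2) by (simp add: as)
  qed (use Suc.prems in simp)
qed (auto dest: list_emb_Nil2)

text \<open>Used in both directions: dependent copies give a dependent list of entries, and after a
  deletion independent groups give an independent list.\<close>

lemma indep_seq_concat:
  assumes "\<And>G. G \<in> set Gs \<Longrightarrow> fin_sets G"
  shows "ind_seq D (concat Gs) \<longleftrightarrow>
    (\<forall>G\<in>set Gs. ind_seq D G) \<and> ind_seq D (map (\<lambda>G. \<Union>(set G)) Gs)"
  using assms
proof (induction Gs rule: rev_induct)
  case (snoc G Gs)
  have Gs: "fin_sets (concat Gs)" using snoc.prems by (auto simp: fin_sets_def)
  have G: "fin_sets G" using snoc.prems by simp
  have "ind_seq D (concat (Gs @ [G])) \<longleftrightarrow> ind_seq D (concat Gs) \<and>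
      ind_seq D G \<and> ind (\<Union>(set (concat Gs))) D (\<Union>(set G))"
    using indep_seq_append[OF Gs G] by simp
  also have "ind (\<Union>(set (concat Gs))) D (\<Union>(set G)) \<longleftrightarrow> ind (\<Union>(set G)) D (\<Union>(set (concat Gs)))"
    using indep_sym[OF _ D fin_sets_Union(1,2)[OF Gs] fin_sets_Union(1,2)[OF G]]
      indep_sym[OF _ D fin_sets_Union(1,2)[OF G] fin_sets_Union(1,2)[OF Gs]] by blast
  also have "\<Union>(set (concat Gs)) = \<Union>(set (map (\<lambda>G. \<Union>(set G)) Gs))" by auto
  finally have "ind_seq D (concat (Gs @ [G])) \<longleftrightarrow> ind_seq D (concat Gs) \<and>
      ind_seq D G \<and> ind (\<Union>(set G)) D (\<Union>(set (map (\<lambda>G. \<Union>(set G)) Gs)))" .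
  moreover have "ind_seq D (concat Gs) \<longleftrightarrow>
      (\<forall>G\<in>set Gs. ind_seq D G) \<and> ind_seq D (map (\<lambda>G. \<Union>(set G)) Gs)"
    using snoc by simp
  moreover have "ind_seq D (map (\<lambda>G. \<Union>(set G)) (Gs @ [G])) \<longleftrightarrow>
      ind_seq D (map (\<lambda>G. \<Union>(set G)) Gs) \<and> ind (\<Union>(set G)) D (\<Union>(set (map (\<lambda>G. \<Union>(set G)) Gs)))"
    unfolding map_append list.map indep_seq_snoc ..
  ultimately show ?case by auto
qed simp

lemma indep_seq_Aut:
  assumes "ind_seq D as" "fin_sets as" "f \<in> Aut D"
  shows "ind_seq D (map ((`) f) as)"
  using assms(1,2)
proof (induction as rule: rev_induct)
  case (snoc x as)
  have as: "fin_sets as" and x: "finite x" "x \<subseteq> U" using snoc.prems(2) by simp_all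
  have "ind (f ` x) D (f ` \<Union>(set as))"
    using snoc.prems(1) x fin_sets_Union(1,2)[OF as] by (intro indep_Aut[OF _ assms(3) D]) (simp_all add: indep_seq_snoc)
  moreover have "f ` \<Union>(set as) = \<Union>(set (map ((`) f) as))" by auto
  moreover have "ind_seq D (map ((`) f) as)" using snoc.IH snoc.prems(1) as by (simp add: indep_seq_snoc)
  ultimately show ?case using indep_seq_snoc[of D "map ((`) f) as" "f ` x"] by simp
qed simp

text \<open>Independence passes to subsequences, so deleting single entries covers all proper
  subsequences.\<close>

lemma is_cycle_iff:
  assumes "fin_sets as"
  shows "is_cycle L M D as \<longleftrightarrow> \<not> ind_seq D as \<and>
    (\<forall>us x vs. as = us @ [x] @ vs \<longrightarrow> ind_seq D (us @ vs))"
proof (intro iffI conjI allI impI)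
  assume cyc: "is_cycle L M D as"
  show "\<not> ind_seq D as" using cyc by (simp add: is_cycle_def)
  fix us x vs assume as: "as = us @ [x] @ vs"
  have "subseq (us @ vs) (us @ [x] @ vs)" by (intro list_emb_append_mono) auto
  moreover have "us @ vs \<noteq> as" using as by simp
  ultimately have "strict_subseq (us @ vs) as" unfolding as strict_subseq_def by blast
  then show "ind_seq D (us @ vs)" using cyc by (simp add: is_cycle_def)
next
  assume r: "\<not> ind_seq D as \<and> (\<forall>us x vs. as = us @ [x] @ vs \<longrightarrow> ind_seq D (us @ vs))"
  have "ind_seq D bs" if bs: "strict_subseq bs as" for bs
  proof -
    have bs': "subseq bs as" "bs \<noteq> as" using bs by (simp_all add: strict_subseq_def)
    obtain us x vs where as: "as = us @ [x] @ vs" "subseq bs (us @ vs)"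
      by (rule strict_subseq_drop[OF bs'])
    have "ind_seq D (us @ vs)" using r as(1) by blast
    then show ?thesis by (rule indep_seq_subseq[OF _ _ as(2)]) (use assms as(1) in simp)
  qed
  then show "is_cycle L M D as" using r by (simp add: is_cycle_def)
qed

end

section \<open>Changing the length of a cycle\<close>

definition has_cycle where
  "has_cycle m \<longleftrightarrow> (\<exists>D as. small_in D \<and> fin_sets as \<and> length as = m \<and> is_cycle L M D as)"

lemma indep_seq_Cons_base:
  assumes "ind_seq D (a # as)" "small_in D" "fin_sets (a # as)"
  shows "ind_seq (D \<union> a) as"
  using assms(1,3)
proof (induction as rule: rev_induct)
  case (snoc x as)
  have as: "fin_sets (a # as)" and x: "x \<subseteq> U" "finite x" using snoc.prems(2) by simp_all
  have sma: "small_in a" using as by (simp add: small_in_finite)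
  have smas: "small_in (a \<union> \<Union>(set as))" using fin_sets_Union(3)[OF as] by simp
  have "ind_seq D ((a # as) @ [x])" using snoc.prems(1) by simp
  then have "ind_seq D (a # as)" "ind x D (\<Union>(set (a # as)))" by (simp_all only: indep_seq_snoc)
  then have "ind x (D \<union> a) (a \<union> \<Union>(set as))"
    using indep_base[of x D "a \<union> \<Union>(set as)" a] assms(2) x smas by simp
  then have "ind x (D \<union> a) (\<Union>(set as))"
    by (rule indep_mono) (use small_in_Un[OF assms(2) sma] x smas in auto)
  moreover have "ind_seq (D \<union> a) as" using snoc.IH \<open>ind_seq D (a # as)\<close> as by simp
  ultimately show ?case by (simp add: indep_seq_snoc)
qed simp

text \<open>The way back from \<open>indep_seq_Cons_base\<close>: transitivity, entry by entry,
  using that each entry is independent from a over D.\<close>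

lemma indep_seq_Cons_lift:
  assumes "ind_seq (D \<union> a) as" "small_in D" "fin_sets (a # as)" "\<And>x. x \<in> set as \<Longrightarrow> ind x D a"
  shows "ind_seq D (a # as)"
  using assms(1,3,4)
proof (induction as rule: rev_induct)
  case Nil
  then show ?case using indep_seq_single[OF assms(2)] by simp
next
  case (snoc x as)
  have as: "fin_sets as" and a: "finite a" "a \<subseteq> U" and x: "x \<subseteq> U" "finite x" using snoc.prems(2) by simp_all
  have "ind_seq (D \<union> a) as" "ind x (D \<union> a) (\<Union>(set as))"
    using snoc.prems(1) by (simp_all add: indep_seq_snoc)
  moreover have "ind x D a" using snoc.prems(3) by simp
  ultimately have "ind x D (a \<union> \<Union>(set as))"
    using assms(2) x a fin_sets_Union(1,2)[OF as] by (intro indep_trans) auto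
  moreover have "ind_seq D (a # as)" using snoc.IH \<open>ind_seq (D \<union> a) as\<close> snoc.prems(2,3) by simp
  ultimately have "ind_seq D ((a # as) @ [x])" by (simp only: indep_seq_snoc) simp
  then show ?case by simp
qed

lemma has_cycle_decrease:
  assumes "has_cycle (Suc m)" "m \<ge> 2"
  shows "has_cycle m"
proof -
  obtain D cs where D: "small_in D" and cs: "fin_sets cs" "length cs = Suc m" "is_cycle L M D cs"
    using assms(1) unfolding has_cycle_def by blast
  obtain a as where eq: "cs = a # as" using cs(2) by (cases cs) auto
  have fin: "fin_sets (a # as)" using cs(1) eq by simp
  have sma: "small_in a" using fin by (simp add: small_in_finite)
  have Da: "small_in (D \<union> a)" by (rule small_in_Un[OF D sma])
  have cyc: "\<not> ind_seq D (a # as)" "\<And>bs. strict_subseq bs (a # as) \<Longrightarrow> ind_seq D bs"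
    using cs(3) by (simp_all add: eq is_cycle_def)
  have "is_cycle L M (D \<union> a) as" unfolding is_cycle_def
  proof (intro conjI allI impI notI)
    fix bs assume bs: "strict_subseq bs as"
    then have "strict_subseq (a # bs) (a # as)" by (simp add: strict_subseq_def)
    then have "ind_seq D (a # bs)" by (rule cyc(2))
    moreover have "set bs \<subseteq> set as" using bs subseq_set[of bs as] by (simp add: strict_subseq_def)
    then have "fin_sets (a # bs)" using fin by (auto simp: fin_sets_def)
    ultimately show "ind_seq (D \<union> a) bs" using D by (intro indep_seq_Cons_base)
  next
    assume seq: "ind_seq (D \<union> a) as"
    have "ind x D a" if x: "x \<in> set as" for x
    proof -
      have "subseq [a, x] (a # as)" using x by (simp add: subseq_singleton_left)
      \<comment> \<open>Here m >= 2 enters: the pair is a proper subsequence of the cycle and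
        therefore independent.\<close>
      moreover have "[a, x] \<noteq> a # as" using cs(2) assms(2) eq by auto
      ultimately have "ind_seq D ([a] @ [x])" using cyc(2)[of "[a, x]"] by (simp add: strict_subseq_def)
      then show ?thesis unfolding indep_seq_snoc by simp
    qed
    then show False using cyc(1) indep_seq_Cons_lift[OF seq D fin] by blast
  qed
  then show ?thesis unfolding has_cycle_def using Da fin cs(2) eq by (intro exI[of _ "D \<union> a"] exI[of _ as]) simp
qed

lemma has_cycle_increase:
  assumes "has_cycle (Suc m)" "m \<ge> 2"
  obtains m' where "m' > Suc m" "has_cycle m'"
proof -
  obtain D cs where D: "small_in D" and cs: "fin_sets cs" "length cs = Suc m" "is_cycle L M D cs"
    using assms(1) unfolding has_cycle_def by blast
  obtain es c where eq: "cs = es @ [c]" "length es = m" using cs(2) by (cases cs rule: rev_cases) auto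
  have es: "fin_sets es" and c: "finite c" "c \<subseteq> U" using cs(1) eq by simp_all
  have cyc: "\<not> ind_seq D (es @ [c])" "\<And>us x vs. es @ [c] = us @ [x] @ vs \<Longrightarrow> ind_seq D (us @ vs)"
    using cs(3) is_cycle_iff[OF D cs(1)] by (simp_all add: eq)
  define E where "E = \<Union>(set es)"
  have E: "finite E" "E \<subseteq> U" unfolding E_def by (rule fin_sets_Union[OF es])+
  have smc: "small_in c" using c by (rule small_in_finite)
  have Dc: "small_in (D \<union> c)" by (rule small_in_Un[OF D smc])
  have seq_es: "ind_seq D es" using cyc(2)[of es c "[]"] by simp
  then have dep: "\<not> ind c D E" using cyc(1) by (simp add: indep_seq_snoc E_def)
  obtain N :: nat where N: "\<And>\<sigma>. (\<And>i. i < N \<Longrightarrow> \<sigma> i \<in> Aut (D \<union> c)) \<Longrightarrow>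
    \<exists>i<N. \<not> ind (\<Union>j<i. \<sigma> j ` E) D (\<sigma> i ` E)"
    using indep_weight[OF dep D E c] by metis
  define img where "img g = g ` E" for g :: "'c \<Rightarrow> 'c"
  have img: "finite (img g)" "img g \<subseteq> U" if "g \<in> Aut (D \<union> c)" for g
    using Aut_image_U[OF that E(2)] E(1) by (simp_all add: img_def)
  have fin_img: "fin_sets (map img ts)" if "set ts \<subseteq> Aut (D \<union> c)" for ts
    using img that by (auto simp: fin_sets_def)
  \<comment> \<open>In contrast to the proof of symmetry, these copies are independent over
    \<open>D \<union> c\<close>; existence followed by extension produces them.\<close>
  have "\<exists>ts. length ts = n \<and> set ts \<subseteq> Aut (D \<union> c) \<and> ind_seq (D \<union> c) (map img ts)" for n
  proof (induction n)
    case (Suc n)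
    then obtain ts where ts: "length ts = n" "set ts \<subseteq> Aut (D \<union> c)" "ind_seq (D \<union> c) (map img ts)"
      by blast
    let ?C = "\<Union>(set (map img ts))"
    have C: "finite ?C" "?C \<subseteq> U" by (rule fin_sets_Union[OF fin_img[OF ts(2)]])+
    obtain \<sigma> where \<sigma>: "\<sigma> \<in> Aut (D \<union> c \<union> {})" "ind (\<sigma> ` E) (D \<union> c) ({} \<union> ?C)"
      by (rule indep_extension[OF indep_empty[OF Dc E] Dc E finite.emptyI empty_subsetI C])
    then have "ind_seq (D \<union> c) (map img ts @ [img \<sigma>])" using ts(3) unfolding indep_seq_snoc by (simp add: img_def)
    then show ?case using ts \<sigma>(1) by (intro exI[of _ "ts @ [\<sigma>]"]) simp
  qed simp
  then obtain ts where ts: "length ts = N" "set ts \<subseteq> Aut (D \<union> c)" "ind_seq (D \<union> c) (map img ts)" by blast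
  have "\<not> ind_seq D (map img ts)"
  proof
    assume seq: "ind_seq D (map img ts)"
    have tsA: "ts ! i \<in> Aut (D \<union> c)" if "i < N" for i using ts(1,2) that by auto
    obtain i where i: "i < N" "\<not> ind (\<Union>j<i. (ts ! j) ` E) D ((ts ! i) ` E)" using N[of "(!) ts"] tsA by blast
    have "(\<Union>j<i. map img ts ! j) = (\<Union>j<i. (ts ! j) ` E)" using i(1) ts(1) by (simp add: img_def)
    then have "ind ((ts ! i) ` E) D (\<Union>j<i. (ts ! j) ` E)"
      using seq i(1) ts(1) unfolding indep_seq_def by (auto simp: img_def)
    moreover have "finite (\<Union>j<i. (ts ! j) ` E)" using E(1) by simp
    moreover have "(\<Union>j<i. (ts ! j) ` E) \<subseteq> U"
      using img(2)[OF tsA] i(1) by (intro UN_least) (simp add: img_def)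
    \<comment> \<open>\<open>indep_weight\<close> speaks of the earlier copies over the later one,
      an independent sequence of the converse; symmetry translates.\<close>
    ultimately have "ind (\<Union>j<i. (ts ! j) ` E) D ((ts ! i) ` E)"
      using indep_sym[of "(ts ! i) ` E" D "\<Union>j<i. (ts ! j) ` E"] D img[OF tsA[OF i(1)]] by (simp add: img_def)
    then show False using i(2) by simp
  qed
  then have "subseq ts ts \<and> \<not> ind_seq D (map img ts)" by simp
  \<comment> \<open>A dependent subsequence of least length: deleting any one copy from it leaves an
    independent sequence.\<close>
  then obtain fs where fs: "subseq fs ts \<and> \<not> ind_seq D (map img fs)"
    and min: "\<And>gs. subseq gs ts \<and> \<not> ind_seq D (map img gs) \<Longrightarrow> length fs \<le> length gs"
    using ex_has_least_nat[of "\<lambda>gs. subseq gs ts \<and> \<not> ind_seq D (map img gs)" ts length] by blast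
  have fsA: "set fs \<subseteq> Aut (D \<union> c)" using subseq_set[OF conjunct1[OF fs]] ts(2) by (rule subset_trans)
  have fs_c: "ind_seq (D \<union> c) (map img fs)"
    using fs by (intro indep_seq_subseq[OF Dc ts(3) fin_img[OF ts(2)]] subseq_map) simp
  have drop: "ind_seq D (map img (f1 @ f2))" if "fs = f1 @ [g] @ f2" for f1 g f2
  proof (rule ccontr)
    assume no: "\<not> ?thesis"
    have "subseq (f1 @ f2) (f1 @ [g] @ f2)" by (intro list_emb_append_mono) auto
    then have "subseq (f1 @ f2) ts" using fs that subseq_order.order_trans by blast
    then have "length fs \<le> length (f1 @ f2)" using min no by blast
    then show False using that by simp
  qed
  \<comment> \<open>A single copy is independent by existence, so dependence takes at least
    two.\<close>
  have len: "length fs \<ge> 2"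
  proof (rule ccontr)
    assume "\<not> ?thesis"
    then consider "fs = []" | g where "fs = [g]" by (cases fs; cases "tl fs") auto
    then show False
    proof cases
      case 1
      then show False using fs by simp
    next
      case 2
      then show False using fs fsA indep_seq_single[OF D] img by simp
    qed
  qed
  define Gs where "Gs = map (\<lambda>g. map ((`) g) es) fs"
  have fin_grp: "fin_sets (map ((`) g) xs)" if "g \<in> Aut (D \<union> c)" "fin_sets xs" for g xs
    using that Aut_image_U[OF that(1)] by (auto simp: fin_sets_def)
  have Union_img: "(\<lambda>G. \<Union>(set G)) (map ((`) g) xs) = g ` \<Union>(set xs)" for g :: "'c \<Rightarrow> 'c" and xs by auto
  have seq_grp: "ind_seq D (map ((`) g) xs)" if "g \<in> Aut (D \<union> c)" "fin_sets xs" "ind_seq D xs" for g xs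
    using indep_seq_Aut[OF D that(3,2) Aut_mono[OF that(1)]] by simp
  have Gs_fin: "fin_sets G" if "G \<in> set Gs" for G using that fin_grp es fsA by (auto simp: Gs_def)
  have Gs_map: "map (\<lambda>G. \<Union>(set G)) Gs = map img fs" by (simp add: Gs_def img_def E_def image_Union)
  have "\<not> ind_seq D (concat Gs)"
    using indep_seq_concat[OF D Gs_fin] fs Gs_map by simp
  moreover have "ind_seq D (us @ vs)" if uv: "concat Gs = us @ [x] @ vs" for us x vs
  proof -
    obtain G1 g1 g2 G2 where G: "Gs = G1 @ [g1 @ [x] @ g2] @ G2" "us = concat G1 @ g1" "vs = g2 @ concat G2"
      by (rule concat_eq_append_ConsE[OF uv])
    obtain f1 g f2 where f: "fs = f1 @ [g] @ f2" "G1 = map (\<lambda>g. map ((`) g) es) f1"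
      "g1 @ [x] @ g2 = map ((`) g) es" "G2 = map (\<lambda>g. map ((`) g) es) f2"
      using G(1) unfolding Gs_def by (auto simp: map_eq_append_conv map_eq_Cons_conv)
    obtain e1 y e2 where e: "es = e1 @ [y] @ e2" "g1 = map ((`) g) e1" "g2 = map ((`) g) e2"
      using f(3) by (auto simp: map_eq_append_conv append_eq_map_conv map_eq_Cons_conv Cons_eq_map_conv)
    have g: "g \<in> Aut (D \<union> c)" and f12: "set f1 \<subseteq> Aut (D \<union> c)" "set f2 \<subseteq> Aut (D \<union> c)"
      using fsA by (simp_all add: f(1))
    have gD: "g \<in> Aut D" by (rule Aut_mono[OF g]) simp
    \<comment> \<open>When the image of y is deleted, the copy made by g retains the image of
      \<open>?F\<close>; \<open>?O\<close> collects the other copies.\<close>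
    let ?F = "\<Union>(set (e1 @ e2))" let ?O = "\<Union>(set (map img f1)) \<union> \<Union>(set (map img f2))"
    have e12: "fin_sets (e1 @ e2)" using es by (simp add: e(1))
    have F: "finite ?F" "?F \<subseteq> U" "small_in ?F" by (rule fin_sets_Union[OF e12])+
    have "fin_sets (map img f1 @ map img f2)" using fin_img f12 by simp
    from fin_sets_Union[OF this] have O: "finite ?O" "?O \<subseteq> U" "small_in ?O" by simp_all
    \<comment> \<open>Deleting y from the given cycle leaves c independent from the remaining
      entries, and g fixes c, so the rest of the copy is independent from c over D. Over
      \<open>D \<union> c\<close> it is independent from the other copies; transitivity removes c
      from the base.\<close>
    have "ind_seq D ((e1 @ e2) @ [c])" using cyc(2)[of e1 y "e2 @ [c]"] by (simp add: e(1))
    then have seq_e: "ind_seq D (e1 @ e2)" and "ind c D ?F" by (simp_all only: indep_seq_snoc)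
    then have "ind ?F D c" using indep_sym[OF _ D c F(1,2)] by blast
    then have "ind (g ` ?F) D (g ` c)" by (rule indep_Aut[OF _ gD D F(1,2) c])
    moreover have "g ` c = c" by (rule Aut_fix_image[OF g]) simp
    ultimately have 1: "ind (g ` ?F) D c" by simp
    have gF: "finite (g ` ?F)" "g ` ?F \<subseteq> U" using F(1) Aut_image_U[OF g F(2)] by simp_all
    have "ind_seq (D \<union> c) (map img f1 @ [img g] @ map img f2)" using fs_c by (simp add: f(1))
    then have "ind (img g) (D \<union> c) ?O"
      using indep_seq_insert[OF Dc fin_img[OF f12(1)] fin_img[OF f12(2)] img[OF g]] by blast
    then have "ind (g ` ?F) (D \<union> c) ?O"
      by (rule indep_mono) (use Dc img(2)[OF g] O(3) in \<open>auto simp: img_def E_def e(1)\<close>)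
    from indep_trans[OF 1 this D gF c O(1,2)]
    have "ind (g ` ?F) D ?O"
      by (rule indep_mono) (use D gF(2) small_in_Un[OF smc O(3)] in auto)
    \<comment> \<open>By minimality of \<open>fs\<close> the other copies are independent over D, so
      the shortened copy can be inserted among them.\<close>
    then have seq_img: "ind_seq D (map img f1 @ [g ` ?F] @ map img f2)"
      using indep_seq_insert[OF D fin_img[OF f12(1)] fin_img[OF f12(2)] gF] drop[OF f(1)] by simp
    let ?H = "G1 @ [map ((`) g) (e1 @ e2)] @ G2"
    have "map (\<lambda>G. \<Union>(set G)) (G1 @ [map ((`) g) (e1 @ e2)] @ G2) = map img f1 @ [g ` ?F] @ map img f2"
      by (simp add: f img_def E_def image_Union image_Un)
    then have H_map: "ind_seq D (map (\<lambda>G. \<Union>(set G)) ?H)" using seq_img by (simp only:)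
    have H: "\<forall>G\<in>set (G1 @ [map ((`) g) (e1 @ e2)] @ G2). fin_sets G \<and> ind_seq D G"
    proof
      fix G assume "G \<in> set (G1 @ [map ((`) g) (e1 @ e2)] @ G2)"
      then consider "G = map ((`) g) (e1 @ e2)" | \<eta> where "\<eta> \<in> Aut (D \<union> c)" "G = map ((`) \<eta>) es"
        using f12 by (auto simp: f)
      then show "fin_sets G \<and> ind_seq D G"
      proof cases
        case 1
        then show ?thesis using fin_grp[OF g e12] seq_grp[OF g e12 seq_e] by simp
      next
        case 2
        then show ?thesis using fin_grp[OF 2(1) es] seq_grp[OF 2(1) es seq_es] by simp
      qed
    qed
    then have H_fin: "\<And>G. G \<in> set ?H \<Longrightarrow> fin_sets G" and H_seq: "\<forall>G\<in>set ?H. ind_seq D G" by blast+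
    have "ind_seq D (concat ?H)" using indep_seq_concat[OF D H_fin] H_seq H_map by blast
    then show ?thesis by (simp add: G(2,3) e(2,3))
  qed
  moreover have fin_Gs: "fin_sets (concat Gs)" using Gs_fin by (auto simp: fin_sets_def)
  ultimately have "is_cycle L M D (concat Gs)" using is_cycle_iff[OF D fin_Gs] by blast
  moreover have "length (concat Gs) = length fs * m"
    unfolding Gs_def eq(2)[symmetric] by (induction fs) simp_all
  ultimately have "has_cycle (length fs * m)" unfolding has_cycle_def using D fin_Gs by blast
  \<comment> \<open>For m >= 2 the product 2 m exceeds m + 1, so the new cycle is longer.\<close>
  moreover have "2 * m \<le> length fs * m" using len by simp
  then have "length fs * m > Suc m" using assms(2) by linarith
  ultimately show ?thesis using that by blast
qed

text \<open>Lengthening does not control the new length but makes the lengths unbounded; shortening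
  by one entry at a time then reaches every smaller length from 2 on.\<close>

lemma has_cycle_iff:
  assumes "k \<ge> 1"
  shows "has_cycle (k + 2) \<longleftrightarrow> has_cycle 3"
proof
  have down: "has_cycle (m + d) \<Longrightarrow> m \<ge> 2 \<Longrightarrow> has_cycle m" for m d
  proof (induction d)
    case (Suc d)
    then show ?case using has_cycle_decrease[of "m + d"] by simp
  qed simp
  { assume "has_cycle (k + 2)"
    then show "has_cycle 3" using down[of 3 "k - 1"] assms by simp }
  { assume c3: "has_cycle 3"
    have "\<exists>m\<ge>n + 3. has_cycle m" for n
    proof (induction n)
      case (Suc n)
      then obtain m where m: "m \<ge> n + 3" "has_cycle m" by blast
      then have "has_cycle (Suc (m - 1))" "m - 1 \<ge> 2" by simp_all
      from has_cycle_increase[OF this] obtain m' where "m' > m" "has_cycle m'" using m(1) by auto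
      then show ?case using m(1) by (intro exI[of _ m']) simp
    qed (use c3 in auto)
    then obtain m where m: "m \<ge> k + 3" "has_cycle m" by blast
    then obtain d where "m = (k + 2) + d" using le_Suc_ex[of "k + 2" m] by auto
    then show "has_cycle (k + 2)" using down[of "k + 2" d] m(2) by simp }
qed

section \<open>Reduction of small tuples to finite ones\<close>

lemma small_in_Union_list: "(\<And>A. A \<in> set as \<Longrightarrow> small_in A) \<Longrightarrow> small_in (\<Union>(set as))"
  by (induction as) (auto intro: small_in_Un small_in_finite)

lemma indep_seq_mono:
  assumes "small_in D" "ind_seq D bs" "list_all2 (\<subseteq>) as bs" "\<And>A. A \<in> set bs \<Longrightarrow> small_in A"
  shows "ind_seq D as"
  using assms(2-4)
proof (induction bs arbitrary: as rule: rev_induct)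
  case (snoc y bs)
  obtain as' x where as: "as = as' @ [x]" "list_all2 (\<subseteq>) as' bs" "x \<subseteq> y"
    using snoc.prems(2) by (auto simp: list_all2_append2 list_all2_Cons2)
  have bs: "ind_seq D bs" "ind y D (\<Union>(set bs))" using snoc.prems(1) by (simp_all add: indep_seq_snoc)
  have "\<Union>(set as') \<subseteq> \<Union>(set bs)"
    using as(2) by (induction rule: list_all2_induct) auto
  moreover have "small_in (\<Union>(set bs))" using snoc.prems(3) by (intro small_in_Union_list) simp
  moreover have "y \<subseteq> U" using snoc.prems(3) by (simp add: small_inD)
  ultimately have "ind x D (\<Union>(set as'))"
    using as(3) assms(1) by (intro indep_mono[OF bs(2)]) auto
  moreover have "ind_seq D as'" using snoc.IH[OF bs(1) as(2)] snoc.prems(3) by simp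
  ultimately show ?case by (simp add: as(1) indep_seq_snoc)
qed simp

lemma is_cycle_finite:
  assumes D: "small_in D" and as: "\<And>A. A \<in> set as \<Longrightarrow> small_in A" and cyc: "is_cycle L M D as"
  shows "has_cycle (length as)"
proof -
  have "\<not> ind_seq D as" using cyc by (simp add: is_cycle_def)
  then obtain i where i: "i < length as" "\<not> ind (as ! i) D (\<Union>j<i. as ! j)"
    unfolding indep_seq_def by blast
  have small_in_part: "small_in (\<Union>(set bs))" if "set bs \<subseteq> set as" for bs using that as by (intro small_in_Union_list) auto
  have "small_in (\<Union>(set (take i as)))" by (rule small_in_part[OF set_take_subset])
  moreover have "\<Union>(set (take i as)) = (\<Union>j<i. as ! j)" using i(1) by (simp add: nth_image[symmetric] atLeast0LessThan)
  ultimately have smB: "small_in (\<Union>j<i. as ! j)" by simp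
  have "as ! i \<subseteq> U" using as[OF nth_mem[OF i(1)]] by (rule small_inD)
  then obtain A' B' where AB: "finite A'" "A' \<subseteq> as ! i" "finite B'" "B' \<subseteq> (\<Union>j<i. as ! j)" "\<not> ind A' D B'"
    using not_indep_finite[OF i(2) D _ smB] by metis
  \<comment> \<open>Dependence at position i survives on a finite part of that entry and finite
    parts of the earlier ones. Later entries are emptied to keep the length. Shrinking entries
    preserves the independence of the sequences with one entry deleted.\<close>
  define f where "f j = (if j < i then as ! j \<inter> B' else if j = i then A' else {})" for j
  define as' where "as' = map f [0..<length as]"
  have all2: "list_all2 (\<subseteq>) as' as" using AB(2) by (auto simp: list_all2_conv_all_nth as'_def f_def)
  have fin: "fin_sets as'" unfolding fin_sets_def
  proof
    fix A assume "A \<in> set as'"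
    then obtain j where j: "j < length as" "A = f j" by (auto simp: as'_def)
    have "as ! j \<subseteq> U" using as[OF nth_mem[OF j(1)]] by (rule small_inD)
    then show "finite A \<and> A \<subseteq> U" using AB(1-3) by (auto simp: j(2) f_def)
  qed
  have "(\<Union>j<i. as' ! j) = B'"
  proof -
    have "(\<Union>j<i. as' ! j) = (\<Union>j<i. as ! j \<inter> B')" using i(1) by (simp add: as'_def f_def)
    also have "\<dots> = (\<Union>j<i. as ! j) \<inter> B'" by blast
    also have "\<dots> = B'" using AB(4) by (rule Int_absorb1)
    finally show ?thesis .
  qed
  moreover have "as' ! i = A'" "i < length as'" using i(1) by (simp_all add: as'_def f_def)
  ultimately have "\<not> ind_seq D as'" unfolding indep_seq_def using AB(5) by metis
  moreover have "ind_seq D (us' @ vs')" if uv: "as' = us' @ [x'] @ vs'" for us' x' vs'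
  proof -
    obtain us x vs where eq: "as = us @ [x] @ vs" "list_all2 (\<subseteq>) us' us" "list_all2 (\<subseteq>) vs' vs"
      using all2 unfolding uv by (auto simp: list_all2_append1 list_all2_Cons1)
    have "subseq (us @ vs) (us @ [x] @ vs)" by (intro list_emb_append_mono) auto
    then have "strict_subseq (us @ vs) as" by (simp add: eq(1) strict_subseq_def)
    then have "ind_seq D (us @ vs)" using cyc by (simp add: is_cycle_def)
    moreover have "list_all2 (\<subseteq>) (us' @ vs') (us @ vs)" using eq(2,3) by (rule list_all2_appendI)
    moreover have "small_in A" if "A \<in> set (us @ vs)" for A using that by (intro as) (auto simp: eq(1))
    ultimately show ?thesis by (rule indep_seq_mono[OF D])
  qed
  ultimately have "is_cycle L M D as'" using is_cycle_iff[OF D fin] by blast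
  then show ?thesis unfolding has_cycle_def using D fin by (intro exI[of _ D] exI[of _ as']) (simp add: as'_def)
qed

text \<open>Finite sets satisfy every bound \<mu> from aleph_0 on, and every cycle of small sets
  shrinks to a cycle of finite sets of the same length, so all \<mu> up to \<kappa> give the same
  notion.\<close>

lemma k_trivial_iff:
  fixes \<mu> :: "'l rel"
  assumes "natLeq \<le>o \<mu>" "\<mu> \<le>o \<kappa>"
  shows "k_trivial L \<kappa> \<mu> M k \<longleftrightarrow> \<not> has_cycle (k + 2)"
proof -
  have fin_cyc: "has_cycle (k + 2)" if "small_in D" "length as = k + 2" "\<forall>A\<in>set as. A \<subseteq> U \<and> |A| <o \<mu>" "is_cycle L M D as" for D as
  proof -
    have "small_in A" if "A \<in> set as" for A
      using \<open>\<forall>A\<in>set as. A \<subseteq> U \<and> |A| <o \<mu>\<close> that ordLess_ordLeq_trans[OF _ assms(2)]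
      by (auto simp: small_in_def small_def)
    from is_cycle_finite[OF that(1) this that(4)] show ?thesis using that(2) by simp
  qed
  have fin: "|A| <o \<mu>" if "finite A" for A :: "'c set"
    using that assms(1) finite_iff_ordLess_natLeq ordLess_ordLeq_trans by blast
  have "(\<exists>D as. D \<subseteq> U \<and> small \<kappa> D \<and> length as = k + 2 \<and>
      (\<forall>A\<in>set as. A \<subseteq> U \<and> |A| <o \<mu>) \<and> is_cycle L M D as) \<longleftrightarrow> has_cycle (k + 2)"
  proof (intro iffI)
    assume "has_cycle (k + 2)"
    then obtain D as where "small_in D" "fin_sets as" "length as = k + 2" "is_cycle L M D as"
      unfolding has_cycle_def by (elim exE conjE)
    moreover have "\<forall>A\<in>set as. A \<subseteq> U \<and> |A| <o \<mu>"
      using \<open>fin_sets as\<close> fin by (simp add: fin_sets_def)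
    ultimately show "\<exists>D as. D \<subseteq> U \<and> small \<kappa> D \<and> length as = k + 2 \<and>
        (\<forall>A\<in>set as. A \<subseteq> U \<and> |A| <o \<mu>) \<and> is_cycle L M D as"
      by (intro exI[of _ D] exI[of _ as]) (simp add: small_in_def)
  qed (elim exE conjE, rule fin_cyc, simp_all add: small_in_def)
  then show ?thesis unfolding k_trivial_def by simp
qed

end

theorem theorem2p18:
  fixes L :: "('f, 'r) language" and T :: "('f, 'r) fm set"
    and M :: "('f, 'r, 'm) struct" and \<kappa> :: "'k rel" and \<mu> :: "'l rel"
  assumes "complete_theory L T"
    and "monster_model L T \<kappa> M"
    and "simple_theory L M"
    and "Card_order \<mu>" and "natLeq \<le>o \<mu>" and "\<mu> \<le>o \<kappa>"
  shows "\<forall>k\<ge>1. k_trivial L \<kappa> \<mu> M 1 \<longleftrightarrow> k_trivial L \<kappa> \<mu> M k"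
proof -
  interpret simple_monster L T M \<kappa>
    using assms(2,3) by unfold_locales
  show ?thesis
  proof (intro allI impI)
    fix k :: nat assume k: "k \<ge> 1"
    show "k_trivial L \<kappa> \<mu> M 1 \<longleftrightarrow> k_trivial L \<kappa> \<mu> M k"
      using has_cycle_iff[OF k] has_cycle_iff[of 1] by (simp add: k_trivial_iff[OF assms(5,6)])
  qed
qed

end
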